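(* Let $G$ be of type $D_n$, let $\mathbf{i}_0=(1\,2\cdots n-1\,n)^{n-1}$, let $c=(c^{(m)}_i)_{1\le i\le n,\,1\le m\le n-1}\in(\mathbb{C}^\times)^{n(n-1)}$, and let $k\in\{1,2,\dots,n-2\}$. Then $$\Delta_{w_0s_k\Lambda_k,\Lambda_k}(\Theta^-_{\mathbf{i}_0}(c))=\frac{1}{c^{(k)}_1}+\sum_{j=1}^{k-1}\frac{c^{(j)}_{k-j}}{c^{(j)}_{k-j+1}}.$$
   Context: $G$ is the simply connected simple algebraic group over $\mathbb{C}$ of type $D_n$ ($n\ge4$), $I=\{1,\dots,n\}$, with Chevalley generators $e_i,f_i,h_i$ of its Lie algebra, simple roots $\alpha_i$, fundamental weights $\Lambda_i$ ($\Lambda_i(h_j)=\delta_{ij}$), and Cartan matrix $a_{ij}=\alpha_j(h_i)$ given by $a_{ii}=2$; $a_{ij}=-1$ if $|i-j|=1$ and $\{i,j\}\ne\{n-1,n\}$, or $\{i,j\}=\{n-2,n\}$; $0$ otherwise. $T$ is the maximal torus, $U^{\pm}$ the unipotent subgroups generated by $x_i(t)=\exp(te_i)$, resp. $y_i(t)=\exp(tf_i)$; $\alpha_i^\vee:\mathbb{C}^\times\to T$ is the coroot one-parameter subgroup. $W$ is the Weyl group, $s_i$ the simple reflections, $w_0$ the longest element. Set $\overline{s}_i=x_i(-1)y_i(1)x_i(-1)$ and $\overline{w}=\overline{s}_{i_1}\cdots\overline{s}_{i_l}$ for any reduced expression $w=s_{i_1}\cdots s_{i_l}$. Generalized minors: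 $\Delta_{\Lambda_i}$ is the regular function on $G$ with $\Delta_{\Lambda_i}(u^-tu^+)=\Lambda_i(t)$ for $u^\pm\in U^\pm$, $t\in T$; for $u,v\in W$, $\Delta_{u\Lambda_i,v\Lambda_i}(g)=\Delta_{\Lambda_i}(\overline{u}^{-1}g\,\overline{v})$ (so $\Delta_{w_0s_k\Lambda_k,\Lambda_k}(g)=\Delta_{\Lambda_k}(\overline{w_0s_k}^{\,-1}g)$). Set $\mathbf{y}_i(c)=y_i(c)\alpha_i^\vee(c^{-1})$. The word $\mathbf{i}_0=(12\cdots n)^{n-1}$ is a reduced word of $w_0$ and $$\Theta^-_{\mathbf{i}_0}(c)=\prod_{m=1}^{n-1}\mathbf{y}_1(c^{(m)}_1)\mathbf{y}_2(c^{(m)}_2)\cdots\mathbf{y}_n(c^{(m)}_n),$$ the factors for $m=1,2,\dots,n-1$ being multiplied from left to right. *)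

theory Defs
  imports "HOL-Analysis.Analysis"
begin

text \<open>
  The simply connected group of type D is not available as a library object.  It is described
  through its closed embeddings into a general linear group (Chevalley and Steinberg): \<open>G\<close> is the
  group of matrices generated by the one-parameter groups of Chevalley generators of its Lie algebra
  in a finite-dimensional representation.  Such a group is the simply connected one exactly when
  the weights of the representation generate the whole weight lattice.  The basis of the
  representation space consists of weight vectors and is indexed by the type \<open>'m\<close>.
\<close>

definition cartan :: "nat \<Rightarrow> nat \<Rightarrow> nat \<Rightarrow> int" where
  "cartan n i j =
    (if i \<in> {1..n} \<and> j \<in> {1..n} then
       if i = j then 2
       else if (i = j + 1 \<or> j = i + 1) \<and> {i, j} \<noteq> {n - 1, n} then - 1
       else if {i, j} = {n - 2, n} then - 1
       else 0
     else 0)"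


subsection \<open>Matrices\<close>

definition cscale :: "complex \<Rightarrow> complex^'m^'m \<Rightarrow> complex^'m^'m" where
  "cscale z A = (\<chi> a b. z * A $ a $ b)"

definition commutator :: "complex^'m^'m \<Rightarrow> complex^'m^'m \<Rightarrow> complex^'m::finite^'m" where
  "commutator A B = A ** B - B ** A"

text \<open>The library's \<open>exp\<close> and \<open>^\<close> would refer to the componentwise product of vectors.\<close>

definition mpower :: "complex^'m^'m \<Rightarrow> nat \<Rightarrow> complex^'m::finite^'m" where
  "mpower A k = ((\<lambda>B. A ** B) ^^ k) (mat 1)"

definition mexp :: "complex^'m^'m \<Rightarrow> complex^'m::finite^'m" where
  "mexp A = (\<Sum>k. (1 / fact k) *\<^sub>R mpower A k)"

definition mprod :: "(complex^'m^'m) list \<Rightarrow> complex^'m::finite^'m" where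
  "mprod As = foldr (**) As (mat 1)"

inductive_set generated_group :: "(complex^'m^'m) set \<Rightarrow> (complex^'m::finite^'m) set"
  for S where
  one: "mat 1 \<in> generated_group S"
| gen: "A \<in> S \<Longrightarrow> A \<in> generated_group S"
| mult: "A \<in> generated_group S \<Longrightarrow> B \<in> generated_group S \<Longrightarrow> A ** B \<in> generated_group S"
| inv: "A \<in> generated_group S \<Longrightarrow> matrix_inv A \<in> generated_group S"

inductive polynomial_map :: "(complex^'m^'m \<Rightarrow> complex) \<Rightarrow> bool" where
  const: "polynomial_map (\<lambda>_. z)"
| entry: "polynomial_map (\<lambda>A. A $ a $ b)"
| add: "polynomial_map p \<Longrightarrow> polynomial_map q \<Longrightarrow> polynomial_map (\<lambda>A. p A + q A)"
| mult: "polynomial_map p \<Longrightarrow> polynomial_map q \<Longrightarrow> polynomial_map (\<lambda>A. p A * q A)"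


subsection \<open>The group and its subgroups\<close>

text \<open>
  \<open>wt a i\<close> is the value at the coroot \<open>h_i\<close> of the weight of the basis vector with index \<open>a\<close>.
\<close>

definition hmat :: "('m \<Rightarrow> nat \<Rightarrow> int) \<Rightarrow> nat \<Rightarrow> complex^'m::finite^'m" where
  "hmat wt i = (\<chi> a b. if a = b then of_int (wt a i) else 0)"

text \<open>
  The last conjunct says that every fundamental weight is an integral combination of weights of
  the representation, that is, the character group of the torus is the whole weight lattice.  It
  also makes the representation of the (simple) Lie algebra nonzero, hence faithful.
\<close>

definition simply_connected_D ::
    "nat \<Rightarrow> (nat \<Rightarrow> complex^'m^'m) \<Rightarrow> (nat \<Rightarrow> complex^'m^'m) \<Rightarrow> ('m::finite \<Rightarrow> nat \<Rightarrow> int) \<Rightarrow> bool"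
  where
  "simply_connected_D n e f wt \<longleftrightarrow>
     (\<forall>i\<in>{1..n}. \<forall>j\<in>{1..n}.
        commutator (hmat wt i) (hmat wt j) = 0
      \<and> commutator (hmat wt i) (e j) = cscale (of_int (cartan n i j)) (e j)
      \<and> commutator (hmat wt i) (f j) = cscale (- of_int (cartan n i j)) (f j)
      \<and> commutator (e i) (f j) = (if i = j then hmat wt i else 0)
      \<and> (i \<noteq> j \<longrightarrow> (commutator (e i) ^^ nat (1 - cartan n i j)) (e j) = 0)
      \<and> (i \<noteq> j \<longrightarrow> (commutator (f i) ^^ nat (1 - cartan n i j)) (f j) = 0))
   \<and> (\<forall>j\<in>{1..n}. \<exists>m :: 'm \<Rightarrow> int. \<forall>i\<in>{1..n}.
        (\<Sum>a\<in>UNIV. m a * wt a i) = (if i = j then 1 else 0))"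

text \<open>
  With \<open>e\<close> this is \<open>x_i(t)\<close>, with \<open>f\<close> it is \<open>y_i(t)\<close>.
\<close>

definition one_param :: "(nat \<Rightarrow> complex^'m^'m) \<Rightarrow> nat \<Rightarrow> complex \<Rightarrow> complex^'m::finite^'m" where
  "one_param e i t = mexp (cscale t (e i))"

text \<open>
  The coroot subgroup: for \<open>c = exp z\<close> this is the exponential of \<open>z h_i\<close>.
\<close>

definition coroot :: "('m \<Rightarrow> nat \<Rightarrow> int) \<Rightarrow> nat \<Rightarrow> complex \<Rightarrow> complex^'m::finite^'m" where
  "coroot wt i c = (\<chi> a b. if a = b then c powi (wt a i) else 0)"

definition torus_element ::
    "nat \<Rightarrow> ('m \<Rightarrow> nat \<Rightarrow> int) \<Rightarrow> (nat \<Rightarrow> complex) \<Rightarrow> complex^'m::finite^'m" where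
  "torus_element n wt t = mprod (map (\<lambda>i. coroot wt i (t i)) [1..<Suc n])"

definition unipotent :: "nat \<Rightarrow> (nat \<Rightarrow> complex^'m^'m) \<Rightarrow> (complex^'m::finite^'m) set" where
  "unipotent n e = generated_group {one_param e i t | i t. i \<in> {1..n}}"

definition group_G ::
    "nat \<Rightarrow> (nat \<Rightarrow> complex^'m^'m) \<Rightarrow> (nat \<Rightarrow> complex^'m^'m) \<Rightarrow> (complex^'m::finite^'m) set" where
  "group_G n e f =
     generated_group ({one_param e i t | i t. i \<in> {1..n}} \<union> {one_param f i t | i t. i \<in> {1..n}})"


subsection \<open>The Weyl group\<close>

text \<open>
  A weight is given by its values at the coroots \<open>h_1, ..., h_n\<close>, so that the simple root with
  index \<open>i\<close> is the function \<open>\<lambda>j. cartan n j i\<close>.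
\<close>

definition simple_refl :: "nat \<Rightarrow> nat \<Rightarrow> (nat \<Rightarrow> int) \<Rightarrow> (nat \<Rightarrow> int)" where
  "simple_refl n i lam = (\<lambda>j. lam j - lam i * cartan n j i)"

definition word_refl :: "nat \<Rightarrow> nat list \<Rightarrow> (nat \<Rightarrow> int) \<Rightarrow> (nat \<Rightarrow> int)" where
  "word_refl n is = foldr (\<lambda>i w. simple_refl n i \<circ> w) is id"

definition weyl_group :: "nat \<Rightarrow> ((nat \<Rightarrow> int) \<Rightarrow> (nat \<Rightarrow> int)) set" where
  "weyl_group n = {word_refl n is | is. set is \<subseteq> {1..n}}"

definition weyl_length :: "nat \<Rightarrow> ((nat \<Rightarrow> int) \<Rightarrow> (nat \<Rightarrow> int)) \<Rightarrow> nat" where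
  "weyl_length n w = (LEAST l. \<exists>is. set is \<subseteq> {1..n} \<and> word_refl n is = w \<and> length is = l)"

definition reduced_word :: "nat \<Rightarrow> nat list \<Rightarrow> ((nat \<Rightarrow> int) \<Rightarrow> (nat \<Rightarrow> int)) \<Rightarrow> bool" where
  "reduced_word n is w \<longleftrightarrow>
     set is \<subseteq> {1..n} \<and> word_refl n is = w \<and> length is = weyl_length n w"

definition longest_element :: "nat \<Rightarrow> ((nat \<Rightarrow> int) \<Rightarrow> (nat \<Rightarrow> int)) \<Rightarrow> bool" where
  "longest_element n w \<longleftrightarrow>
     w \<in> weyl_group n \<and> (\<forall>v\<in>weyl_group n. weyl_length n v \<le> weyl_length n w)"

definition sbar ::
    "(nat \<Rightarrow> complex^'m^'m) \<Rightarrow> (nat \<Rightarrow> complex^'m^'m) \<Rightarrow> nat \<Rightarrow> complex^'m::finite^'m" where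
  "sbar e f i = one_param e i (- 1) ** one_param f i 1 ** one_param e i (- 1)"

text \<open>
  The elements \<open>sbar e f i\<close> satisfy the braid relations, so the choice of the reduced word does
  not matter.
\<close>

definition wbar ::
    "nat \<Rightarrow> (nat \<Rightarrow> complex^'m^'m) \<Rightarrow> (nat \<Rightarrow> complex^'m^'m)
      \<Rightarrow> ((nat \<Rightarrow> int) \<Rightarrow> (nat \<Rightarrow> int)) \<Rightarrow> complex^'m::finite^'m" where
  "wbar n e f w = mprod (map (sbar e f) (SOME is. reduced_word n is w))"


subsection \<open>Generalized minors\<close>

text \<open>
  \<open>principal_minor n e f wt i D\<close> says that \<open>D\<close> is the minor belonging to the fundamental weight
  with index \<open>i\<close>.  As the group is simply connected, \<open>torus_element n wt\<close> is an isomorphism from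
  the tuples of nonzero numbers onto the maximal torus, and the fundamental weight with index \<open>i\<close>,
  being 1 at \<open>h_i\<close> and 0 at the other coroots, becomes the projection to the coordinate \<open>t i\<close>.
  The group is closed in the special linear group, so its regular functions are the restrictions
  of polynomials in the matrix entries.  The two conditions determine \<open>D\<close> on \<open>G\<close> because the set of
  the products below is dense.
\<close>

definition principal_minor ::
    "nat \<Rightarrow> (nat \<Rightarrow> complex^'m^'m) \<Rightarrow> (nat \<Rightarrow> complex^'m^'m) \<Rightarrow> ('m::finite \<Rightarrow> nat \<Rightarrow> int)
      \<Rightarrow> nat \<Rightarrow> (complex^'m^'m \<Rightarrow> complex) \<Rightarrow> bool" where
  "principal_minor n e f wt i D \<longleftrightarrow>
     (\<exists>p. polynomial_map p \<and> (\<forall>g\<in>group_G n e f. D g = p g))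
   \<and> (\<forall>u\<in>unipotent n f. \<forall>v\<in>unipotent n e. \<forall>t. (\<forall>j\<in>{1..n}. t j \<noteq> 0) \<longrightarrow>
        D (u ** torus_element n wt t ** v) = t i)"

text \<open>
  If \<open>D\<close> is the principal minor for the fundamental weight with index \<open>i\<close>, this is the generalized
  minor for the pair of its images under \<open>u\<close> and \<open>v\<close>.
\<close>

definition gen_minor ::
    "nat \<Rightarrow> (nat \<Rightarrow> complex^'m^'m) \<Rightarrow> (nat \<Rightarrow> complex^'m^'m) \<Rightarrow> (complex^'m^'m \<Rightarrow> complex)
      \<Rightarrow> ((nat \<Rightarrow> int) \<Rightarrow> (nat \<Rightarrow> int)) \<Rightarrow> ((nat \<Rightarrow> int) \<Rightarrow> (nat \<Rightarrow> int))
      \<Rightarrow> complex^'m::finite^'m \<Rightarrow> complex" where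
  "gen_minor n e f D u v g = D (matrix_inv (wbar n e f u) ** g ** wbar n e f v)"

definition ybold ::
    "(nat \<Rightarrow> complex^'m^'m) \<Rightarrow> ('m \<Rightarrow> nat \<Rightarrow> int) \<Rightarrow> nat \<Rightarrow> complex \<Rightarrow> complex^'m::finite^'m" where
  "ybold f wt i c = one_param f i c ** coroot wt i (inverse c)"

text \<open>\<open>c m i\<close> is the variable with upper index \<open>m\<close> and lower index \<open>i\<close>.\<close>

definition Theta_minus ::
    "nat \<Rightarrow> (nat \<Rightarrow> complex^'m^'m) \<Rightarrow> ('m \<Rightarrow> nat \<Rightarrow> int) \<Rightarrow> (nat \<Rightarrow> nat \<Rightarrow> complex)
      \<Rightarrow> complex^'m::finite^'m" where
  "Theta_minus n f wt c =
     mprod (map (\<lambda>m. mprod (map (\<lambda>i. ybold f wt i (c m i)) [1..<Suc n])) [1..<n])"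

end

(*
The factor y_i(c) alpha_i(1/c) equals x_i(1/c) s_i x_i(c), where s_i is the lift of the simple
reflection.  Moving all x_i(c) to the right turns Theta into u n u' with u, u' unipotent upper
triangular and n the lift of w_0.  The minor for (w_0 s_k, id) is left invariant under x_j(t) for
j different from k, and along x_k(t) it is linear with coefficient the lowest minor, which is 1 on
n; hence its value is the coefficient of u at the simple root with index k.  This coefficient is
computed one Coxeter block 1 2 ... n at a time: a block sends the coefficient with index k - 1 to
the one with index k and adds c_{k-1}/c_k.

Only the values of the minor D for (id, id) on the big cell and its being a polynomial are used.
Two tricks make this suffice.  A product of x_i(t), y_i(t) with positive t lies in the big cell, so
the big cell is dense.  Invariance of D(w^{-1} g) under a root subgroup is shown by conjugating
with the one-parameter group of the sum of the positive coroots and letting the parameter tend to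
a limit in which the root subgroup element becomes 1.

That the lift of w_0 does not depend on the reduced word is Matsumoto's theorem, proved along paths
of the form w(rho): a word is reduced if each letter lowers the weight reached so far.
*)
theory Submission
  imports Defs "HOL-Computational_Algebra.Polynomial"
begin

section \<open>Matrices as a normed algebra\<close>

text \<open>The representation is arbitrary, so the minor is not a known matrix entry of a
  fundamental representation; every rule for it has to come from its values on the products
  \<open>Y u * tor t * X v\<close>. Root subgroups of non-simple roots occur only as conjugates
  \<open>swi is * x j t * sw is\<close>. Unipotent factors are kept as words in simple letters:
  moving \<open>sb i\<close> through such a word gives another one, in which a commutator stands for
  the root \<open>\<alpha>\<^sub>i + \<alpha>\<^sub>j\<close>. The wanted coefficient is therefore a
  function on words, computed by recursion. The condition \<open>k \<le> n - 2\<close> enters in two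
  ways. First, w_0 sends \<open>\<alpha>\<^sub>k\<close> to its negative, so w_0 and s_k commute;
  hence a reduced word of w_0 s_k, prefixed with \<open>k\<close>, is one of w_0, and
  \<open>x k\<close> is the one simple direction in which the minor varies on the left. Second, the
  indices up to \<open>k\<close> lie on the chain of the diagram, so the fork at its end does not
  disturb the recursion for the coefficients.\<close>

text \<open>
  A copy of the square matrices on which \<open>*\<close> is the matrix product, so that the library's \<open>exp\<close>
  and its derivative rules apply.
\<close>

typedef 'm cm = "UNIV :: (complex^'m^'m) set"
  morphisms mat_of cm_of by auto

setup_lifting type_definition_cm

instantiation cm :: (finite) ring_1
begin
lift_definition zero_cm :: "'a cm" is 0 .
lift_definition one_cm :: "'a cm" is "mat 1" .
lift_definition plus_cm :: "'a cm \<Rightarrow> 'a cm \<Rightarrow> 'a cm" is "(+)" .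
lift_definition minus_cm :: "'a cm \<Rightarrow> 'a cm \<Rightarrow> 'a cm" is "(-)" .
lift_definition uminus_cm :: "'a cm \<Rightarrow> 'a cm" is "uminus" .
lift_definition times_cm :: "'a cm \<Rightarrow> 'a cm \<Rightarrow> 'a cm" is "(**)" .
instance
proof
  show "(0::'a cm) \<noteq> 1"
    by transfer (auto simp: mat_def vec_eq_iff)
  fix A B E :: "'a cm"
  show "A * B * E = A * (B * E)"
    by transfer (simp add: matrix_mul_assoc)
  show "1 * A = A" "A * 1 = A" by (transfer; simp)+
  show "A + B + E = A + (B + E)" "A + B = B + A" "0 + A = A" "- A + A = 0" "A - B = A + - B"
    by (transfer; simp)+
  show "(A + B) * E = A * E + B * E"
    by transfer (simp add: matrix_matrix_mult_def vec_eq_iff sum.distrib algebra_simps)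
  show "A * (B + E) = A * B + A * E"
    by transfer (simp add: matrix_add_ldistrib)
qed
end

text \<open>The operator norm is submultiplicative and gives the identity norm 1, as the class
  demands; the Euclidean norm of the entries fails the second demand as soon as the size exceeds
  1.\<close>

instantiation cm :: (finite) real_normed_algebra_1
begin
lift_definition scaleR_cm :: "real \<Rightarrow> 'a cm \<Rightarrow> 'a cm" is "scaleR" .
lift_definition norm_cm :: "'a cm \<Rightarrow> real" is "\<lambda>A. onorm ((*v) A)" .
definition dist_cm :: "'a cm \<Rightarrow> 'a cm \<Rightarrow> real" where "dist_cm A B = norm (A - B)"
definition sgn_cm :: "'a cm \<Rightarrow> 'a cm" where "sgn_cm A = scaleR (inverse (norm A)) A"
definition uniformity_cm :: "('a cm \<times> 'a cm) filter"
  where "uniformity_cm = (INF e\<in>{0<..}. principal {(x, y). dist x y < e})"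
definition open_cm :: "'a cm set \<Rightarrow> bool"
  where "open_cm S = (\<forall>x\<in>S. \<forall>\<^sub>F (x', y) in uniformity. x' = x \<longrightarrow> y \<in> S)"
instance
proof
  fix a b :: real and A B E :: "'a cm"
  show "a *\<^sub>R (A + B) = a *\<^sub>R A + a *\<^sub>R B" "(a + b) *\<^sub>R A = a *\<^sub>R A + b *\<^sub>R A"
    "a *\<^sub>R b *\<^sub>R A = (a * b) *\<^sub>R A" "1 *\<^sub>R A = A"
    by (transfer; simp add: algebra_simps)+
  show "a *\<^sub>R A * B = a *\<^sub>R (A * B)" "A * a *\<^sub>R B = a *\<^sub>R (A * B)"
    by (transfer; simp add: matrix_matrix_mult_def vec_eq_iff scaleR_sum_right)+
  show "(norm A = 0) = (A = 0)"
    by transfer (auto simp: onorm_eq_0 matrix_vector_mul_bounded_linear matrix_eq)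
  show "norm (A + B) \<le> norm A + norm B"
    unfolding norm_cm.rep_eq plus_cm.rep_eq matrix_vector_mult_add_rdistrib
    by (intro onorm_triangle matrix_vector_mul_bounded_linear)
  show "norm (a *\<^sub>R A) = \<bar>a\<bar> * norm A"
  proof -
    have "(*v) (a *\<^sub>R mat_of A) = (\<lambda>x. a *\<^sub>R (mat_of A *v x))"
      by (auto simp: fun_eq_iff matrix_vector_mult_def vec_eq_iff scaleR_sum_right)
    then show ?thesis
      unfolding norm_cm.rep_eq scaleR_cm.rep_eq
      by (simp add: onorm_scaleR matrix_vector_mul_bounded_linear)
  qed
  show "norm (A * B) \<le> norm A * norm B"
    unfolding norm_cm.rep_eq times_cm.rep_eq matrix_vector_mul_assoc[symmetric]
    using onorm_compose[OF matrix_vector_mul_bounded_linear[of "mat_of A"] matrix_vector_mul_bounded_linear[of "mat_of B"]]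
    by (simp add: o_def)
  show "norm (1::'a cm) = 1"
    unfolding norm_cm.rep_eq one_cm.rep_eq matrix_vector_mul_lid by (rule onorm_id)
qed (simp_all add: dist_cm_def sgn_cm_def uniformity_cm_def open_cm_def)
end

definition entry :: "'m::finite cm \<Rightarrow> 'm \<Rightarrow> 'm \<Rightarrow> complex" where
  "entry A a b = mat_of A $ a $ b"

lemma cm_eqI: "(\<And>a b. entry A a b = entry B a b) \<Longrightarrow> A = B"
  by (simp add: entry_def mat_of_inject[symmetric] vec_eq_iff)

lemma entry_simps [simp]:
  "entry 0 a b = 0" "entry (A + B) a b = entry A a b + entry B a b"
  "entry (A - B) a b = entry A a b - entry B a b" "entry (- A) a b = - entry A a b"
  "entry (r *\<^sub>R A) a b = r *\<^sub>R entry A a b" "entry 1 a b = (if a = b then 1 else 0)"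
  unfolding entry_def by (transfer; simp add: mat_def)+

lemma entry_times: "entry (A * B) a b = (\<Sum>c\<in>UNIV. entry A a c * entry B c b)"
  unfolding entry_def by transfer (simp add: matrix_matrix_mult_def)

lemma norm_entry_le: "cmod (entry A a b) \<le> norm A"
proof -
  have "cmod (mat_of A $ a $ b) = cmod ((mat_of A *v axis b 1) $ a)"
    by (simp add: matrix_vector_mult_def axis_def if_distrib cong: if_cong)
  also have "\<dots> \<le> norm (mat_of A *v axis b 1)"
    by (rule Finite_Cartesian_Product.norm_nth_le)
  also have "\<dots> \<le> onorm ((*v) (mat_of A)) * norm (axis b (1::complex))"
    by (rule onorm[OF matrix_vector_mul_bounded_linear])
  finally show ?thesis by (simp add: entry_def norm_cm.rep_eq)
qed

text \<open>With \<open>norm_entry_le\<close> this shows that convergence in the operator norm is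
  entrywise convergence, so limits and completeness come from the complex numbers.\<close>

lemma norm_le_entry: "norm A \<le> (\<Sum>a\<in>UNIV. \<Sum>b\<in>UNIV. cmod (entry A a b))"
  unfolding norm_cm.rep_eq
proof (rule onorm_le)
  fix x
  have "norm (mat_of A *v x) \<le> (\<Sum>a\<in>UNIV. norm ((mat_of A *v x) $ a))"
    unfolding norm_vec_def by (rule L2_set_le_sum) simp
  also have "\<dots> \<le> (\<Sum>a\<in>UNIV. \<Sum>b\<in>UNIV. cmod (entry A a b) * norm x)"
  proof (rule sum_mono)
    fix a
    have "norm ((mat_of A *v x) $ a) \<le> (\<Sum>b\<in>UNIV. cmod (entry A a b * x $ b))"
      by (simp add: matrix_vector_mult_def entry_def norm_sum)
    also have "\<dots> \<le> (\<Sum>b\<in>UNIV. cmod (entry A a b) * norm x)"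
      by (intro sum_mono) (simp add: norm_mult mult_left_mono Finite_Cartesian_Product.norm_nth_le)
    finally show "norm ((mat_of A *v x) $ a) \<le> (\<Sum>b\<in>UNIV. cmod (entry A a b) * norm x)" .
  qed
  finally show "norm (mat_of A *v x) \<le> (\<Sum>a\<in>UNIV. \<Sum>b\<in>UNIV. cmod (entry A a b)) * norm x"
    by (simp add: sum_distrib_right)
qed

lemma bounded_linear_entry: "bounded_linear (\<lambda>A. entry A a b)"
  by (rule bounded_linear_intro[where K = 1]) (simp_all add: norm_entry_le)

lemma cm_tendstoI:
  assumes "\<And>a b. ((\<lambda>x. entry (f x) a b) \<longlongrightarrow> entry L a b) F"
  shows "(f \<longlongrightarrow> L) F"
proof -
  have *: "((\<lambda>x. \<Sum>a\<in>UNIV. \<Sum>b\<in>UNIV. cmod (entry (f x - L) a b)) \<longlongrightarrow> 0) F"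
    using assms by (auto intro!: tendsto_null_sum tendsto_norm_zero simp: LIM_zero)
  have "((\<lambda>x. f x - L) \<longlongrightarrow> 0) F"
    by (rule Lim_null_comparison[OF _ *]) (rule always_eventually, rule allI, rule norm_le_entry)
  then show ?thesis by (rule LIM_zero_cancel)
qed

instance cm :: (finite) banach
proof
  fix X :: "nat \<Rightarrow> 'a cm"
  assume X: "Cauchy X"
  have "Cauchy (\<lambda>i. entry (X i) a b)" for a b
    by (rule bounded_linear.Cauchy[OF bounded_linear_entry X])
  then have "\<exists>l. (\<lambda>i. entry (X i) a b) \<longlonglongrightarrow> l" for a b
    using Cauchy_convergent_iff convergent_def by blast
  then obtain l where l: "\<And>a b. (\<lambda>i. entry (X i) a b) \<longlonglongrightarrow> l a b"
    by metis
  have "X \<longlonglongrightarrow> cm_of (\<chi> a b. l a b)"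
    by (rule cm_tendstoI) (use l in \<open>simp add: entry_def cm_of_inverse\<close>)
  then show "convergent X" by (auto simp: convergent_def)
qed

text \<open>The type class provides real scalars only. Complex scalars are represented by central
  matrices.\<close>

definition scal :: "complex \<Rightarrow> 'm::finite cm" where
  "scal z = cm_of (\<chi> a b. if a = b then z else 0)"

lemma entry_scal [simp]: "entry (scal z) a b = (if a = b then z else 0)"
  by (simp add: scal_def entry_def cm_of_inverse)

lemma entry_scal_times [simp]: "entry (scal z * A) a b = z * entry A a b"
proof -
  have "entry (scal z * A) a b = (\<Sum>c\<in>UNIV. if a = c then z * entry A c b else 0)"
    unfolding entry_times by (rule sum.cong) auto
  then show ?thesis by simp
qed


lemma entry_times_scal [simp]: "entry (A * scal z) a b = entry A a b * z"
proof -
  have "entry (A * scal z) a b = (\<Sum>c\<in>UNIV. if c = b then entry A a c * z else 0)"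
    unfolding entry_times by (rule sum.cong) auto
  then show ?thesis by simp
qed

lemma scal_comm: "A * scal z = scal z * A"
  by (rule cm_eqI) simp

lemma scal_left_comm: "A * (scal z * B) = scal z * (A * B)"
  by (simp only: scal_comm[of A] mult.assoc[symmetric])

lemma scal_add: "scal (z + w) = scal z + scal w"
  and scal_minus: "scal (- z) = - scal z"
  and scal_mult: "scal (z * w) = scal z * scal w"
  and scal_0 [simp]: "scal 0 = 0"
  and scal_1 [simp]: "scal 1 = 1"
  by (auto intro!: cm_eqI)

section \<open>Conjugation by exponentials\<close>

lemma exp_conj:
  fixes P Q A :: "'a::{real_normed_algebra_1,banach}"
  assumes "P * Q = 1" "Q * P = 1"
  shows "P * exp A * Q = exp (P * A * Q)"
proof -
  have pow: "P * A ^ k * Q = (P * A * Q) ^ k" for k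
  proof (induction k)
    case (Suc k)
    have "P * A ^ Suc k * Q = (P * A) * (Q * P) * (A ^ k * Q)"
      using assms(2) by (simp add: mult.assoc)
    also have "\<dots> = (P * A * Q) * (P * A ^ k * Q)" by (simp only: mult.assoc)
    also have "\<dots> = (P * A * Q) ^ Suc k" by (simp add: Suc)
    finally show ?case .
  qed (simp add: assms)
  have bl: "bounded_linear (\<lambda>X. P * X * Q)"
    using bounded_linear_compose[OF bounded_linear_mult_left[of Q] bounded_linear_mult_right[of P]]
    by (simp add: o_def)
  show ?thesis
  proof -
    have "P * exp A * Q = (\<Sum>k. P * (A ^ k /\<^sub>R fact k) * Q)"
      unfolding exp_def by (rule bounded_linear.suminf[OF bl summable_exp_generic])
    also have "(\<lambda>k. P * (A ^ k /\<^sub>R fact k) * Q) = (\<lambda>k. (P * A * Q) ^ k /\<^sub>R fact k)"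
      by (simp only: pow[symmetric] mult_scaleR_left mult_scaleR_right)
    finally show ?thesis unfolding exp_def .
  qed
qed

lemma add_diff3: "(a + b + c) - (a' + b' + c') = (a - a') + (b - b') + (c - c' :: 'a::ab_group_add)"
  by (simp add: algebra_simps)

text \<open>The series exp(ad A) X breaks off after the quadratic term, and the 2 in
  \<open>X2\<close> absorbs its factorial. The polynomial \<open>p\<close> solves p' = [A, p], so
  \<open>F\<close> has derivative 0 and takes the same value at 0 and 1.\<close>

lemma exp_Ad:
  fixes A :: "'a::{real_normed_algebra_1,banach}"
  assumes X1: "A * X - X * A = X1" and X2: "A * X1 - X1 * A = 2 * X2" and X3: "A * X2 = X2 * A"
  shows "exp A * X * exp (- A) = X + X1 + X2"
proof -
  define p where "p t = X + t *\<^sub>R X1 + (t * t) *\<^sub>R X2" for t :: real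
  define F where "F t = exp (t *\<^sub>R (- A)) * p t * exp (t *\<^sub>R A)" for t :: real
  have p': "(p has_vector_derivative X1 + (2 * t) *\<^sub>R X2) (at t)" for t
  proof -
    have 1: "((\<lambda>t. t *\<^sub>R X1) has_vector_derivative X1) (at t)"
      by (auto intro!: derivative_eq_intros simp: has_vector_derivative_def)
    have "((\<lambda>t::real. t * t) has_field_derivative 2 * t) (at t)"
      by (auto intro!: derivative_eq_intros)
    from has_vector_derivative_scaleR[OF this has_vector_derivative_const[of X2]]
    have 2: "((\<lambda>t. (t * t) *\<^sub>R X2) has_vector_derivative (2 * t) *\<^sub>R X2) (at t)"
      by simp
    have "(p has_vector_derivative (0 + X1) + (2 * t) *\<^sub>R X2) (at t)"
      unfolding p_def
      by (rule has_vector_derivative_add[OF has_vector_derivative_add[OF has_vector_derivative_const 1] 2])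
    then show ?thesis by simp
  qed
  have eq: "A * p t - p t * A = X1 + (2 * t) *\<^sub>R X2" for t
  proof -
    have "A * p t - p t * A = (A * X - X * A) + t *\<^sub>R (A * X1 - X1 * A) + (t * t) *\<^sub>R (A * X2 - X2 * A)"
      by (simp only: p_def distrib_left distrib_right scaleR_diff_right mult_scaleR_left mult_scaleR_right add_diff3)
    also have "\<dots> = X1 + t *\<^sub>R (2 * X2)"
      by (simp add: X1 X2 X3)
    also have "t *\<^sub>R (2 * X2) = (2 * t) *\<^sub>R X2"
      by (simp only: mult_2 scaleR_add_left scaleR_add_right)
    finally show ?thesis .
  qed
  have "(F has_vector_derivative 0) (at t)" for t
  proof -
    have gen: "U * W * (A * V) + (U * q + U * (- A) * W) * V = U * (q - (A * W - W * A)) * V" for U V W q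
      by (simp add: algebra_simps)
    have "(F has_vector_derivative
        (exp (t *\<^sub>R (- A)) * p t) * (A * exp (t *\<^sub>R A)) +
        (exp (t *\<^sub>R (- A)) * (X1 + (2 * t) *\<^sub>R X2) + exp (t *\<^sub>R (- A)) * (- A) * p t) * exp (t *\<^sub>R A)) (at t)"
      unfolding F_def
      by (intro has_vector_derivative_mult p' exp_scaleR_has_vector_derivative_left
            exp_scaleR_has_vector_derivative_right)
    then have "(F has_vector_derivative exp (t *\<^sub>R (- A)) * ((X1 + (2 * t) *\<^sub>R X2) - (A * p t - p t * A)) * exp (t *\<^sub>R A)) (at t)"
      unfolding gen .
    then show ?thesis unfolding eq by simp
  qed
  then obtain c where "\<And>t. F t = c"
    using has_vector_derivative_zero_constant[of UNIV F] by auto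
  then have "F 1 = F 0" by simp
  then have "exp (- A) * (X + X1 + X2) * exp A = X"
    by (simp add: F_def p_def)
  then have "exp A * X * exp (- A) = exp A * (exp (- A) * (X + X1 + X2) * exp A) * exp (- A)"
    by simp
  also have "\<dots> = (exp A * exp (- A)) * (X + X1 + X2) * (exp A * exp (- A))"
    by (simp only: mult.assoc)
  finally show ?thesis by (simp only: exp_minus_inverse mult_1_left mult_1_right)
qed

section \<open>Roots, reflections and reduced words in type D\<close>

text \<open>
  Weights are written in the orthonormal coordinates \<open>\<epsilon>\<^sub>1, ..., \<epsilon>\<^sub>n\<close>, in which \<open>rho\<close> is
  \<open>(n - 1, ..., 1, 0)\<close> and the reflections are signed transpositions.
\<close>

locale type_D =
  fixes n :: nat
  assumes n4: "4 \<le> n"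
begin

abbreviation "I \<equiv> {1..n}"

definition dot :: "(nat \<Rightarrow> int) \<Rightarrow> (nat \<Rightarrow> int) \<Rightarrow> int" where
  "dot a b = (\<Sum>l\<in>I. a l * b l)"

definition sroot :: "nat \<Rightarrow> nat \<Rightarrow> int" where
  "sroot i = (\<lambda>l. if i < n then (if l = i then 1 else if l = i + 1 then - 1 else 0)
                else (if l = n - 1 \<or> l = n then 1 else 0))"

definition reflect :: "nat \<Rightarrow> (nat \<Rightarrow> int) \<Rightarrow> nat \<Rightarrow> int" where
  "reflect i a = (\<lambda>l. a l - dot a (sroot i) * sroot i l)"

definition refls :: "nat list \<Rightarrow> (nat \<Rightarrow> int) \<Rightarrow> nat \<Rightarrow> int" where
  "refls is = foldr reflect is"

definition rho :: "nat \<Rightarrow> int" where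
  "rho = (\<lambda>l. if l \<in> I then int n - int l else 0)"

text \<open>The fundamental weight with index \<open>k\<close> when \<open>k \<le> n - 2\<close>;
  the two spin weights have half-integral coordinates.\<close>

definition omega :: "nat \<Rightarrow> nat \<Rightarrow> int" where
  "omega k = (\<lambda>l. if 1 \<le> l \<and> l \<le> k then 1 else 0)"

lemma refls_Nil [simp]: "refls [] a = a"
  and refls_Cons [simp]: "refls (i # is) a = reflect i (refls is a)"
  and refls_append: "refls (is @ js) a = refls is (refls js a)"
  by (simp_all add: refls_def)

lemma dot_commute: "dot a b = dot b a"
  by (simp add: dot_def mult.commute)

lemma dot_comb: "dot (\<lambda>l. a l - c * b l) d = dot a d - c * dot b d"
  by (simp add: dot_def sum_subtractf sum_distrib_left algebra_simps)

lemma dot_comb_right: "dot d (\<lambda>l. a l - c * b l) = dot d a - c * dot d b"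
  using dot_comb[of a c b d] by (simp only: dot_commute)

lemma dot_minus: "dot (\<lambda>l. - a l) d = - dot a d"
  by (simp add: dot_def sum_negf)

lemma dot_sroot:
  assumes "i \<in> I"
  shows "dot a (sroot i) = (if i < n then a i - a (i + 1) else a (n - 1) + a n)"
proof (cases "i < n")
  case True
  have "dot a (sroot i) = (\<Sum>l\<in>{i, i + 1}. a l * sroot i l)"
    unfolding dot_def by (rule sum.mono_neutral_right) (use assms True in \<open>auto simp: sroot_def\<close>)
  then show ?thesis using True by (simp add: sroot_def)
next
  case False
  have "dot a (sroot i) = (\<Sum>l\<in>{n - 1, n}. a l * sroot i l)"
    unfolding dot_def by (rule sum.mono_neutral_right) (use assms False n4 in \<open>auto simp: sroot_def\<close>)
  then show ?thesis using False n4 by (simp add: sroot_def)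
qed

lemma dot_sroot_self: "i \<in> I \<Longrightarrow> dot (sroot i) (sroot i) = 2"
  using n4 by (auto simp: dot_sroot) (auto simp: sroot_def)

lemma cartan_dot:
  assumes i: "i \<in> I" and j: "j \<in> I"
  shows "cartan n i j = dot (sroot i) (sroot j)"
proof -
  \<comment> \<open>Writing \<open>n = m + 2\<close> removes the truncated subtractions; for
    neighbours \<open>i\<close> and \<open>j\<close>, the pair being {n-1, n} then means
    \<open>i + j = 2 * m + 3\<close>.\<close>
  obtain m where m: "n = m + 2" 
  proof -
    have "n = (n - 2) + 2" using n4 by simp
    then show ?thesis using that by blast
  qed
  have c: "cartan n i j = (if i = j then 2 else if (i = j + 1 \<or> j = i + 1) \<and> i + j \<noteq> 2 * m + 3 then - 1
      else if i = m \<and> j = m + 2 \<or> i = m + 2 \<and> j = m then - 1 else 0)"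
  proof -
    have "(i = j + 1 \<or> j = i + 1) \<and> {i, j} \<noteq> {n - 1, n} \<longleftrightarrow> (i = j + 1 \<or> j = i + 1) \<and> i + j \<noteq> 2 * m + 3"
      unfolding doubleton_eq_iff m by presburger
    moreover have "{i, j} = {n - 2, n} \<longleftrightarrow> i = m \<and> j = m + 2 \<or> i = m + 2 \<and> j = m"
      unfolding doubleton_eq_iff m by simp
    ultimately show ?thesis using i j unfolding cartan_def by (simp only: simp_thms if_True)
  qed
  have "i \<le> m \<or> i = m + 1 \<or> i = m + 2" "j \<le> m \<or> j = m + 1 \<or> j = m + 2"
    using i j m by auto
  then show ?thesis
    unfolding c dot_sroot[OF j] unfolding sroot_def unfolding m by (elim disjE) auto
qed

lemma cartan_commute: "i \<in> I \<Longrightarrow> j \<in> I \<Longrightarrow> cartan n i j = cartan n j i"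
  by (metis cartan_dot dot_commute)

lemma dot_rho_sroot: "i \<in> I \<Longrightarrow> dot rho (sroot i) = 1"
  using n4 by (auto simp: dot_sroot rho_def)

lemma dot_reflect: "dot (reflect i a) b = dot a b - dot a (sroot i) * dot (sroot i) b"
  by (simp add: reflect_def dot_comb)

lemma reflect_isometry:
  assumes "i \<in> I"
  shows "dot (reflect i a) (reflect i b) = dot a b"
proof -
  have "dot (reflect i a) (reflect i b) = dot (reflect i a) b - dot b (sroot i) * dot (reflect i a) (sroot i)"
    unfolding reflect_def[of i b] by (rule dot_comb_right)
  then show ?thesis
    using dot_sroot_self[OF assms] by (simp add: dot_reflect dot_commute[of b] algebra_simps)
qed

lemma reflect_involution: "i \<in> I \<Longrightarrow> reflect i (reflect i a) = a"
  by (rule ext) (simp add: reflect_def[of i "reflect i a"] dot_reflect dot_sroot_self, simp add: reflect_def)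

lemma reflect_comb: "reflect i (\<lambda>l. a l - c * b l) = (\<lambda>l. reflect i a l - c * reflect i b l)"
  by (rule ext) (simp add: reflect_def dot_comb algebra_simps)

lemma refls_comb: "refls is (\<lambda>l. a l - c * b l) = (\<lambda>l. refls is a l - c * refls is b l)"
  by (induction "is") (simp_all add: reflect_comb)

lemma refls_isometry: "set is \<subseteq> I \<Longrightarrow> dot (refls is a) (refls is b) = dot a b"
  by (induction "is") (simp_all add: reflect_isometry)

lemma refls_rev: "set is \<subseteq> I \<Longrightarrow> refls (rev is) (refls is a) = a"
  by (induction "is") (simp_all add: refls_append reflect_involution)

lemma sroot_outside: "i \<in> I \<Longrightarrow> l \<notin> I \<Longrightarrow> sroot i l = 0"
  using n4 by (auto simp: sroot_def)

lemma reflect_outside: "i \<in> I \<Longrightarrow> l \<notin> I \<Longrightarrow> reflect i a l = a l"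
  by (simp add: reflect_def sroot_outside)

lemma refls_outside: "set is \<subseteq> I \<Longrightarrow> l \<notin> I \<Longrightarrow> refls is a l = a l"
  by (induction "is") (simp_all add: reflect_outside)

lemma reflect_less: "i \<in> I \<Longrightarrow> i < n \<Longrightarrow> reflect i a = a(i := a (i + 1), i + 1 := a i)"
  by (rule ext) (use dot_sroot[of i a] in \<open>auto simp: reflect_def\<close>, auto simp: sroot_def)

lemma reflect_last: "reflect n a = a(n - 1 := - a n, n := - a (n - 1))"
  using n4 dot_sroot[of n a] by (intro ext) (auto simp: reflect_def, auto simp: sroot_def)

text \<open>
  Entries with distinct absolute values mean a trivial stabilizer; this yields the dichotomy
  between positive and negative roots without listing the roots.
\<close>

definition regular :: "(nat \<Rightarrow> int) \<Rightarrow> bool" where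
  "regular a \<longleftrightarrow> inj_on (\<lambda>l. \<bar>a l\<bar>) I"

lemma regular_dot: 
  assumes "regular a" "i \<in> I"
  shows "dot a (sroot i) \<noteq> 0"
proof -
  have *: "\<bar>a p\<bar> \<noteq> \<bar>a q\<bar>" if "p \<in> I" "q \<in> I" "p \<noteq> q" for p q
    using assms(1) that unfolding regular_def inj_on_def by blast
  show ?thesis
  proof (cases "i < n")
    case True
    then have "\<bar>a i\<bar> \<noteq> \<bar>a (i + 1)\<bar>" using assms(2) by (intro *) auto
    then show ?thesis using True assms(2) unfolding dot_sroot[OF assms(2)] by auto
  next
    case False
    have "\<bar>a (n - 1)\<bar> \<noteq> \<bar>a n\<bar>" using n4 by (intro *) auto
    then show ?thesis unfolding dot_sroot[OF assms(2)] using False by auto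
  qed
qed

lemma regular_reflect:
  assumes "regular a" "i \<in> I"
  shows "regular (reflect i a)"
proof -
  define p where "p = (if i < n then i else n - 1)"
  have p: "p \<in> I" "p + 1 \<in> I" using assms(2) n4 by (auto simp: p_def)
  have "\<bar>reflect i a l\<bar> = \<bar>a (Transposition.transpose p (p + 1) l)\<bar>" for l
  proof (cases "i < n")
    case True
    then show ?thesis
      using assms(2) by (auto simp: reflect_less p_def Transposition.transpose_def)
  next
    case False
    then have "i = n" using assms(2) by auto
    then show ?thesis
      using n4 by (auto simp: reflect_last p_def Transposition.transpose_def)
  qed
  moreover have "inj_on (\<lambda>l. \<bar>a (Transposition.transpose p (p + 1) l)\<bar>) I"
  proof -
    have "Transposition.transpose p (p + 1) ` I = I"
      using p by (simp add: transpose_image_eq)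
    then have "inj_on ((\<lambda>l. \<bar>a l\<bar>) \<circ> Transposition.transpose p (p + 1)) I"
      using assms(1) by (intro comp_inj_on inj_on_subset[OF inj_transpose]) (auto simp: regular_def)
    then show ?thesis by (simp add: o_def)
  qed
  ultimately show ?thesis by (simp add: regular_def)
qed

lemma regular_refls_rho: "set is \<subseteq> I \<Longrightarrow> regular (refls is rho)"
proof (induction "is")
  case Nil
  then show ?case unfolding regular_def by (intro inj_onI) (simp add: rho_def)
qed (simp add: regular_reflect)

lemma dot_self_eq_0: "dot a a \<le> 0 \<Longrightarrow> l \<in> I \<Longrightarrow> a l = 0"
proof -
  assume "dot a a \<le> 0" and l: "l \<in> I"
  then have "(\<Sum>l\<in>I. a l * a l) = 0"
    unfolding dot_def by (intro antisym sum_nonneg) auto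
  then show ?thesis using l by (subst (asm) sum_nonneg_eq_0_iff) auto
qed

text \<open>
  If the height of \<open>v\<^sup>-\<^sup>1 \<alpha>\<^sub>i\<close> changes its sign when \<open>s\<^sub>j\<close> is appended to \<open>v\<close>, then
  \<open>\<langle>v \<alpha>\<^sub>j, \<alpha>\<^sub>i\<rangle> \<ge> 2\<close>, and both vectors have square length 2, so they are equal.
\<close>

lemma exchange:
  assumes "set js \<subseteq> I" "i \<in> I" "dot (refls js rho) (sroot i) < 0"
  shows "\<exists>js'. set js' \<subseteq> I \<and> Suc (length js') = length js \<and> refls (i # js) = refls js'"
  using assms(1,3)
proof (induction js rule: rev_induct)
  case Nil
  then show ?case using dot_rho_sroot[OF assms(2)] by simp
next
  case (snoc j ks)
  have j: "j \<in> I" and ks: "set ks \<subseteq> I" using snoc.prems by auto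
  show ?case
  proof (cases "dot (refls ks rho) (sroot i) < 0")
    case True
    then obtain ks' where "set ks' \<subseteq> I" "Suc (length ks') = length ks" "refls (i # ks) = refls ks'"
      using snoc.IH ks by blast
    then show ?thesis
      using j by (intro exI[of _ "ks' @ [j]"]) (auto simp: fun_eq_iff refls_append)
  next
    case False
    then have A: "dot (refls ks rho) (sroot i) \<ge> 1"
      using regular_dot[OF regular_refls_rho[OF ks] assms(2)] by simp
    have reflect_rho: "reflect j rho = (\<lambda>l. rho l - 1 * sroot j l)"
      using dot_rho_sroot[OF j] by (simp add: reflect_def)
    have "dot (refls ks rho) (sroot i) - dot (refls ks (sroot j)) (sroot i) < 0"
      using snoc.prems(2) by (simp add: refls_append reflect_rho refls_comb[where c = 1, simplified] dot_comb[where c = 1, simplified])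
    with A have B: "dot (refls ks (sroot j)) (sroot i) \<ge> 2" by simp
    define d where "d = (\<lambda>l. refls ks (sroot j) l - 1 * sroot i l)"
    have "dot d d = dot (refls ks (sroot j)) (refls ks (sroot j)) - 2 * dot (refls ks (sroot j)) (sroot i) + dot (sroot i) (sroot i)"
      unfolding d_def dot_comb dot_comb_right by (simp add: dot_commute[of "sroot i" "refls ks (sroot j)"])
    also have "\<dots> \<le> 0"
      using B by (simp add: refls_isometry[OF ks] dot_sroot_self[OF j] dot_sroot_self[OF assms(2)])
    finally have d0: "d l = 0" if "l \<in> I" for l using dot_self_eq_0 that by blast
    have eq: "refls ks (sroot j) = sroot i"
    proof
      fix l show "refls ks (sroot j) l = sroot i l"
        using d0[of l] refls_outside[OF ks, of l] sroot_outside[of _ l] j assms(2)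
        by (cases "l \<in> I") (auto simp: d_def)
    qed
    \<comment> \<open>An isometry that carries \<open>\<alpha>\<^sub>j\<close> to
      \<open>\<alpha>\<^sub>i\<close> conjugates s_j to s_i.\<close>
    have "refls (i # ks) a = refls (ks @ [j]) a" for a
    proof -
      have "reflect j a = (\<lambda>l. a l - dot a (sroot j) * sroot j l)" by (rule reflect_def)
      then have "refls ks (reflect j a) = (\<lambda>l. refls ks a l - dot a (sroot j) * sroot i l)"
        by (simp add: refls_comb eq)
      moreover have "dot a (sroot j) = dot (refls ks a) (sroot i)"
        using refls_isometry[OF ks, of a "sroot j"] eq by simp
      ultimately show ?thesis by (simp add: refls_append reflect_def)
    qed
    then have "refls (i # ks @ [j]) = refls ks"
      using j by (auto simp: fun_eq_iff refls_append reflect_involution)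
    then show ?thesis using ks by (intro exI[of _ ks]) auto
  qed
qed

section \<open>Ascending words and shortest words\<close>

fun ascending :: "nat list \<Rightarrow> bool" where
  "ascending [] = True"
| "ascending (i # is) = (i \<in> I \<and> ascending is \<and> 0 < dot (refls is rho) (sroot i))"

lemma ascending_set: "ascending is \<Longrightarrow> set is \<subseteq> I"
  by (induction "is") auto

text \<open>The counterpart of \<open>reduced_word\<close> for the action on coordinates.\<close>

definition minimal :: "nat list \<Rightarrow> bool" where
  "minimal is \<longleftrightarrow> set is \<subseteq> I \<and> (\<forall>js. set js \<subseteq> I \<longrightarrow> refls js = refls is \<longrightarrow> length is \<le> length js)"

lemma minimal_Cons: 
  assumes "minimal (i # is)" 
  shows "minimal is"
  unfolding minimal_def
proof (intro conjI allI impI)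
  fix js assume js: "set js \<subseteq> I" "refls js = refls is"
  have "refls (i # js) = refls (i # is)"
    using js by (intro ext) simp
  moreover have "set (i # js) \<subseteq> I"
    using assms js by (auto simp: minimal_def)
  ultimately have "length (i # is) \<le> length (i # js)"
    using assms unfolding minimal_def by blast
  then show "length is \<le> length js" by simp
qed (use assms in \<open>auto simp: minimal_def\<close>)

text \<open>If a letter paired negatively with the weight reached so far, \<open>exchange\<close>
  would give a word two letters shorter; the value 0 is excluded by regularity.\<close>

lemma minimal_ascending: "minimal is \<Longrightarrow> ascending is"
proof (induction "is")
  case (Cons i "is")
  have m: "minimal is" using minimal_Cons[OF Cons.prems] .
  have i: "i \<in> I" "set is \<subseteq> I" using Cons.prems by (auto simp: minimal_def)
  have "\<not> dot (refls is rho) (sroot i) < 0"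
  proof
    assume "dot (refls is rho) (sroot i) < 0"
    then obtain js where js: "set js \<subseteq> I" "Suc (length js) = length is" "refls (i # is) = refls js"
      using exchange[OF i(2,1)] by blast
    then have "length (i # is) \<le> length js"
      using Cons.prems[unfolded minimal_def] by metis
    then show False using js(2) by simp
  qed
  then have "0 < dot (refls is rho) (sroot i)"
    using regular_dot[OF regular_refls_rho[OF i(2)] i(1)] by linarith
  then show ?case
    using Cons.IH[OF m] i(1) unfolding ascending.simps by blast
qed simp

lemma ex_minimal:
  assumes "set is \<subseteq> I" 
  shows "\<exists>js. minimal js \<and> refls js = refls is"
proof -
  obtain js where "set js \<subseteq> I \<and> refls js = refls is"
    "\<And>ks. set ks \<subseteq> I \<and> refls ks = refls is \<Longrightarrow> length js \<le> length ks"
    using ex_has_least_nat[of "\<lambda>js. set js \<subseteq> I \<and> refls js = refls is" "is" length] assms by blast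
  then show ?thesis by (intro exI[of _ js]) (auto simp: minimal_def)
qed

text \<open>Each letter lowers the pairing with \<open>rho\<close> by at least 1. In particular an
  ascending word that fixes \<open>rho\<close> is empty.\<close>

lemma ascending_height: "ascending is \<Longrightarrow> dot (refls is rho) rho + int (length is) \<le> dot rho rho"
proof (induction "is")
  case (Cons i "is")
  have "dot (reflect i (refls is rho)) rho = dot (refls is rho) rho - dot (refls is rho) (sroot i)"
    using dot_rho_sroot[of i] Cons.prems by (simp add: dot_reflect dot_commute[of "sroot i" rho])
  then show ?case using Cons by simp
qed simp

text \<open>The stabilizer of \<open>rho\<close> is trivial: a shortest word for the quotient is
  ascending and fixes \<open>rho\<close>, hence is empty.\<close>

lemma refls_eqI_rho:
  assumes "set is \<subseteq> I" "set js \<subseteq> I" "refls is rho = refls js rho"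
  shows "refls is = refls js"
proof -
  obtain ks where ks: "minimal ks" "refls ks = refls (rev js @ is)"
    using ex_minimal[of "rev js @ is"] assms by auto
  have "refls ks rho = rho"
    using assms by (simp add: ks(2) refls_append refls_rev)
  then have "ks = []"
    using ascending_height[OF minimal_ascending[OF ks(1)]] by simp
  then have *: "refls (rev js) (refls is a) = a" for a
    using ks(2) by (simp add: fun_eq_iff refls_append)
  have "refls is a = refls js a" for a
    using refls_rev[of "rev js" "refls is a"] assms(2) *[of a] by simp
  then show ?thesis by auto
qed

section \<open>Coordinates against values at the coroots\<close>

lemma word_refl_Cons: "word_refl n (i # is) = simple_refl n i \<circ> word_refl n is"
  and word_refl_Nil: "word_refl n [] = id"
  by (simp_all add: word_refl_def)

lemma word_refl_append: "word_refl n (is @ js) = word_refl n is \<circ> word_refl n js"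
  by (induction "is") (simp_all add: word_refl_Cons word_refl_Nil o_assoc)

text \<open>
  The factor 2 is needed because fundamental weights of type D may have half-integral coordinates.
\<close>

lemma word_refl_refls:
  assumes "set is \<subseteq> I" "\<And>j. j \<in> I \<Longrightarrow> 2 * lam j = dot a (sroot j)"
  shows "j \<in> I \<Longrightarrow> 2 * word_refl n is lam j = dot (refls is a) (sroot j)"
    and "j \<notin> I \<Longrightarrow> word_refl n is lam j = lam j"
proof -
  have "(\<forall>j. j \<in> I \<longrightarrow> 2 * word_refl n is lam j = dot (refls is a) (sroot j)) \<and>
        (\<forall>j. j \<notin> I \<longrightarrow> word_refl n is lam j = lam j)"
    using assms(1)
  proof (induction "is")
    case Nil
    then show ?case using assms(2) by (simp add: word_refl_Nil)
  next
    case (Cons i "is")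
    then have i: "i \<in> I" by simp
    have "2 * word_refl n (i # is) lam j = dot (refls (i # is) a) (sroot j)" if "j \<in> I" for j
    proof -
      have "2 * word_refl n (i # is) lam j
          = 2 * word_refl n is lam j - (2 * word_refl n is lam i) * cartan n j i"
        by (simp add: word_refl_Cons simple_refl_def)
      also have "\<dots> = dot (refls is a) (sroot j) - dot (refls is a) (sroot i) * dot (sroot i) (sroot j)"
        using Cons i that by (simp add: cartan_dot dot_commute[of "sroot j"])
      finally show ?thesis by (simp add: dot_reflect)
    qed
    moreover have "word_refl n (i # is) lam j = lam j" if "j \<notin> I" for j
    proof -
      have "cartan n j i = 0"
        using that unfolding cartan_def by (simp only: simp_thms if_False)
      then show ?thesis
        using Cons that by (simp add: word_refl_Cons simple_refl_def)
    qed
    ultimately show ?case by blast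
  qed
  then show "j \<in> I \<Longrightarrow> 2 * word_refl n is lam j = dot (refls is a) (sroot j)"
    and "j \<notin> I \<Longrightarrow> word_refl n is lam j = lam j" by blast+
qed

lemma ex_double:
  "\<exists>a. \<forall>j\<in>I. 2 * lam j = dot a (sroot j)"
proof -
  \<comment> \<open>The equations for the indices \<open>n - 1\<close> and \<open>n\<close> give the
    last two coordinates; the others follow by adding up \<open>a i - a (i + 1) = 2 * lam i\<close>
    from the end.\<close>
  define a where "a = (\<lambda>i. if i = n then lam n - lam (n - 1)
     else (\<Sum>l\<in>{i..<n - 1}. 2 * lam l) + lam (n - 1) + lam n)"
  have "2 * lam j = dot a (sroot j)" if j: "j \<in> I" for j
  proof -
    consider "j < n - 1" | "j = n - 1" | "j = n" using j by force
    then show ?thesis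
    proof cases
      case 1
      then have "{j..<n - 1} = insert j {j + 1..<n - 1}" by auto
      moreover have "j < n" "j + 1 \<noteq> n" "j \<noteq> n" using 1 by auto
      ultimately show ?thesis using 1 unfolding dot_sroot[OF j] a_def by simp
    qed (use j n4 in \<open>simp_all add: dot_sroot a_def\<close>)
  qed
  then show ?thesis by blast
qed

lemma dot_sroot_inject:
  assumes "\<And>j. j \<in> I \<Longrightarrow> dot a (sroot j) = dot b (sroot j)"
  shows "l \<in> I \<Longrightarrow> a l = b l"
proof -
  have 1: "a (n - 1) - a n = b (n - 1) - b n" "a (n - 1) + a n = b (n - 1) + b n"
    using assms[of "n - 1"] assms[of n] n4 by (simp_all add: dot_sroot)
  have "a (n - d) = b (n - d)" if "d < n" for d
    using that
  proof (induction d)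
    case 0
    then show ?case using 1 by simp
  next
    case (Suc d)
    show ?case
    proof (cases "d = 0")
      case True
      then show ?thesis using 1 by simp
    next
      case False
      then show ?thesis
        using assms[of "n - Suc d"] Suc by (simp add: dot_sroot Suc_diff_Suc)
    qed
  qed
  from this[of "n - l"] show "l \<in> I \<Longrightarrow> a l = b l" by simp
qed

text \<open>This carries reducedness over between the two actions. From coordinates to coroot values
  one uses a vector \<open>a\<close> that represents twice the given weight; in the other direction
  \<open>a\<close> itself is doubled.\<close>

lemma word_refl_eq_iff:
  assumes "set is \<subseteq> I" "set js \<subseteq> I"
  shows "word_refl n is = word_refl n js \<longleftrightarrow> refls is = refls js"
proof
  assume eq: "refls is = refls js"
  show "word_refl n is = word_refl n js"
  proof (intro ext)
    fix lam j
    obtain a where "\<And>j. j \<in> I \<Longrightarrow> 2 * lam j = dot a (sroot j)" using ex_double by blast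
    from word_refl_refls[OF assms(1) this, of j] word_refl_refls[OF assms(2) this, of j]
    show "word_refl n is lam j = word_refl n js lam j"
      unfolding eq by (cases "j \<in> I") auto
  qed
next
  assume eq: "word_refl n is = word_refl n js"
  show "refls is = refls js"
  proof (intro ext)
    fix a l
    define lam where "lam = (\<lambda>j. dot a (sroot j))"
    \<comment> \<open>This is \<open>2 * a\<close>, in the shape to which \<open>refls_comb\<close>
      and \<open>dot_comb\<close> apply.\<close>
    have *: "2 * lam j = dot (\<lambda>l. a l - (-1) * a l) (sroot j)" for j
      unfolding dot_comb lam_def by simp
    have "dot (refls is (\<lambda>l. a l - (-1) * a l)) (sroot j) = dot (refls js (\<lambda>l. a l - (-1) * a l)) (sroot j)"
      if "j \<in> I" for j
      using word_refl_refls(1)[OF assms(1) *, of j] word_refl_refls(1)[OF assms(2) *, of j] that eq by simp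
    then have "dot (refls is a) (sroot j) = dot (refls js a) (sroot j)" if "j \<in> I" for j
      using that unfolding refls_comb dot_comb by simp
    then show "refls is a l = refls js a l"
      using dot_sroot_inject refls_outside assms by (cases "l \<in> I") auto
  qed
qed

lemma reduced_minimal:
  assumes "reduced_word n is w"
  shows "minimal is" "word_refl n is = w"
proof -
  show eq: "word_refl n is = w" using assms by (simp add: reduced_word_def)
  have s: "set is \<subseteq> I" using assms by (simp add: reduced_word_def)
  show "minimal is"
    unfolding minimal_def
  proof (intro conjI allI impI s)
    fix js assume "set js \<subseteq> I" "refls js = refls is"
    then have "word_refl n js = w" using word_refl_eq_iff[OF _ s] eq by simp
    then have "weyl_length n w \<le> length js"
      unfolding weyl_length_def using \<open>set js \<subseteq> I\<close> by (intro Least_le) auto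
    then show "length is \<le> length js" using assms by (simp add: reduced_word_def)
  qed
qed

lemma ex_reduced:
  assumes "w \<in> weyl_group n"
  shows "\<exists>is. reduced_word n is w"
proof -
  obtain js where "set js \<subseteq> I" "w = word_refl n js" using assms by (auto simp: weyl_group_def)
  then have "\<exists>is. set is \<subseteq> I \<and> word_refl n is = w \<and> length is = length js"
    by blast
  then have "\<exists>is. set is \<subseteq> I \<and> word_refl n is = w \<and> length is = weyl_length n w"
    unfolding weyl_length_def
    by (rule LeastI[of "\<lambda>l. \<exists>is. set is \<subseteq> I \<and> word_refl n is = w \<and> length is = l"])
  then show ?thesis by (auto simp: reduced_word_def)
qed

text \<open>If w_0 \<open>rho\<close> paired positively with some \<open>\<alpha>\<^sub>i\<close>, a
  reduced word of s_i w_0 could be shortened by \<open>exchange\<close> to a word of w_0 that is too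
  short. So the difference \<open>d\<close> of -w_0 \<open>rho\<close> and \<open>rho\<close> is
  dominant, whence \<open>dot rho d \<ge> 0\<close>; the last coordinate of \<open>d\<close>, whose
  sign dominance leaves open, is weighted by \<open>rho n = 0\<close>. As w_0 is an isometry,
  \<open>dot d d + 2 * dot rho d = 0\<close>, which forces \<open>d\<close> to vanish.\<close>

lemma longest_rho:
  assumes "longest_element n w0"
  obtains "is" where "set is \<subseteq> I" "word_refl n is = w0" "refls is rho = (\<lambda>l. - rho l)"
proof -
  obtain "is" where r: "reduced_word n is w0"
    using ex_reduced assms by (auto simp: longest_element_def)
  have s: "set is \<subseteq> I" and w0: "word_refl n is = w0" and len: "length is = weyl_length n w0"
    using r by (auto simp: reduced_word_def)
  have neg: "dot (refls is rho) (sroot i) < 0" if i: "i \<in> I" for i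
  proof (rule ccontr)
    assume "\<not> ?thesis"
    then have pos: "0 < dot (refls is rho) (sroot i)"
      using regular_dot[OF regular_refls_rho[OF s] i] by simp
    have "word_refl n (i # is) \<in> weyl_group n" using i s by (auto simp: weyl_group_def intro!: exI[of _ "i # is"])
    then obtain js where js: "reduced_word n js (word_refl n (i # is))" using ex_reduced by blast
    have sjs: "set js \<subseteq> I" and "word_refl n js = word_refl n (i # is)"
      and ljs: "length js \<le> length is"
      using js assms len \<open>word_refl n (i # is) \<in> weyl_group n\<close>
      by (auto simp: reduced_word_def longest_element_def)
    then have weq: "refls js = refls (i # is)"
      using word_refl_eq_iff[of js "i # is"] i s by simp
    have "dot (refls js rho) (sroot i) = - dot (refls is rho) (sroot i)"
      using dot_sroot_self[OF i] by (simp add: weq dot_reflect)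
    then obtain ks where ks: "set ks \<subseteq> I" "Suc (length ks) = length js" "refls (i # js) = refls ks"
      using exchange[OF sjs i] pos by auto
    have "refls ks = refls is"
      using ks(3) weq reflect_involution[OF i] by (auto simp: fun_eq_iff)
    then have "length is \<le> length ks"
      using reduced_minimal(1)[OF r, unfolded minimal_def] ks(1) by blast
    then show False
      using ks(2) ljs by linarith
  qed
  define d where "d = (\<lambda>l. - refls is rho l - 1 * rho l)"
  have d: "dot d (sroot i) \<ge> 0" if "i \<in> I" for i
    using neg[OF that] dot_rho_sroot[OF that] unfolding d_def dot_comb dot_minus by simp
  have dec: "d (i + 1) \<le> d i" if "1 \<le> i" "i < n" for i
    using d[of i] that by (simp add: dot_sroot)
  have "d (n - 1) \<ge> 0"
  proof -
    have "1 \<le> n - 1" "n - 1 < n" "n - 1 + 1 = n" "n \<in> I" using n4 by auto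
    then show ?thesis using d[of n] dec[of "n - 1"] by (simp add: dot_sroot)
  qed
  have dn: "d l \<ge> 0" if "1 \<le> l" "l < n" for l
  proof -
    have "l \<le> n - 1" using that by simp
    then show ?thesis using that(1)
    proof (induction l rule: inc_induct)
      case (step l)
      then have "l < n" "1 \<le> l" by auto
      then show ?case using dec[of l] step.IH by auto
    qed (use \<open>d (n - 1) \<ge> 0\<close> in simp)
  qed
  have "dot rho d \<ge> 0"
    unfolding dot_def
  proof (rule sum_nonneg)
    fix l assume "l \<in> I"
    then show "0 \<le> rho l * d l" using dn[of l] by (cases "l = n") (auto simp: rho_def)
  qed
  moreover have "dot d d + 2 * dot rho d = 0"
  proof -
    have w: "refls is rho = (\<lambda>l. - d l - 1 * rho l)" by (auto simp: d_def)
    have "dot (refls is rho) (refls is rho) = dot d d + 2 * dot rho d + dot rho rho"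
      unfolding w dot_comb dot_comb_right
      by (simp add: dot_minus dot_commute[of rho "\<lambda>l. - d l"] dot_commute[of d "\<lambda>l. - d l"] dot_commute[of rho d])
    then show ?thesis by (simp add: refls_isometry[OF s])
  qed
  ultimately have "d l = 0" if "l \<in> I" for l using dot_self_eq_0[of d l] that by simp
  then have "refls is rho = (\<lambda>l. - rho l)"
  proof (intro ext)
    fix l show "refls is rho l = - rho l"
    proof (cases "l \<in> I")
      case True
      then show ?thesis using \<open>\<And>l. l \<in> I \<Longrightarrow> d l = 0\<close>[of l] unfolding d_def by linarith
    next
      case False
      then have "rho l = 0" unfolding rho_def by (simp only: if_False)
      then show ?thesis using refls_outside[OF s False, of rho] by simp
    qed
  qed
  then show thesis using that s w0 by blast
qed

section \<open>The word (1 2 ... n)^m and the longest element\<close>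

definition i0 :: "nat \<Rightarrow> nat list" where
  "i0 m = concat (replicate m [1..<Suc n])"

text \<open>A tail of the Coxeter word is a signed cycle: the coordinates from \<open>i\<close> to
  \<open>n - 1\<close> are shifted by one place, and the one that wraps around and the last one
  change sign.\<close>

lemma refls_block:
  assumes "1 \<le> i" "i < n"
  shows "refls [i..<Suc n] a = (\<lambda>l. if l = i then - a (n - 1) else if i < l \<and> l < n then a (l - 1)
      else if l = n then - a n else a l)"
  using assms(2,1)
proof (induction i rule: strict_inc_induct)
  case (base i)
  then have "[i..<Suc n] = [n - 1, n]" by (simp add: upt_rec)
  then have "refls [i..<Suc n] a = reflect (n - 1) (reflect n a)" by simp
  also have "\<dots> = (reflect n a)(n - 1 := reflect n a n, n := reflect n a (n - 1))"
    using reflect_less[of "n - 1" "reflect n a"] n4 by simp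
  also have "\<dots> = (\<lambda>l. if l = n - 1 then - a (n - 1) else if n - 1 < l \<and> l < n then a (l - 1)
      else if l = n then - a n else a l)"
    unfolding reflect_last using n4 by (intro ext) auto
  finally have *: "refls [i..<Suc n] a = \<dots>" .
  have "i = n - 1" using base by simp
  then show ?case using * by (simp only:)
next
  case (step i)
  have "[i..<Suc n] = i # [Suc i..<Suc n]" using step by (simp add: upt_rec)
  then show ?case using step by (auto simp: reflect_less fun_eq_iff)
qed

lemma refls_i0:
  "m < n \<Longrightarrow> refls (i0 m) a = (\<lambda>l. if 1 \<le> l \<and> l \<le> m then - a (n - 1 - m + l)
     else if m < l \<and> l < n then a (l - m) else if l = n then (- 1) ^ m * a n else a l)"
proof (induction m)
  case 0
  then show ?case by (auto simp: i0_def fun_eq_iff)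
next
  case (Suc m)
  have "refls (i0 (Suc m)) a = refls [1..<Suc n] (refls (i0 m) a)"
    by (simp add: i0_def refls_append del: upt_Suc)
  also have "\<dots> = (\<lambda>l. if 1 \<le> l \<and> l \<le> Suc m then - a (n - 1 - Suc m + l)
     else if Suc m < l \<and> l < n then a (l - Suc m) else if l = n then (- 1) ^ Suc m * a n else a l)"
    (is "_ = ?R")
  proof
    fix l
    have block: "refls [1..<Suc n] b l = (if l = 1 then - b (n - 1) else if 1 < l \<and> l < n then b (l - 1)
      else if l = n then - b n else b l)" for b
      using n4 by (subst refls_block) auto
    consider "l = 0" | "l = 1" | "1 < l" "l \<le> Suc m" | "Suc m < l" "l < n" | "l = n" | "n < l" by linarith
    then show "refls [1..<Suc n] (refls (i0 m) a) l = ?R l"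
    proof cases
      case 3
      then have "n - 1 - m + (l - 1) = n - 1 - Suc m + l" "1 \<le> l - 1" "l - 1 \<le> m" using Suc.prems by auto
      then show ?thesis using 3 Suc n4 unfolding block by simp
    next
      case 4
      then have "l - Suc m = l - 1 - m" "m < l - 1" "l - 1 < n" by auto
      then show ?thesis using 4 Suc n4 unfolding block by simp
    next
      case 1 then show ?thesis unfolding block using Suc n4 by simp
    next
      case 2
      moreover have "n - 1 - Suc m + 1 = n - 1 - m" "m < n - 1" "n - 1 < n" using Suc.prems by auto
      ultimately show ?thesis unfolding block using Suc by (simp del: One_nat_def)
    next
      case 5 then show ?thesis unfolding block using Suc n4 by simp
    next
      case 6 then show ?thesis unfolding block using Suc n4 by simp
    qed
  qed
  finally show ?case .
qed

lemma set_i0: "set (i0 m) \<subseteq> I"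
  by (auto simp: i0_def)

text \<open>For odd \<open>n\<close> the last coordinate is fixed, so w_0 is not -1. For
  \<open>k \<le> n - 2\<close> neither \<open>sroot k\<close> nor \<open>omega k\<close> involves
  that coordinate, so both are negated for every \<open>n\<close>.\<close>

lemma refls_i0_full:
  "refls (i0 (n - 1)) a = (\<lambda>l. if 1 \<le> l \<and> l < n then - a l else if l = n then (- 1) ^ (n - 1) * a n else a l)"
  using n4 by (auto simp: refls_i0 fun_eq_iff)

lemma refls_i0_rho: "refls (i0 (n - 1)) rho = (\<lambda>l. - rho l)"
  unfolding refls_i0_full by (auto simp: fun_eq_iff rho_def)

lemma refls_i0_sroot: "1 \<le> k \<Longrightarrow> k \<le> n - 2 \<Longrightarrow> refls (i0 (n - 1)) (sroot k) = (\<lambda>l. - sroot k l)"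
  unfolding refls_i0_full by (auto simp: fun_eq_iff sroot_def)

lemma refls_i0_omega: "1 \<le> k \<Longrightarrow> k \<le> n - 2 \<Longrightarrow> refls (i0 (n - 1)) (omega k) = (\<lambda>l. - omega k l)"
  unfolding refls_i0_full by (auto simp: fun_eq_iff omega_def)

text \<open>After \<open>m\<close> blocks the last two coordinates of the weight are
  \<open>m + 1\<close> and 0. In the next block the entry \<open>m + 1\<close> turns negative and
  travels to the left; every entry that it passes is at least \<open>- m\<close>, so each pairing is
  positive.\<close>

lemma ascending_i0: "m < n \<Longrightarrow> ascending (i0 m)"
proof (induction m)
  case 0
  then show ?case by (simp add: i0_def)
next
  case (Suc m)
  define a where "a = refls (i0 m) rho"
  have mn: "Suc m < n" using Suc.prems by simp
  have a: "a l = (if l \<le> m then - int (m + 1 - l) else if l < n then int (n - l + m) else 0)" if "l \<in> I" for l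
    using mn that unfolding a_def by (subst refls_i0) (auto simp: rho_def)
  have a1: "a (n - 1) = int m + 1" "a n = 0" using mn n4 by (auto simp: a)
  have a2: "a i \<ge> - int m" if "i \<in> I" for i using that by (simp add: a)
  have "ascending ([i..<Suc n] @ i0 m)" if "1 \<le> i" "i \<le> n" for i
    using that(2,1)
  proof (induction i rule: inc_induct)
    case base
    have n: "n \<in> I" using n4 by simp
    have "0 < dot a (sroot n)" unfolding dot_sroot[OF n] using a1 by simp
    then show ?case
      using Suc.IH mn n by (simp add: a_def)
  next
    case (step i)
    have eq: "[i..<Suc n] = i # [Suc i..<Suc n]" using step by (simp add: upt_rec)
    have i: "i \<in> I" "i < n" "1 \<le> Suc i" using step by auto
    have "0 < dot (refls [Suc i..<Suc n] a) (sroot i)"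
    proof (cases "Suc i < n")
      case True
      show ?thesis
        unfolding dot_sroot[OF i(1)] refls_block[OF i(3) True]
        using a1 a2[OF i(1)] True by auto
    next
      case False
      then have "Suc i = n" using i by simp
      then have "refls [Suc i..<Suc n] a = reflect n a" by simp
      then show ?thesis
        unfolding dot_sroot[OF i(1)] using i a1 \<open>Suc i = n\<close> by (auto simp: reflect_last)
    qed
    then show ?case
      unfolding eq using step i(1) by (simp add: refls_append a_def del: upt_Suc)
  qed
  from this[of 1] have "ascending ([1..<Suc n] @ i0 m)" using n4 by (simp del: upt_Suc)
  moreover have "i0 (Suc m) = [1..<Suc n] @ i0 m" by (simp add: i0_def del: upt_Suc)
  ultimately show ?case by (simp only:)
qed

text \<open>Since w_0 negates \<open>\<alpha>\<^sub>k\<close>, the word \<open>ws\<close> sends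
  \<open>rho\<close> to \<open>- rho\<close> plus \<open>\<alpha>\<^sub>k\<close>. This pairs to 1
  with \<open>\<alpha>\<^sub>k\<close>, so one more letter \<open>k\<close> on the left is ascending
  and leads to \<open>- rho\<close>.\<close>

lemma longest_word_facts:
  assumes "longest_element n w0" "1 \<le> k" "k \<le> n - 2" "reduced_word n ws (w0 \<circ> simple_refl n k)"
  shows "ascending (k # ws)" "refls (k # ws) = refls (i0 (n - 1))"
    "dot (refls ws (omega k)) (sroot k) = 1"
    "\<And>j. j \<in> I \<Longrightarrow> dot (refls (k # ws) rho) (sroot j) < 0"
proof -
  have k: "k \<in> I" using assms by auto
  obtain "is" where isf: "set is \<subseteq> I" "word_refl n is = w0" "refls is rho = (\<lambda>l. - rho l)"
    using longest_rho assms(1) by blast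
  have w: "refls is = refls (i0 (n - 1))"
    by (rule refls_eqI_rho[OF isf(1) set_i0]) (simp only: isf(3) refls_i0_rho)
  have "word_refl n ws = word_refl n (is @ [k])"
    using reduced_minimal(2)[OF assms(4)] isf(2)
    by (simp add: word_refl_append word_refl_Cons word_refl_Nil)
  moreover have sws: "set ws \<subseteq> I" using assms(4) by (simp add: reduced_word_def)
  ultimately have ws: "refls ws a = refls (i0 (n - 1)) (reflect k a)" for a
    using word_refl_eq_iff[of ws "is @ [k]"] isf(1) k w by (simp add: fun_eq_iff refls_append)
  have ws': "refls ws a = (\<lambda>l. refls (i0 (n - 1)) a l - dot a (sroot k) * - sroot k l)" for a
    unfolding ws reflect_def refls_comb refls_i0_sroot[OF assms(2,3)] ..
  have wr: "refls ws rho = (\<lambda>l. - rho l - 1 * - sroot k l)"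
    unfolding ws' dot_rho_sroot[OF k] refls_i0_rho by simp
  have d1: "dot (refls ws rho) (sroot k) = 1"
    unfolding wr dot_comb dot_minus dot_rho_sroot[OF k] dot_sroot_self[OF k] by simp
  then show "ascending (k # ws)"
    using minimal_ascending[OF reduced_minimal(1)[OF assms(4)]] k by simp
  have "refls (k # ws) rho = refls (i0 (n - 1)) rho"
    unfolding refls_Cons reflect_def[of k "refls ws rho"] d1 refls_i0_rho unfolding wr by simp
  then show *: "refls (k # ws) = refls (i0 (n - 1))"
    using k sws by (intro refls_eqI_rho set_i0) auto
  have "dot (omega k) (sroot k) = 1"
    using k assms(2,3) n4 by (auto simp: dot_sroot omega_def)
  then show "dot (refls ws (omega k)) (sroot k) = 1"
    unfolding ws' dot_comb dot_minus dot_sroot_self[OF k] refls_i0_omega[OF assms(2,3)] by simp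
  show "dot (refls (k # ws) rho) (sroot j) < 0" if "j \<in> I" for j
    unfolding * refls_i0_rho dot_minus dot_rho_sroot[OF that] by simp
qed

end

section \<open>Relations between the one-parameter subgroups\<close>

lemma exp_commute_comm:
  fixes A X :: "'a::{real_normed_algebra_1,banach}"
  assumes "A * X = X * A"
  shows "exp A * X = X * exp A"
proof -
  have "exp A * X * exp (- A) = X + 0 + 0"
    by (rule exp_Ad) (use assms in simp_all)
  then have "exp A * X * exp (- A) * exp A = X * exp A" by simp
  then show ?thesis
    using exp_minus_inverse[of "- A"] by (simp add: mult.assoc)
qed

text \<open>The derivative rules for \<open>exp\<close> have a real parameter. With \<open>B\<close>
  the multiple of \<open>A\<close> by the imaginary unit, a complex multiple of \<open>A\<close>
  splits into real multiples of the commuting elements \<open>A\<close> and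
  \<open>B\<close>.\<close>

lemma has_vector_derivative_exp_scal:
  fixes A :: "'m::finite cm"
  assumes "(g has_vector_derivative g') (at s)"
  shows "((\<lambda>s. exp (scal (g s) * A)) has_vector_derivative scal g' * A * exp (scal (g s) * A)) (at s)"
proof -
  define B where "B = scal \<i> * A"
  have AB: "A * B = B * A" by (simp add: B_def scal_left_comm[of A] mult.assoc)
  have split: "exp (scal w * A) = exp (Re w *\<^sub>R A) * exp (Im w *\<^sub>R B)" for w
  proof -
    have "scal w * A = Re w *\<^sub>R A + Im w *\<^sub>R B"
      by (rule cm_eqI) (simp add: B_def complex_eq_iff algebra_simps)
    then show ?thesis using AB by (simp add: exp_add_commuting)
  qed
  have g: "((\<lambda>s. Re (g s)) has_vector_derivative Re g') (at s)" "((\<lambda>s. Im (g s)) has_vector_derivative Im g') (at s)"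
    using assms by (auto intro: bounded_linear.has_vector_derivative[OF bounded_linear_Re]
        bounded_linear.has_vector_derivative[OF bounded_linear_Im])
  have 1: "((\<lambda>s. exp (Re (g s) *\<^sub>R A)) has_vector_derivative Re g' *\<^sub>R (A * exp (Re (g s) *\<^sub>R A))) (at s)"
    using vector_diff_chain_at[OF g(1) exp_scaleR_has_vector_derivative_left[of A]] by (simp add: o_def)
  have 2: "((\<lambda>s. exp (Im (g s) *\<^sub>R B)) has_vector_derivative Im g' *\<^sub>R (B * exp (Im (g s) *\<^sub>R B))) (at s)"
    using vector_diff_chain_at[OF g(2) exp_scaleR_has_vector_derivative_left[of B]] by (simp add: o_def)
  have comm: "exp (Re (g s) *\<^sub>R A) * B = B * exp (Re (g s) *\<^sub>R A)"
    using AB by (intro exp_commute_comm) simp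
  have eq: "exp (Re (g s) *\<^sub>R A) * (Im g' *\<^sub>R (B * exp (Im (g s) *\<^sub>R B)))
      + Re g' *\<^sub>R (A * exp (Re (g s) *\<^sub>R A)) * exp (Im (g s) *\<^sub>R B)
      = scal g' * A * (exp (Re (g s) *\<^sub>R A) * exp (Im (g s) *\<^sub>R B))"
  proof -
    have "scal g' * A = Re g' *\<^sub>R A + Im g' *\<^sub>R B"
      by (rule cm_eqI) (simp add: B_def complex_eq_iff algebra_simps)
    moreover have "exp (Re (g s) *\<^sub>R A) * (Im g' *\<^sub>R (B * exp (Im (g s) *\<^sub>R B)))
        = Im g' *\<^sub>R B * (exp (Re (g s) *\<^sub>R A) * exp (Im (g s) *\<^sub>R B))"
      using comm by (simp add: mult.assoc[symmetric])
    ultimately show ?thesis by (simp add: distrib_right mult.assoc)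
  qed
  show ?thesis
    using has_vector_derivative_mult[OF 1 2] unfolding eq unfolding split .
qed

text \<open>
  Both sides are values at \<open>s = 1\<close> of solutions of one linear differential equation along the path
  \<open>s \<mapsto> exp (s z)\<close> from 1 to \<open>1 + t r\<close>, which avoids 0.
\<close>

lemma sl2_relation:
  fixes E F H :: "'m::finite cm"
  assumes EF: "E * F - F * E = H" and HF: "H * F - F * H = scal (- 2) * F"
    and HE: "\<And>w. exp (scal w * H) * E = scal (exp (2 * w)) * E * exp (scal w * H)"
    and r: "r \<noteq> 0" and z: "exp z = 1 + t * r"
  shows "exp (scal t * E) * exp (scal r * F) =
    exp (scal (r / exp z) * F) * exp (scal z * H) * exp (scal (t / exp z) * E)"
proof -
  \<comment> \<open>The claim with \<open>T s\<close> in place of \<open>t\<close>: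
    \<open>1 + T s * r = tau s\<close>, and the parameters on the right side are
    \<open>sg s = r / tau s\<close> and \<open>xi s = T s / tau s\<close>. At \<open>s = 0\<close>
    both sides are \<open>exp (scal r * F)\<close>.\<close>
  define tau T sg xi where "tau s = exp (of_real s * z)" and "T s = (tau s - 1) / r"
    and "sg s = r / tau s" and "xi s = (1 - 1 / tau s) / r" for s :: real
  have tau0: "tau s \<noteq> 0" for s by (simp add: tau_def)
  have dz: "((\<lambda>s. of_real s * z) has_vector_derivative z) (at s)" for s
    by (auto intro!: derivative_eq_intros)
  have "((\<lambda>s. exp (of_real s * z)) has_vector_derivative z * exp (of_real s * z)) (at s)" for s
    using field_vector_diff_chain_at[OF dz DERIV_exp] by (simp add: o_def mult.commute)
  then have dtau: "(tau has_vector_derivative z * tau s) (at s)" for s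
    unfolding tau_def .
  have "((\<lambda>s. exp (of_real s * (- z))) has_vector_derivative - z * exp (of_real s * (- z))) (at s)" for s
  proof -
    have "((\<lambda>s. of_real s * (- z)) has_vector_derivative (- z)) (at s)"
      by (auto intro!: derivative_eq_intros)
    from field_vector_diff_chain_at[OF this DERIV_exp] show ?thesis by (simp add: o_def mult.commute)
  qed
  then have dinv: "((\<lambda>s. 1 / tau s) has_vector_derivative - z / tau s) (at s)" for s
    by (simp add: tau_def exp_minus divide_inverse)
  have dT: "(T has_vector_derivative z * tau s / r) (at s)" for s
  proof -
    have "((\<lambda>s. (tau s - 1) * (1 / r)) has_vector_derivative (z * tau s - 0) * (1 / r)) (at s)"
      by (intro has_vector_derivative_mult_left has_vector_derivative_diff dtau has_vector_derivative_const)
    then show ?thesis by (simp add: T_def[abs_def])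
  qed
  have dxi: "(xi has_vector_derivative z / (r * tau s)) (at s)" for s
  proof -
    have "((\<lambda>s. (1 - 1 / tau s) * (1 / r)) has_vector_derivative (0 - (- z / tau s)) * (1 / r)) (at s)"
      by (intro has_vector_derivative_mult_left has_vector_derivative_diff dinv has_vector_derivative_const)
    then show ?thesis by (simp add: xi_def[abs_def] mult.commute)
  qed
  have dsg: "(sg has_vector_derivative - z * sg s) (at s)" for s
  proof -
    have "((\<lambda>s. r * (1 / tau s)) has_vector_derivative r * (- z / tau s)) (at s)"
      by (intro has_vector_derivative_mult_right dinv)
    then show ?thesis by (simp add: sg_def[abs_def] mult.commute)
  qed
  define b a x where "b s = exp (scal (sg s) * F)" and "a s = exp (scal (of_real s * z) * H)"
    and "x s = exp (scal (xi s) * E)" for s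
  define R where "R s = b s * a s * x s" for s
  have FH: "(scal w * F) * H - H * (scal w * F) = scal (2 * w) * F" for w
  proof -
    have "(scal w * F) * H - H * (scal w * F) = - (scal w * (H * F - F * H))"
      by (simp add: scal_left_comm[of H] mult.assoc right_diff_distrib)
    also have "\<dots> = scal (2 * w) * F" unfolding HF by (rule cm_eqI) simp
    finally show ?thesis .
  qed
  have FE: "(scal w * F) * E - E * (scal w * F) = scal (- w) * H" for w
  proof -
    have "(scal w * F) * E - E * (scal w * F) = - (scal w * (E * F - F * E))"
      by (simp add: scal_left_comm[of E] mult.assoc right_diff_distrib)
    also have "\<dots> = scal (- w) * H" unfolding EF by (rule cm_eqI) simp
    finally show ?thesis .
  qed
  have bi: "exp (- (scal w * F)) * exp (scal w * F) = 1" for w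
    using exp_minus_inverse[of "- (scal w * F)"] by simp
  have FcF: "(scal w * F) * (scal v * F) = (scal v * F) * (scal w * F)" for v w
    unfolding mult.assoc scal_left_comm[of F] unfolding mult.assoc[symmetric] scal_mult[symmetric]
    by (simp add: mult.commute)
  have AdH: "exp (scal w * F) * H = (H + scal (2 * w) * F) * exp (scal w * F)" for w
  proof -
    have "exp (scal w * F) * H * exp (- (scal w * F)) = H + scal (2 * w) * F + 0"
      by (rule exp_Ad[OF FH]) (simp_all add: FcF)
    then have "exp (scal w * F) * H * exp (- (scal w * F)) * exp (scal w * F) = (H + scal (2 * w) * F) * exp (scal w * F)"
      by simp
    then show ?thesis by (simp add: mult.assoc bi)
  qed
  have AdE: "exp (scal w * F) * E = (E + scal (- w) * H + scal (- (w * w)) * F) * exp (scal w * F)" for w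
  proof -
    have "(scal w * F) * (scal (- w) * H) - (scal (- w) * H) * (scal w * F) = scal (- w) * ((scal w * F) * H - H * (scal w * F))"
      by (simp only: scal_left_comm[of "scal w * F" "- w" H] mult.assoc[of "scal (- w)" H] right_diff_distrib)
    also have "\<dots> = 2 * (scal (- (w * w)) * F)"
      unfolding FH mult_2 by (rule cm_eqI) (simp add: algebra_simps)
    finally have "exp (scal w * F) * E * exp (- (scal w * F)) = E + scal (- w) * H + scal (- (w * w)) * F"
      by (intro exp_Ad[OF FE]) (simp_all add: FcF)
    then have "exp (scal w * F) * E * exp (- (scal w * F)) * exp (scal w * F) = (E + scal (- w) * H + scal (- (w * w)) * F) * exp (scal w * F)"
      by simp
    then show ?thesis by (simp add: mult.assoc bi)
  qed
  \<comment> \<open>This is R' = T' E R. Once \<open>E\<close> and \<open>H\<close> have been moved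
    to the left of \<open>a s\<close> and \<open>b s\<close>, the terms with \<open>H\<close> and
    \<open>F\<close> cancel because \<open>sg s = r / tau s\<close>. Hence the product
    \<open>P\<close> of \<open>R\<close> with the inverse of exp(T E) is constant.\<close>
  have dR: "(R has_vector_derivative scal (z * tau s / r) * E * R s) (at s)" for s
  proof -
    have R': "(R has_vector_derivative (b s * a s) * (scal (z / (r * tau s)) * E * x s) +
        (b s * (scal z * H * a s) + (scal (- z * sg s) * F * b s) * a s) * x s) (at s)"
      unfolding R_def b_def a_def x_def
      by (intro has_vector_derivative_mult has_vector_derivative_exp_scal dxi dsg dz)
    have aE: "a s * E = scal (tau s * tau s) * E * a s"
      using HE[of "of_real s * z"] by (simp add: a_def tau_def mult_exp_exp mult.commute)
    have "(b s * a s) * (scal (z / (r * tau s)) * E * x s) = scal (z / (r * tau s)) * (b s * (a s * E) * x s)"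
      by (simp only: mult.assoc scal_left_comm[of "a s"] scal_left_comm[of "b s"])
    then have "(b s * a s) * (scal (z / (r * tau s)) * E * x s)
        = scal (z / (r * tau s)) * scal (tau s * tau s) * (b s * E) * a s * x s"
      unfolding aE by (simp only: mult.assoc scal_left_comm[of "b s"])
    moreover have "b s * (scal z * H * a s) = scal z * (b s * H) * a s"
      by (simp only: mult.assoc scal_left_comm[of "b s"])
    moreover have "scal (z / (r * tau s)) * scal (tau s * tau s) * (b s * E) * a s * x s +
        (scal z * (b s * H) * a s + (scal (- z * sg s) * F * b s) * a s) * x s
        = (scal (z / (r * tau s)) * scal (tau s * tau s) * (E + scal (- sg s) * H + scal (- (sg s * sg s)) * F)
          + scal z * (H + scal (2 * sg s) * F) + scal (- z * sg s) * F) * R s"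
      unfolding R_def b_def AdE AdH by (simp add: distrib_right mult.assoc)
    moreover have "scal (z / (r * tau s)) * scal (tau s * tau s) * (E + scal (- sg s) * H + scal (- (sg s * sg s)) * F)
          + scal z * (H + scal (2 * sg s) * F) + scal (- z * sg s) * F = scal (z * tau s / r) * E"
      by (rule cm_eqI) (use r tau0[of s] in \<open>simp add: sg_def field_simps mult.assoc\<close>)
    ultimately show ?thesis using R' by (simp only:)
  qed
  define P where "P s = exp (scal (- T s) * E) * R s" for s
  have "(P has_vector_derivative 0) (at s)" for s
  proof -
    have "((\<lambda>s. - T s) has_vector_derivative - (z * tau s / r)) (at s)"
      by (rule has_vector_derivative_minus[OF dT])
    from has_vector_derivative_exp_scal[OF this, of E]
    have "(P has_vector_derivative exp (scal (- T s) * E) * (scal (z * tau s / r) * E * R s) +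
        (scal (- (z * tau s / r)) * E * exp (scal (- T s) * E)) * R s) (at s)"
      unfolding P_def by (intro has_vector_derivative_mult dR)
    moreover have "exp (scal (- T s) * E) * E = E * exp (scal (- T s) * E)"
      by (intro exp_commute_comm) (simp add: scal_left_comm[of E] mult.assoc)
    then have "exp (scal (- T s) * E) * (scal (z * tau s / r) * E * R s) +
        (scal (- (z * tau s / r)) * E * exp (scal (- T s) * E)) * R s = 0"
      by (simp add: scal_minus mult.assoc scal_left_comm[of "exp (- (scal (T s) * E))"]) (simp add: mult.assoc[symmetric])
    ultimately show ?thesis by simp
  qed
  then obtain c where "\<And>s. P s = c"
    using has_vector_derivative_zero_constant[of UNIV P] by auto
  then have "P 1 = P 0" by simp
  moreover have "P 0 = exp (scal r * F)" by (simp add: P_def R_def T_def b_def a_def x_def tau_def sg_def xi_def)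
  moreover have one: "T 1 = t" "sg 1 = r / exp z" "xi 1 = t / exp z"
  proof -
    have "xi 1 = (exp z - 1) / exp z / r" by (simp add: xi_def tau_def diff_divide_distrib)
    then show "xi 1 = t / exp z" using r unfolding z by simp
  qed (use r z in \<open>simp_all add: T_def sg_def tau_def\<close>)
  ultimately have "exp (scal (- t) * E) * R 1 = exp (scal r * F)" by (simp add: P_def)
  then have "exp (scal t * E) * exp (scal r * F) = exp (scal t * E) * (exp (scal (- t) * E) * R 1)" by simp
  also have "\<dots> = R 1"
    by (simp add: mult.assoc[symmetric] scal_minus exp_minus_inverse)
  finally show ?thesis
    using one by (simp add: R_def a_def b_def x_def)
qed

text \<open>The Serre relations are split into the Cartan entries 0 and -1, the only ones off the
  diagonal; for -1 they say that the generator commutes with the commutator.\<close>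

locale D_group = type_D n for n :: nat +
  fixes e f :: "nat \<Rightarrow> 'm::finite cm" and wt :: "'m \<Rightarrow> nat \<Rightarrow> int"
  assumes he: "i \<in> {1..n} \<Longrightarrow> j \<in> {1..n} \<Longrightarrow>
      cm_of (hmat wt i) * e j - e j * cm_of (hmat wt i) = scal (of_int (cartan n i j)) * e j"
    and hf: "i \<in> {1..n} \<Longrightarrow> j \<in> {1..n} \<Longrightarrow>
      cm_of (hmat wt i) * f j - f j * cm_of (hmat wt i) = scal (- of_int (cartan n i j)) * f j"
    and ef: "i \<in> {1..n} \<Longrightarrow> j \<in> {1..n} \<Longrightarrow>
      e i * f j - f j * e i = (if i = j then cm_of (hmat wt i) else 0)"
    and ee0: "i \<in> {1..n} \<Longrightarrow> j \<in> {1..n} \<Longrightarrow> i \<noteq> j \<Longrightarrow> cartan n i j = 0 \<Longrightarrow> e i * e j = e j * e i"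
    and ff0: "i \<in> {1..n} \<Longrightarrow> j \<in> {1..n} \<Longrightarrow> i \<noteq> j \<Longrightarrow> cartan n i j = 0 \<Longrightarrow> f i * f j = f j * f i"
    and ee1: "i \<in> {1..n} \<Longrightarrow> j \<in> {1..n} \<Longrightarrow> cartan n i j = - 1 \<Longrightarrow>
      e i * (e i * e j - e j * e i) = (e i * e j - e j * e i) * e i"
    and ff1: "i \<in> {1..n} \<Longrightarrow> j \<in> {1..n} \<Longrightarrow> cartan n i j = - 1 \<Longrightarrow>
      f i * (f i * f j - f j * f i) = (f i * f j - f j * f i) * f i"
begin

abbreviation "hm i \<equiv> cm_of (hmat wt i)"

definition x :: "nat \<Rightarrow> complex \<Rightarrow> 'm cm" where "x i t = exp (scal t * e i)"
definition y :: "nat \<Rightarrow> complex \<Rightarrow> 'm cm" where "y i t = exp (scal t * f i)"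
definition co :: "nat \<Rightarrow> complex \<Rightarrow> 'm cm" where "co i c = cm_of (coroot wt i c)"
definition sb :: "nat \<Rightarrow> 'm cm" where "sb i = x i (- 1) * y i 1 * x i (- 1)"
definition sbi :: "nat \<Rightarrow> 'm cm" where "sbi i = x i 1 * y i (- 1) * x i 1"

text \<open>
  The Chevalley involution: it transfers facts about \<open>x\<close> to facts about \<open>y\<close>.
\<close>

lemma flip: "D_group n f e (\<lambda>a i. - wt a i)"
proof -
  have h: "cm_of (hmat (\<lambda>a i. - wt a i) i) = - hm i" for i
    by (rule cm_eqI) (simp add: entry_def hmat_def cm_of_inverse uminus_cm.rep_eq)
  have 1: "- hm i * f j - f j * (- hm i) = scal (of_int (cartan n i j)) * f j"
    if "i \<in> I" "j \<in> I" for i j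
    using arg_cong[OF hf[OF that], of uminus] by (simp add: scal_minus)
  have 2: "- hm i * e j - e j * (- hm i) = scal (- of_int (cartan n i j)) * e j"
    if "i \<in> I" "j \<in> I" for i j
    using arg_cong[OF he[OF that], of uminus] by (simp add: scal_minus)
  have 3: "f i * e j - e j * f i = (if i = j then - hm i else 0)"
    if "i \<in> I" "j \<in> I" for i j
    using arg_cong[OF ef[OF that(2,1)], of uminus] by auto
  show ?thesis
    by unfold_locales (use n4 1 2 3 ee0 ff0 ee1 ff1 in \<open>simp_all only: h\<close>)
qed

lemma entry_hm: "entry (hm i) a b = (if a = b then of_int (wt a i) else 0)"
  by (simp add: entry_def cm_of_inverse hmat_def)

lemma entry_co: "entry (co i c) a b = (if a = b then c powi wt a i else 0)"
  by (simp add: entry_def cm_of_inverse coroot_def co_def)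

lemma entry_diag_times:
  assumes "\<And>a b. entry D a b = (if a = b then d a else 0)"
  shows "entry (D * A) a b = d a * entry A a b" "entry (A * D) a b = entry A a b * d b"
proof -
  have "entry (D * A) a b = (\<Sum>c\<in>UNIV. if a = c then d a * entry A c b else 0)"
    unfolding entry_times assms by (rule sum.cong) auto
  then show "entry (D * A) a b = d a * entry A a b" by simp
  have "entry (A * D) a b = (\<Sum>c\<in>UNIV. if c = b then entry A a c * d c else 0)"
    unfolding entry_times assms by (rule sum.cong) auto
  then show "entry (A * D) a b = entry A a b * d b" by simp
qed

lemma wt_e:
  assumes "i \<in> I" "j \<in> I" "entry (e j) a b \<noteq> 0"
  shows "wt a i = wt b i + cartan n i j"
proof -
  have "entry (hm i * e j - e j * hm i) a b = entry (scal (of_int (cartan n i j)) * e j) a b"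
    using he[OF assms(1,2)] by simp
  then have "(of_int (wt a i) - of_int (wt b i) - of_int (cartan n i j)) * entry (e j) a b = 0"
    by (simp add: entry_diag_times[OF entry_hm] algebra_simps)
  then have "(of_int (wt a i - wt b i - cartan n i j) :: complex) = 0"
    using assms(3) by simp
  then show ?thesis unfolding of_int_eq_0_iff by simp
qed

lemma co_e:
  assumes "i \<in> I" "j \<in> I" "c \<noteq> 0"
  shows "co i c * e j = scal (c powi cartan n i j) * e j * co i c"
proof (rule cm_eqI)
  fix a b
  show "entry (co i c * e j) a b = entry (scal (c powi cartan n i j) * e j * co i c) a b"
    using wt_e[OF assms(1,2), of a b] assms(3)
    by (cases "entry (e j) a b = 0") (simp_all add: mult.assoc entry_diag_times[OF entry_co] power_int_add)
qed

lemma co_mult: "c \<noteq> 0 \<Longrightarrow> d \<noteq> 0 \<Longrightarrow> co i c * co i d = co i (c * d)"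
  by (rule cm_eqI) (simp add: entry_diag_times[OF entry_co] entry_co power_int_mult_distrib)

lemma co_1 [simp]: "co i 1 = 1"
  by (rule cm_eqI) (simp add: entry_co)

lemma co_inv: "c \<noteq> 0 \<Longrightarrow> co i c * co i (inverse c) = 1" "c \<noteq> 0 \<Longrightarrow> co i (inverse c) * co i c = 1"
  by (simp_all add: co_mult)

lemma co_eq_exp: "exp (scal z * hm i) = co i (exp z)"
proof (rule cm_eqI)
  fix a b
  have pow: "entry ((scal z * hm i) ^ k) a b = (if a = b then (z * of_int (wt a i)) ^ k else 0)" for k a b
  proof (induction k arbitrary: a b)
    case (Suc k)
    have "entry (scal z * hm i) a b = (if a = b then z * of_int (wt a i) else 0)" for a b
      by (simp add: entry_hm)
    from entry_diag_times(1)[OF this, of "(scal z * hm i) ^ k"] Suc show ?case by simp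
  qed simp
  have "entry (exp (scal z * hm i)) a b = (\<Sum>k. entry ((scal z * hm i) ^ k /\<^sub>R fact k) a b)"
    unfolding exp_def by (rule bounded_linear.suminf[OF bounded_linear_entry summable_exp_generic])
  also have "\<dots> = (\<Sum>k. if a = b then (z * of_int (wt a i)) ^ k /\<^sub>R fact k else 0)"
    by (rule suminf_cong) (simp add: pow)
  also have "\<dots> = (if a = b then exp (z * of_int (wt a i)) else 0)"
    by (simp add: exp_def)
  also have "\<dots> = entry (co i (exp z)) a b"
    by (simp add: entry_co exp_power_int mult.commute)
  finally show "entry (exp (scal z * hm i)) a b = entry (co i (exp z)) a b" .
qed

lemma x_add: "x i s * x i t = x i (s + t)"
proof -
  have "(scal s * e i) * (scal t * e i) = (scal t * e i) * (scal s * e i)"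
    unfolding mult.assoc scal_left_comm[of "e i"] unfolding mult.assoc[symmetric] scal_mult[symmetric]
    by (simp add: mult.commute)
  from exp_add_commuting[OF this] show ?thesis by (simp add: x_def scal_add distrib_right)
qed

lemma x_0 [simp]: "x i 0 = 1"
  by (simp add: x_def)

lemma y_add: "y i s * y i t = y i (s + t)" and y_0 [simp]: "y i 0 = 1"
proof -
  interpret fl: D_group n f e "\<lambda>a i. - wt a i" by (rule flip)
  have "fl.x = y" by (simp add: fun_eq_iff y_def fl.x_def)
  then show "y i s * y i t = y i (s + t)" "y i 0 = 1" using fl.x_add fl.x_0 by metis+
qed

lemma co_x:
  assumes "i \<in> I" "j \<in> I" "c \<noteq> 0"
  shows "co i c * x j t = x j (c powi cartan n i j * t) * co i c"
proof -
  have "co i c * x j t * co i (inverse c) = exp (co i c * (scal t * e j) * co i (inverse c))"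
    unfolding x_def by (rule exp_conj) (simp_all add: co_inv assms)
  also have "co i c * (scal t * e j) * co i (inverse c) = scal t * (co i c * e j) * co i (inverse c)"
    by (simp only: scal_left_comm[of "co i c"])
  also have "\<dots> = scal t * scal (c powi cartan n i j) * e j * (co i c * co i (inverse c))"
    by (simp only: co_e[OF assms] mult.assoc)
  also have "\<dots> = scal (c powi cartan n i j * t) * e j"
    by (simp only: co_inv(1)[OF assms(3)] mult_1_right scal_mult[symmetric] mult.commute[of t])
  finally have "co i c * x j t * co i (inverse c) * co i c = x j (c powi cartan n i j * t) * co i c"
    by (simp add: x_def)
  then show ?thesis by (simp add: mult.assoc co_inv assms)
qed

lemma co_y:
  assumes "i \<in> I" "j \<in> I" "c \<noteq> 0"
  shows "co i c * y j t = y j (c powi (- cartan n i j) * t) * co i c"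
proof -
  interpret fl: D_group n f e "\<lambda>a i. - wt a i" by (rule flip)
  have 1: "fl.x = y" by (simp add: fun_eq_iff y_def fl.x_def)
  have 2: "fl.co i (inverse c) = co i c"
    by (rule cm_eqI) (simp add: entry_co fl.entry_co power_int_minus power_int_inverse)
  show ?thesis
    using fl.co_x[of i j "inverse c" t] assms
    by (simp add: 1 2 power_int_minus power_int_inverse)
qed

lemma cartan_self: "i \<in> I \<Longrightarrow> cartan n i i = 2"
  by (simp add: cartan_def)

text \<open>Multiplication rule of the rank one subgroup. For positive \<open>t\<close> and
  \<open>r\<close> all parameters on the right are positive, on which \<open>x_Y\<close>
  relies.\<close>

lemma x_y_self:
  assumes i: "i \<in> I" and d: "1 + t * r \<noteq> 0"
  shows "x i t * y i r = y i (r / (1 + t * r)) * co i (1 + t * r) * x i (t / (1 + t * r))"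
proof (cases "r = 0")
  case False
  obtain z where z: "exp z = 1 + t * r" using d exp_Ln by blast
  have "exp (scal t * e i) * exp (scal r * f i) =
      exp (scal (r / exp z) * f i) * exp (scal z * hm i) * exp (scal (t / exp z) * e i)"
  proof (rule sl2_relation[OF _ _ _ False z])
    show "e i * f i - f i * e i = hm i" using ef[OF i i] by simp
    show "hm i * f i - f i * hm i = scal (- 2) * f i"
      using hf[OF i i] by (simp add: cartan_self[OF i])
    show "exp (scal w * hm i) * e i = scal (exp (2 * w)) * e i * exp (scal w * hm i)" for w
      using co_e[OF i i, of "exp w"] by (simp add: co_eq_exp cartan_self[OF i] exp_double)
  qed
  then show ?thesis by (simp add: x_def y_def co_eq_exp z)
qed simp

lemma sb_sbi: "sb i * sbi i = 1" and sbi_sb: "sbi i * sb i = 1"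
proof -
  have "sb i * sbi i = x i (- 1) * (y i 1 * (x i (- 1) * x i 1) * y i (- 1)) * x i 1"
    by (simp only: sb_def sbi_def mult.assoc)
  then show "sb i * sbi i = 1" by (simp add: x_add y_add)
  have "sbi i * sb i = x i 1 * (y i (- 1) * (x i 1 * x i (- 1)) * y i 1) * x i (- 1)"
    by (simp only: sb_def sbi_def mult.assoc)
  then show "sbi i * sb i = 1" by (simp add: x_add y_add)
qed

lemma y_co:
  assumes i: "i \<in> I" and c: "c \<noteq> 0"
  shows "y i c * co i (inverse c) = x i (inverse c) * sb i * x i c"
proof -
  have "x i (inverse c) * sb i * x i c = (x i (inverse c) * x i (- 1)) * y i 1 * (x i (- 1) * x i c)"
    by (simp only: sb_def mult.assoc)
  also have "\<dots> = x i (inverse c - 1) * y i 1 * x i (c - 1)"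
    by (simp add: x_add)
  \<comment> \<open>Here the parameters are \<open>t = inverse c - 1\<close> and
    \<open>r = 1\<close>, so that \<open>1 + t * r = inverse c\<close>.\<close>
  also have "x i (inverse c - 1) * y i 1 = y i c * co i (inverse c) * x i (1 - c)"
    using x_y_self[OF i, of "inverse c - 1" 1] c by (simp add: divide_inverse left_diff_distrib)
  also have "y i c * co i (inverse c) * x i (1 - c) * x i (c - 1) = y i c * co i (inverse c)"
    by (simp add: mult.assoc x_add)
  finally show ?thesis by simp
qed

lemma x_sb:
  assumes i: "i \<in> I" and t: "t \<noteq> 0"
  shows "x i t * sb i = y i (inverse t) * co i t * x i (- inverse t)"
proof -
  have "y i (inverse t) * co i t * x i (- inverse t) = x i t * sb i * (x i (inverse t) * x i (- inverse t))"
    using y_co[OF i, of "inverse t"] t by (simp add: mult.assoc)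
  then show ?thesis by (simp add: x_add)
qed

text \<open>The left side is what becomes of \<open>sb i\<close> when an element that scales
  \<open>x i\<close> by \<open>d\<close> and \<open>y i\<close> by its inverse is moved through
  it.\<close>

lemma sb_rescaled:
  assumes i: "i \<in> I" and d: "d \<noteq> 0"
  shows "x i (- d) * y i (inverse d) * x i (- d) = sb i * co i (inverse d)"
proof -
  have "y i (inverse d) * co i d = x i d * sb i * x i (inverse d)"
    using y_co[OF i, of "inverse d"] d by simp
  then have "y i (inverse d) * co i d * co i (inverse d) = x i d * sb i * x i (inverse d) * co i (inverse d)"
    by simp
  then have "y i (inverse d) = x i d * sb i * x i (inverse d) * co i (inverse d)"
    using d by (simp add: mult.assoc co_inv)
  then have "x i (- d) * y i (inverse d) * x i (- d)
      = (x i (- d) * x i d) * sb i * x i (inverse d) * (co i (inverse d) * x i (- d))"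
    by (simp add: mult.assoc)
  also have "co i (inverse d) * x i (- d) = x i (- inverse d) * co i (inverse d)"
  proof -
    have "inverse d powi 2 * - d = - inverse d" using d by (simp add: power2_eq_square)
    then show ?thesis using co_x[OF i i, of "inverse d" "- d"] d unfolding cartan_self[OF i] by simp
  qed
  finally show ?thesis by (simp add: x_add mult.assoc) (simp add: mult.assoc[symmetric] x_add)
qed

lemma co_sb_self:
  assumes i: "i \<in> I" and d: "d \<noteq> 0"
  shows "co i d * sb i = sb i * co i (inverse d)"
proof -
  have "co i d * sb i = x i (- (d * d)) * y i (inverse (d * d)) * x i (- (d * d)) * co i d"
    unfolding sb_def mult.assoc[symmetric]
    using co_x[OF i i d, of "- 1"] co_y[OF i i d, of 1]
    by (simp add: cartan_self[OF i] mult.assoc power2_eq_square power_int_minus)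
  also have "\<dots> = sb i * (co i (inverse (d * d)) * co i d)"
    using sb_rescaled[OF i, of "d * d"] d by (simp add: mult.assoc)
  also have "co i (inverse (d * d)) * co i d = co i (inverse d)"
    using d co_mult[of "inverse (d * d)" d i] by (simp add: mult.assoc)
  finally show ?thesis .
qed

lemma co_sb:
  assumes i: "i \<in> I" and j: "j \<in> I" and c: "c \<noteq> 0"
  shows "co j c * sb i = sb i * co i (c powi (- cartan n j i)) * co j c"
proof -
  let ?d = "c powi cartan n j i"
  have d: "?d \<noteq> 0" using c by simp
  have "co j c * sb i = x i (- ?d) * y i (inverse ?d) * x i (- ?d) * co j c"
    unfolding sb_def mult.assoc[symmetric]
    using co_x[OF j i c, of "- 1"] co_y[OF j i c, of 1]
    by (simp add: mult.assoc power_int_minus)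
  then show ?thesis using sb_rescaled[OF i d] by (simp add: power_int_minus)
qed

end

section \<open>Rank two relations, braid relations and Matsumoto's theorem\<close>

lemma scal_scal_times: "(scal s * A) * (scal u * B) = scal (s * u) * (A * B)"
  by (simp only: mult.assoc scal_left_comm[of A] scal_mult)

lemma exp_scal_commute:
  fixes A B :: "'m::finite cm"
  assumes "A * B = B * A"
  shows "exp (scal s * A) * exp (scal t * B) = exp (scal t * B) * exp (scal s * A)"
proof -
  have "A * (scal t * B) = (scal t * B) * A"
    using assms by (simp add: scal_left_comm[of A] mult.assoc)
  then have "A * exp (scal t * B) = exp (scal t * B) * A"
    by (metis exp_commute_comm)
  then have "(scal s * A) * exp (scal t * B) = exp (scal t * B) * (scal s * A)"
    by (simp add: scal_left_comm[of "exp (scal t * B)"] mult.assoc)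
  then show ?thesis by (rule exp_commute_comm)
qed

lemma exp_scal_Ad:
  fixes A X Y :: "'m::finite cm"
  assumes "A * X - X * A = Y" "A * Y = Y * A"
  shows "exp (scal t * A) * X * exp (scal (- t) * A) = X + scal t * Y"
proof -
  have 1: "(scal t * A) * X - X * (scal t * A) = scal t * Y"
    by (simp add: scal_left_comm[of X] mult.assoc assms(1)[symmetric] right_diff_distrib)
  have "(scal t * A) * (scal t * Y) = (scal t * Y) * (scal t * A)"
    using assms(2) by (simp only: mult.assoc scal_left_comm[of A] scal_left_comm[of Y])
  then have 2: "(scal t * A) * (scal t * Y) - (scal t * Y) * (scal t * A) = 2 * 0" by simp
  show ?thesis using exp_Ad[OF 1 2] by (simp add: scal_minus)
qed

lemma exp_scal_conj:
  fixes P Q A X :: "'m::finite cm"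
  assumes "P * Q = 1" "Q * P = 1" "P * A * Q = X"
  shows "P * exp (scal t * A) * Q = exp (scal t * X)"
proof -
  have "P * (scal t * A) * Q = scal t * (P * A * Q)"
    by (simp only: scal_left_comm[of P] mult.assoc)
  then show ?thesis using exp_conj[OF assms(1,2), of "scal t * A"] assms(3) by simp
qed

context type_D
begin

lemma cartan_cases: "i \<in> I \<Longrightarrow> j \<in> I \<Longrightarrow> i \<noteq> j \<Longrightarrow> cartan n i j = 0 \<or> cartan n i j = - 1"
  unfolding cartan_def by (simp only: if_True simp_thms split: if_split)

lemma reflect_commute: "dot (sroot i) (sroot j) = 0 \<Longrightarrow> reflect i (reflect j a) = reflect j (reflect i a)"
  by (rule ext) (simp add: reflect_def dot_comb dot_commute[of "sroot j" "sroot i"])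

lemma reflect_braid:
  assumes "i \<in> I" "j \<in> I" "dot (sroot i) (sroot j) = - 1"
  shows "reflect i (reflect j (reflect i a)) = reflect j (reflect i (reflect j a))"
proof
  fix l
  have 1: "reflect i b l = b l - dot b (sroot i) * sroot i l" for i b by (simp add: reflect_def)
  show "reflect i (reflect j (reflect i a)) l = reflect j (reflect i (reflect j a)) l"
    unfolding 1 dot_reflect dot_sroot_self[OF assms(1)] dot_sroot_self[OF assms(2)] assms(3)
      dot_commute[of "sroot j" "sroot i"] by (simp add: algebra_simps)
qed

end

context D_group
begin

definition sw :: "nat list \<Rightarrow> 'm cm" where "sw is = prod_list (map sb is)"
definition swi :: "nat list \<Rightarrow> 'm cm" where "swi is = prod_list (map sbi (rev is))"

lemma sw_Nil [simp]: "sw [] = 1" and sw_Cons: "sw (i # is) = sb i * sw is"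
  and swi_Nil [simp]: "swi [] = 1" and swi_Cons: "swi (i # is) = swi is * sbi i"
  by (simp_all add: sw_def swi_def)

lemma sw_swi: "sw is * swi is = 1" and swi_sw: "swi is * sw is = 1"
proof -
  have "sw is * swi is = 1 \<and> swi is * sw is = 1"
  proof (induction "is")
    case (Cons i "is")
    have "sw (i # is) * swi (i # is) = sb i * (sw is * swi is) * sbi i"
      "swi (i # is) * sw (i # is) = swi is * (sbi i * sb i) * sw is"
      by (simp_all only: sw_Cons swi_Cons mult.assoc)
    then show ?case using Cons by (simp add: sb_sbi sbi_sb)
  qed simp
  then show "sw is * swi is = 1" "swi is * sw is = 1" by auto
qed

lemma x_y_commute: "i \<in> I \<Longrightarrow> j \<in> I \<Longrightarrow> i \<noteq> j \<Longrightarrow> x i s * y j t = y j t * x i s"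
  unfolding x_def y_def by (rule exp_scal_commute) (use ef[of i j] in simp)

lemma x_x_commute: "i \<in> I \<Longrightarrow> j \<in> I \<Longrightarrow> i \<noteq> j \<Longrightarrow> cartan n i j = 0 \<Longrightarrow> x i s * x j t = x j t * x i s"
  unfolding x_def by (rule exp_scal_commute) (rule ee0)

lemma y_y_commute: "i \<in> I \<Longrightarrow> j \<in> I \<Longrightarrow> i \<noteq> j \<Longrightarrow> cartan n i j = 0 \<Longrightarrow> y i s * y j t = y j t * y i s"
  unfolding y_def by (rule exp_scal_commute) (rule ff0)

lemma sb_x_commute:
  assumes "i \<in> I" "j \<in> I" "i \<noteq> j" "cartan n i j = 0"
  shows "sb i * x j t = x j t * sb i"
proof -
  note c = x_x_commute[OF assms] x_y_commute[OF assms(2,1) assms(3)[symmetric]]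
  have "sb i * x j t = x i (- 1) * y i 1 * (x i (- 1) * x j t)" by (simp only: sb_def mult.assoc)
  also have "\<dots> = x i (- 1) * (y i 1 * x j t) * x i (- 1)" by (simp only: c mult.assoc)
  also have "\<dots> = (x i (- 1) * x j t) * y i 1 * x i (- 1)" by (simp only: c(2) mult.assoc)
  also have "\<dots> = x j t * sb i" by (simp only: c sb_def mult.assoc)
  finally show ?thesis .
qed

lemma sb_y_commute:
  assumes "i \<in> I" "j \<in> I" "i \<noteq> j" "cartan n i j = 0"
  shows "sb i * y j t = y j t * sb i"
proof -
  note c = y_y_commute[OF assms] x_y_commute[OF assms(1,2,3)]
  have "sb i * y j t = x i (- 1) * y i 1 * (x i (- 1) * y j t)" by (simp only: sb_def mult.assoc)
  also have "\<dots> = x i (- 1) * (y i 1 * y j t) * x i (- 1)" by (simp only: c(2) mult.assoc)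
  also have "\<dots> = (x i (- 1) * y j t) * y i 1 * x i (- 1)" unfolding c(1) by (simp only: mult.assoc)
  also have "\<dots> = y j t * sb i" by (simp only: c sb_def mult.assoc)
  finally show ?thesis .
qed

lemma sb_commute:
  assumes "i \<in> I" "j \<in> I" "i \<noteq> j" "cartan n i j = 0"
  shows "sb i * sb j = sb j * sb i"
proof -
  note c = sb_x_commute[OF assms] sb_y_commute[OF assms]
  have "sb i * sb j = (sb i * x j (- 1)) * y j 1 * x j (- 1)" by (simp only: sb_def[of j] mult.assoc)
  also have "\<dots> = x j (- 1) * (sb i * y j 1) * x j (- 1)" by (simp only: c mult.assoc)
  also have "\<dots> = x j (- 1) * y j 1 * (sb i * x j (- 1))" by (simp only: c mult.assoc)
  also have "\<dots> = sb j * sb i" by (simp only: c sb_def[of j] mult.assoc)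
  finally show ?thesis .
qed

definition e_comm :: "nat \<Rightarrow> nat \<Rightarrow> 'm cm" where "e_comm i j = e i * e j - e j * e i"
definition f_comm :: "nat \<Rightarrow> nat \<Rightarrow> 'm cm" where "f_comm i j = f i * f j - f j * f i"

context
  fixes i j
  assumes ij: "i \<in> I" "j \<in> I" "cartan n i j = - 1"
begin

lemma adjacent_neq: "i \<noteq> j" using ij by (auto simp: cartan_def)

lemma e_e_comm: "e i * e_comm i j = e_comm i j * e i" unfolding e_comm_def by (rule ee1[OF ij])
lemma f_f_comm: "f i * f_comm i j = f_comm i j * f i" unfolding f_comm_def by (rule ff1[OF ij])

lemma f_e: "f i * e j = e j * f i" using ef[OF ij(2,1)] adjacent_neq by auto
lemma e_f: "e i * f j = f j * e i" using ef[OF ij(1,2)] adjacent_neq by auto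

lemma f_e_comm: "f i * e_comm i j - e_comm i j * f i = e j"
proof -
  have "f i * e_comm i j - e_comm i j * f i
      = (f i * e i) * e j - (f i * e j) * e i - e i * (e j * f i) + e j * (e i * f i)"
    by (simp add: e_comm_def algebra_simps)
  also have "\<dots> = (f i * e i) * e j - (e j * f i) * e i - e i * (f i * e j) + e j * (e i * f i)"
    unfolding f_e ..
  also have "\<dots> = - ((e i * f i - f i * e i) * e j - e j * (e i * f i - f i * e i))"
    by (simp add: algebra_simps)
  also have "\<dots> = - (scal (- 1) * e j)"
    using ef[OF ij(1,1)] he[OF ij(1,2)] ij(3) by simp
  also have "\<dots> = e j" by (simp add: scal_minus)
  finally show ?thesis .
qed

lemma e_f_comm: "e i * f_comm i j - f_comm i j * e i = f j"
proof -
  have "e i * f_comm i j - f_comm i j * e i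
      = (e i * f i) * f j - (e i * f j) * f i - f i * (f j * e i) + f j * (f i * e i)"
    by (simp add: f_comm_def algebra_simps)
  also have "\<dots> = (e i * f i) * f j - (f j * e i) * f i - f i * (e i * f j) + f j * (f i * e i)"
    unfolding e_f ..
  also have "\<dots> = (e i * f i - f i * e i) * f j - f j * (e i * f i - f i * e i)"
    by (simp add: algebra_simps)
  also have "\<dots> = f j"
    using ef[OF ij(1,1)] hf[OF ij(1,2)] ij(3) by simp
  finally show ?thesis .
qed

text \<open>Here ad of \<open>e i\<close> sends \<open>e j\<close> to \<open>e_comm i j\<close> and
  \<open>f_comm i j\<close> to \<open>f j\<close>, and kills the two images; so the exponential
  series stops at the linear term. In \<open>Ad_y\<close> the roles are exchanged.\<close>

lemma Ad_x:
  "x i t * e j * x i (- t) = e j + scal t * e_comm i j" "x i t * e_comm i j * x i (- t) = e_comm i j"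
  "x i t * f j * x i (- t) = f j" "x i t * f_comm i j * x i (- t) = f_comm i j + scal t * f j"
  unfolding x_def
  using exp_scal_Ad[of "e i" "e j" "e_comm i j" t] exp_scal_Ad[of "e i" "e_comm i j" 0 t]
    exp_scal_Ad[of "e i" "f j" 0 t] exp_scal_Ad[of "e i" "f_comm i j" "f j" t] e_e_comm e_f e_f_comm
  by (simp_all add: e_comm_def[symmetric])

lemma Ad_y:
  "y i t * e j * y i (- t) = e j" "y i t * e_comm i j * y i (- t) = e_comm i j + scal t * e j"
  "y i t * f j * y i (- t) = f j + scal t * f_comm i j" "y i t * f_comm i j * y i (- t) = f_comm i j"
  unfolding y_def
  using exp_scal_Ad[of "f i" "f j" "f_comm i j" t] exp_scal_Ad[of "f i" "f_comm i j" 0 t]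
    exp_scal_Ad[of "f i" "e j" 0 t] exp_scal_Ad[of "f i" "e_comm i j" "e j" t] f_f_comm f_e f_e_comm
  by (simp_all add: f_comm_def[symmetric])

lemma sb_conj: "sb i * X * sbi i = x i (- 1) * (y i 1 * (x i (- 1) * X * x i 1) * y i (- 1)) * x i 1"
  by (simp only: sb_def sbi_def mult.assoc)

lemma Ad_sb:
  "sb i * e j * sbi i = - e_comm i j" "sb i * e_comm i j * sbi i = e j"
  "sb i * f j * sbi i = f_comm i j" "sb i * f_comm i j * sbi i = - f j"
  unfolding sb_conj
  using Ad_x[of "- 1"] Ad_y[of 1]
  by (simp_all add: scal_minus distrib_left distrib_right left_diff_distrib right_diff_distrib)

end

lemma e_comm_flip: "e_comm j i = - e_comm i j" and f_comm_flip: "f_comm j i = - f_comm i j"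
  by (simp_all add: e_comm_def f_comm_def)

text \<open>The product s_i s_j sends \<open>\<alpha>\<^sub>i\<close> to
  \<open>\<alpha>\<^sub>j\<close>. The point is that no sign remains: the one from
  \<open>Ad_sb\<close> cancels the one from reversing the commutator.\<close>

lemma sb_x_sb:
  assumes ij: "i \<in> I" "j \<in> I" "cartan n i j = - 1"
  shows "sb i * sb j * x i t = x j t * sb i * sb j" "sb i * sb j * y i t = y j t * sb i * sb j"
proof -
  have ji: "j \<in> I" "i \<in> I" "cartan n j i = - 1" using ij cartan_commute by auto
  have PQ: "(sb i * sb j) * (sbi j * sbi i) = 1" "(sbi j * sbi i) * (sb i * sb j) = 1"
    using sw_swi[of "[i, j]"] swi_sw[of "[i, j]"] by (simp_all add: sw_def swi_def)
  have "(sb i * sb j) * e i * (sbi j * sbi i) = sb i * (sb j * e i * sbi j) * sbi i"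
    by (simp only: mult.assoc)
  also have "\<dots> = e j" unfolding Ad_sb(1)[OF ji] e_comm_flip[of j i] using Ad_sb(2)[OF ij] by simp
  finally have "(sb i * sb j) * x i t * (sbi j * sbi i) = x j t"
    unfolding x_def by (rule exp_scal_conj[OF PQ])
  then have "(sb i * sb j) * x i t * ((sbi j * sbi i) * (sb i * sb j)) = x j t * (sb i * sb j)"
    by (simp only: mult.assoc[symmetric])
  then show "sb i * sb j * x i t = x j t * sb i * sb j" unfolding PQ by (simp add: mult.assoc)
  have "(sb i * sb j) * f i * (sbi j * sbi i) = sb i * (sb j * f i * sbi j) * sbi i"
    by (simp only: mult.assoc)
  also have "\<dots> = f j" unfolding Ad_sb(3)[OF ji] f_comm_flip[of j i] using Ad_sb(4)[OF ij] by simp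
  finally have "(sb i * sb j) * y i t * (sbi j * sbi i) = y j t"
    unfolding y_def by (rule exp_scal_conj[OF PQ])
  then have "(sb i * sb j) * y i t * ((sbi j * sbi i) * (sb i * sb j)) = y j t * (sb i * sb j)"
    by (simp only: mult.assoc[symmetric])
  then show "sb i * sb j * y i t = y j t * sb i * sb j" unfolding PQ by (simp add: mult.assoc)
qed

lemma sb_braid:
  assumes ij: "i \<in> I" "j \<in> I" "cartan n i j = - 1"
  shows "sb i * sb j * sb i = sb j * sb i * sb j"
proof -
  note c = sb_x_sb[OF ij]
  have "sb i * sb j * sb i = (sb i * sb j * x i (- 1)) * y i 1 * x i (- 1)"
    unfolding sb_def[of i, THEN arg_cong[of _ _ "\<lambda>z. sb i * sb j * z"]] by (simp only: mult.assoc)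
  also have "\<dots> = x j (- 1) * (sb i * sb j * y i 1) * x i (- 1)" unfolding c(1) by (simp only: mult.assoc)
  also have "\<dots> = x j (- 1) * y j 1 * (sb i * sb j * x i (- 1))" unfolding c(2) by (simp only: mult.assoc)
  also have "\<dots> = x j (- 1) * y j 1 * x j (- 1) * (sb i * sb j)" unfolding c(1) by (simp only: mult.assoc)
  also have "\<dots> = sb j * (sb i * sb j)" by (simp only: sb_def[of j])
  finally show ?thesis by (simp only: mult.assoc)
qed

text \<open>If the first letters \<open>i\<close> and \<open>j\<close> differ, the element is the
  longest element of the subgroup generated by s_i and s_j times some element with shortest word
  \<open>ks\<close>. Both words are compared, after removal of their first letter, with a
  continuation of \<open>ks\<close>, and the commutation or braid relation joins the two. The
  equality of lengths is carried along to bound the word in the second use of the induction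
  hypothesis.\<close>

lemma matsumoto_aux:
  "length is \<le> N \<Longrightarrow> ascending is \<Longrightarrow> ascending js \<Longrightarrow> refls is = refls js \<Longrightarrow> sw is = sw js \<and> length is = length js"
proof (induction N arbitrary: "is" js)
  case 0
  then have "is = []" by simp
  moreover have "refls js rho = rho" using 0 \<open>is = []\<close> by (metis refls_Nil)
  ultimately have "js = []" using ascending_height[of js] 0 by simp
  then show ?case using \<open>is = []\<close> by simp
next
  case (Suc N)
  show ?case
  proof (cases "is = [] \<or> js = []")
    case True
    have "is = [] \<and> js = []"
    proof -
      have "refls js rho = refls is rho" using Suc.prems(4) by simp
      then show ?thesis
        using True ascending_height[OF Suc.prems(2)] ascending_height[OF Suc.prems(3)] by auto
    qed
    then show ?thesis by simp
  next
    case False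
    then obtain i is' j js' where is_js: "is = i # is'" "js = j # js'"
      by (meson neq_Nil_conv)
    have i: "i \<in> I" and j: "j \<in> I" and pi: "ascending is'" and pj: "ascending js'" and len: "length is' \<le> N"
      using Suc.prems is_js by auto
    have weq: "reflect i (refls is' a) = reflect j (refls js' a)" for a
      using Suc.prems(4) by (auto simp: is_js fun_eq_iff)
    show ?thesis
    proof (cases "i = j")
      case True
      have "refls is' a = refls js' a" for a
      proof -
        have "reflect i (reflect i (refls is' a)) = reflect i (reflect i (refls js' a))"
          using weq[of a] unfolding True by (rule arg_cong)
        then show ?thesis by (simp only: reflect_involution[OF i])
      qed
      then have "sw is' = sw js' \<and> length is' = length js'"
        by (intro Suc.IH len pi pj) auto
      then show ?thesis by (simp add: is_js True sw_Cons)
    next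
      case ij: False
      define v where "v = refls is' rho"
      define p where "p = dot v (sroot i)"
      define q where "q = dot (refls js' rho) (sroot j)"
      have p: "p > 0" and q: "q > 0"
        using Suc.prems by (auto simp: is_js p_def q_def v_def)
      have "dot (reflect i v) (sroot j) = - q"
        unfolding v_def weq dot_reflect dot_sroot_self[OF j] q_def by simp
      then have vj: "dot v (sroot j) = p * dot (sroot i) (sroot j) - q" by (simp add: dot_reflect p_def)
      have js'w: "refls js' a = reflect j (reflect i (refls is' a))" for a
        by (simp only: weq reflect_involution[OF j])
      have set': "set is' \<subseteq> I" using ascending_set[OF pi] .
      consider (0) "cartan n i j = 0" | (1) "cartan n i j = - 1" using cartan_cases[OF i j ij] by blast
      then show ?thesis
      proof cases
        case 0
        then have o: "dot (sroot i) (sroot j) = 0" "dot (sroot j) (sroot i) = 0"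
          using cartan_dot i j dot_commute by auto
        obtain ks where ks: "minimal ks" "refls ks = refls (j # is')"
          using ex_minimal[of "j # is'"] set' j by auto
        have ksr: "refls ks a = reflect j (refls is' a)" for a using ks(2) by simp
        have dk: "dot (refls ks rho) (sroot j) = q" "dot (refls ks rho) (sroot i) = p"
          using vj o dot_sroot_self[OF j] by (simp_all add: ksr v_def[symmetric] dot_reflect p_def)
        have A: "sw is' = sw (j # ks) \<and> length is' = length (j # ks)"
          using minimal_ascending[OF ks(1)] j dk q reflect_involution[OF j]
          by (intro Suc.IH len pi) (auto simp: fun_eq_iff ksr)
        have B: "sw (i # ks) = sw js' \<and> length (i # ks) = length js'"
          using minimal_ascending[OF ks(1)] i dk p len A
          by (intro Suc.IH pj) (auto simp: fun_eq_iff ksr js'w reflect_commute[OF o(1)])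
        have "sw is = sb i * sb j * sw ks" using A by (simp add: is_js sw_Cons mult.assoc)
        also have "\<dots> = sb j * sw js'"
          unfolding sb_commute[OF i j ij 0] using B by (simp add: sw_Cons mult.assoc)
        finally show ?thesis using A B by (simp add: is_js sw_Cons)
      next
        case 1
        then have o: "dot (sroot i) (sroot j) = - 1" "dot (sroot j) (sroot i) = - 1"
          using cartan_dot[OF i j] dot_commute[of "sroot j"] by auto
        obtain ks where ks: "minimal ks" "refls ks = refls (i # j # is')"
          using ex_minimal[of "i # j # is'"] set' i j by auto
        have ksr: "refls ks a = reflect i (reflect j (refls is' a))" for a using ks(2) by simp
        \<comment> \<open>The braid move permutes the pairings \<open>p\<close>, \<open>q\<close>
          and \<open>p + q\<close>. All are positive, so the prefixes of \<open>ks\<close> used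
          below are ascending.\<close>
        have dk: "dot (refls ks rho) (sroot i) = q" "dot (refls ks rho) (sroot j) = p"
          using vj o dot_sroot_self[OF j] dot_sroot_self[OF i]
          by (simp_all add: ksr v_def[symmetric] dot_reflect p_def)
        have dk2: "dot (reflect i (refls ks rho)) (sroot j) = p + q" "dot (reflect j (refls ks rho)) (sroot i) = p + q"
          using dk o by (simp_all add: dot_reflect)
        have A: "sw is' = sw (j # i # ks) \<and> length is' = length (j # i # ks)"
          using minimal_ascending[OF ks(1)] i j dk dk2 p q
          by (intro Suc.IH len pi) (auto simp: fun_eq_iff ksr reflect_involution[OF i] reflect_involution[OF j])
        have "refls (i # j # ks) a = refls js' a" for a
          using reflect_braid[OF i j o(1), of "reflect j (refls is' a)"]
          by (simp add: ksr js'w reflect_involution[OF j])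
        then have B: "sw (i # j # ks) = sw js' \<and> length (i # j # ks) = length js'"
          using minimal_ascending[OF ks(1)] i j dk dk2 p q len A
          by (intro Suc.IH pj) auto
        have "sw is = sb i * sb j * sb i * sw ks" using A by (simp add: is_js sw_Cons mult.assoc)
        also have "\<dots> = sb j * sw js'"
          unfolding sb_braid[OF i j 1] using B by (simp add: sw_Cons mult.assoc)
        finally show ?thesis using A B by (simp add: is_js sw_Cons)
      qed
    qed
  qed
qed

lemma matsumoto: "ascending is \<Longrightarrow> ascending js \<Longrightarrow> refls is = refls js \<Longrightarrow> sw is = sw js"
  using matsumoto_aux by blast

text \<open>
  \<open>trans i a v\<close> is a word for \<open>s\<^sub>i u s\<^sub>i\<^sup>-\<^sup>1\<close> where \<open>u\<close> is what remains of \<open>x\<^sub>i(a) v\<close> after all letters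
  \<open>x\<^sub>i\<close> have been moved to the right end.
\<close>

fun trans :: "nat \<Rightarrow> complex \<Rightarrow> (nat \<times> complex) list \<Rightarrow> (nat \<times> complex) list" where
  "trans i a [] = []"
| "trans i a ((j, t) # v) = (if j = i then trans i (a + t) v
     else if cartan n i j = 0 then (j, t) # trans i a v
     else (i, - 1) # (j, t) # (i, 1) # (j, - t) # (j, t * a) # trans i a v)"

definition X :: "(nat \<times> complex) list \<Rightarrow> 'm cm" where "X v = prod_list (map (\<lambda>(i, t). x i t) v)"

text \<open>The additive character of the upper unipotent group for the simple root
  \<open>k\<close>, read off the letters of a word.\<close>

fun chi :: "nat \<Rightarrow> (nat \<times> complex) list \<Rightarrow> complex" where
  "chi k [] = 0"
| "chi k ((j, t) # v) = (if j = k then t else 0) + chi k v"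

lemma X_Nil [simp]: "X [] = 1" and X_Cons: "X ((i, t) # v) = x i t * X v"
  by (simp_all add: X_def)

text \<open>Conjugation by \<open>sb i * x i a\<close> takes \<open>e j\<close> to
  \<open>- e_comm i j + scal a * e j\<close>. The two summands commute, and the exponential of the
  first is the commutator \<open>x i (- 1) * x j t * x i 1 * x j (- t)\<close>.\<close>

lemma trans_step:
  assumes ij: "i \<in> I" "j \<in> I" "cartan n i j = - 1"
  shows "sb i * x i a * x j t = x i (- 1) * x j t * x i 1 * x j (- t) * x j (t * a) * sb i * x i a"
proof -
  define Z where "Z = exp (scal t * (- e_comm i j))"
  have ji: "j \<in> I" "i \<in> I" "cartan n j i = - 1" using ij cartan_commute by auto
  have comm: "e j * e_comm i j = e_comm i j * e j"
    using e_e_comm[OF ji] unfolding e_comm_flip[of j i] by simp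
  have "(x i (- 1) * x i 1) = 1" "(x i 1 * x i (- 1)) = 1" by (simp_all add: x_add)
  moreover have "x i (- 1) * e j * x i 1 = e j + - e_comm i j"
    using Ad_x(1)[OF ij, of "- 1"] by (simp add: scal_minus)
  ultimately have "x i (- 1) * x j t * x i 1 = exp (scal t * (e j + - e_comm i j))"
    unfolding x_def[of j] by (rule exp_scal_conj)
  also have "\<dots> = exp (scal t * (- e_comm i j) + scal t * e j)"
    by (simp add: distrib_left right_diff_distrib add.commute)
  also have "\<dots> = Z * x j t"
    unfolding Z_def x_def
  proof (rule exp_add_commuting)
    show "(scal t * - e_comm i j) * (scal t * e j) = (scal t * e j) * (scal t * - e_comm i j)"
      by (simp only: mult.assoc scal_left_comm[of "- e_comm i j"] scal_left_comm[of "e j"]) (simp add: comm)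
  qed
  finally have Z: "x i (- 1) * x j t * x i 1 * x j (- t) = Z"
    by (simp add: mult.assoc x_add)
  define P Q where "P = sb i * x i a" and "Q = x i (- a) * sbi i"
  have "P * Q = sb i * (x i a * x i (- a)) * sbi i" "Q * P = x i (- a) * (sbi i * sb i) * x i a"
    by (simp_all only: P_def Q_def mult.assoc)
  then have PQ: "P * Q = 1" "Q * P = 1" by (simp_all add: x_add sb_sbi sbi_sb)
  have "P * e j * Q = sb i * (x i a * e j * x i (- a)) * sbi i" by (simp only: P_def Q_def mult.assoc)
  also have "\<dots> = sb i * e j * sbi i + scal a * (sb i * e_comm i j * sbi i)"
    unfolding Ad_x(1)[OF ij] by (simp add: distrib_left distrib_right mult.assoc scal_left_comm[of "sb i"])
  also have "\<dots> = - e_comm i j + scal a * e j" by (simp add: Ad_sb[OF ij])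
  finally have "P * x j t * Q = exp (scal t * (- e_comm i j + scal a * e j))"
    unfolding x_def[of j] by (rule exp_scal_conj[OF PQ])
  also have "\<dots> = exp (scal t * (- e_comm i j) + scal (t * a) * e j)"
    by (simp only: distrib_left scal_mult mult.assoc)
  also have "\<dots> = Z * x j (t * a)"
    unfolding Z_def x_def
  proof (rule exp_add_commuting)
    show "(scal t * - e_comm i j) * (scal (t * a) * e j) = (scal (t * a) * e j) * (scal t * - e_comm i j)"
      unfolding scal_scal_times by (simp add: comm mult_ac)
  qed
  finally have "P * x j t * (Q * P) = Z * x j (t * a) * P" by (simp only: mult.assoc[symmetric])
  then show ?thesis unfolding PQ Z[symmetric] by (simp add: P_def mult.assoc)
qed

lemma trans:
  assumes i: "i \<in> I"
  shows "fst ` set v \<subseteq> I \<Longrightarrow> sb i * x i a * X v = X (trans i a v) * sb i * x i (a + chi i v)"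
proof (induction v arbitrary: a)
  case (Cons jt v)
  obtain j t where jt: "jt = (j, t)" by force
  have j: "j \<in> I" and v: "fst ` set v \<subseteq> I" using Cons.prems jt by auto
  have split: "sb i * x i a * X (jt # v) = sb i * x i a * x j t * X v"
    by (simp only: jt X_Cons mult.assoc)
  consider "j = i" | "j \<noteq> i" "cartan n i j = 0" | "j \<noteq> i" "cartan n i j = - 1"
    using cartan_cases[OF i j] by blast
  then show ?case
  proof cases
    case 1
    then have "sb i * x i a * x j t * X v = sb i * x i (a + t) * X v"
      by (simp add: mult.assoc x_add[symmetric])
    then show ?thesis unfolding split using Cons.IH[OF v] 1 by (simp add: jt add.assoc)
  next
    case 2
    have "sb i * x i a * x j t * X v = sb i * (x i a * x j t) * X v" by (simp only: mult.assoc)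
    also have "\<dots> = (sb i * x j t) * x i a * X v"
      using x_x_commute[OF i j] 2 by (simp only: mult.assoc)
    also have "\<dots> = x j t * (sb i * x i a * X v)"
      using sb_x_commute[OF i j] 2 by (simp add: mult.assoc)
    finally show ?thesis unfolding split using Cons.IH[OF v] 2 by (simp add: jt X_Cons mult.assoc)
  next
    case 3
    have "sb i * x i a * x j t * X v
        = x i (- 1) * x j t * x i 1 * x j (- t) * x j (t * a) * (sb i * x i a * X v)"
      unfolding trans_step[OF i j 3(2)] by (simp only: mult.assoc)
    then show ?thesis unfolding split Cons.IH[OF v] using 3 by (simp add: jt X_Cons mult.assoc)
  qed
qed simp

end

section \<open>Positive products and density\<close>

lemma tendsto_const_at_0:
  fixes q :: "complex \<Rightarrow> complex"
  assumes "isCont q 0" "\<And>w. w \<noteq> 0 \<Longrightarrow> q w = c"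
  shows "q 0 = c"
proof -
  have "(q \<longlongrightarrow> c) (at 0)"
    by (rule tendsto_eventually) (auto simp: eventually_at_filter assms(2))
  then show ?thesis
    using assms(1) LIM_unique unfolding isCont_def by blast
qed

lemma poly_zero_on_positive:
  fixes q :: "complex poly"
  assumes "\<And>s::real. s > 0 \<Longrightarrow> poly q (of_real s) = 0"
  shows "q = 0"
proof (rule ccontr)
  assume "q \<noteq> 0"
  then have "finite {z. poly q z = 0}" by (rule poly_roots_finite)
  moreover have "of_real ` {0::real<..} \<subseteq> {z. poly q z = 0}" using assms by auto
  ultimately have "finite ((of_real :: real \<Rightarrow> complex) ` {0<..})" by (rule finite_subset[rotated])
  then show False
    using infinite_Ioi[of "0::real"] by (simp add: finite_image_iff inj_on_def)
qed

context D_group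
begin

text \<open>Each factor \<open>e j\<close> raises the value of the weight at \<open>h_j\<close> by
  2, and the weights are finite in number.\<close>

lemma nilpotent_e:
  assumes j: "j \<in> I"
  shows "\<exists>N. \<forall>k\<ge>N. e j ^ k = 0"
proof -
  define M where "M = Max (range (\<lambda>a. nat \<bar>wt a j\<bar>))"
  have M: "\<bar>wt a j\<bar> \<le> int M" for a
  proof -
    have "nat \<bar>wt a j\<bar> \<le> M" unfolding M_def by (rule Max_ge) auto
    then show ?thesis by simp
  qed
  have step: "entry (e j ^ k) a b \<noteq> 0 \<Longrightarrow> wt a j = wt b j + 2 * int k" for k a b
  proof (induction k arbitrary: a)
    case 0
    then show ?case by (simp split: if_splits)
  next
    case (Suc k)
    have "(\<Sum>c\<in>UNIV. entry (e j) a c * entry (e j ^ k) c b) \<noteq> 0"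
      using Suc.prems by (simp add: entry_times)
    then obtain c where "entry (e j) a c * entry (e j ^ k) c b \<noteq> 0"
      by (meson sum.not_neutral_contains_not_neutral)
    then have "entry (e j) a c \<noteq> 0" "entry (e j ^ k) c b \<noteq> 0" by auto
    then show ?case using Suc.IH[of c] wt_e[OF j j, of a c] cartan_self[OF j] by simp
  qed
  have "e j ^ k = 0" if "k \<ge> Suc M" for k
  proof (rule cm_eqI, rule ccontr)
    fix a b assume "entry (e j ^ k) a b \<noteq> entry 0 a b"
    then have "wt a j = wt b j + 2 * int k" using step by simp
    then show False using M[of a] M[of b] that by linarith
  qed
  then show ?thesis by blast
qed

lemma nilpotent_f: "j \<in> I \<Longrightarrow> \<exists>N. \<forall>k\<ge>N. f j ^ k = 0"
  by (rule D_group.nilpotent_e[OF flip])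

definition gen :: "bool \<Rightarrow> nat \<Rightarrow> complex \<Rightarrow> 'm cm" where "gen b i t = (if b then x i t else y i t)"

lemma entry_exp_nilpotent:
  assumes "\<And>k. k \<ge> N \<Longrightarrow> Z ^ k = 0"
  shows "entry (A * exp (scal t * Z) * B) a b = (\<Sum>k<N. (entry (A * Z ^ k * B) a b / fact k) * t ^ k)"
proof -
  have pow: "(scal t * Z) ^ k = scal (t ^ k) * Z ^ k" for k
  proof (induction k)
    case (Suc k)
    then show ?case by (simp only: power_Suc scal_mult mult.assoc scal_left_comm[of Z])
  qed simp
  have bl: "bounded_linear (\<lambda>Y. entry (A * Y * B) a b)"
  proof -
    have "bounded_linear (\<lambda>Y. A * Y * B)"
      using bounded_linear_compose[OF bounded_linear_mult_left[of B] bounded_linear_mult_right[of A]]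
      by (simp add: o_def)
    from bounded_linear_compose[OF bounded_linear_entry this] show ?thesis by (simp add: o_def)
  qed
  have "entry (A * exp (scal t * Z) * B) a b = (\<Sum>k. entry (A * ((scal t * Z) ^ k /\<^sub>R fact k) * B) a b)"
    unfolding exp_def by (rule bounded_linear.suminf[OF bl summable_exp_generic])
  also have "(\<lambda>k. entry (A * ((scal t * Z) ^ k /\<^sub>R fact k) * B) a b) = (\<lambda>k. (entry (A * Z ^ k * B) a b / fact k) * t ^ k)"
  proof
    fix k
    have "A * ((scal t * Z) ^ k /\<^sub>R fact k) * B = (scal (t ^ k) * (A * Z ^ k * B)) /\<^sub>R fact k"
      by (simp only: pow mult_scaleR_left mult_scaleR_right scal_left_comm[of A] mult.assoc)
    then have "entry (A * ((scal t * Z) ^ k /\<^sub>R fact k) * B) a b = (t ^ k * entry (A * Z ^ k * B) a b) /\<^sub>R fact k"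
      by (simp only: entry_simps(5) entry_scal_times)
    then show "entry (A * ((scal t * Z) ^ k /\<^sub>R fact k) * B) a b = (entry (A * Z ^ k * B) a b / fact k) * t ^ k"
      by (simp add: scaleR_conv_of_real divide_inverse mult_ac)
  qed
  also have "(\<Sum>k. (entry (A * Z ^ k * B) a b / fact k) * t ^ k) = (\<Sum>k<N. (entry (A * Z ^ k * B) a b / fact k) * t ^ k)"
    by (rule suminf_finite) (use assms in auto)
  finally show ?thesis .
qed

text \<open>
  What density needs of a polynomial: it is a polynomial in the parameter of each single factor.
\<close>

definition polylike :: "('m cm \<Rightarrow> complex) \<Rightarrow> bool" where
  "polylike H \<longleftrightarrow> (\<forall>A B b. \<forall>i\<in>I. \<exists>q. \<forall>t. H (A * gen b i t * B) = poly q t)"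

lemma polylike_entry: "polylike (\<lambda>A. entry A a c)"
  unfolding polylike_def
proof (intro allI ballI)
  fix A B :: "'m cm" and b i assume i: "i \<in> I"
  define Z where "Z = (if b then e i else f i)"
  obtain N where N: "\<And>k. k \<ge> N \<Longrightarrow> Z ^ k = 0"
    using nilpotent_e[OF i] nilpotent_f[OF i] unfolding Z_def by (cases b) auto
  have "entry (A * gen b i t * B) a c = poly (\<Sum>k<N. monom (entry (A * Z ^ k * B) a c / fact k) k) t" for t
    using entry_exp_nilpotent[where N = N and Z = Z and A = A and B = B and t = t and a = a and b = c] N
    by (simp add: gen_def Z_def x_def y_def poly_sum poly_monom split: if_splits)
  then show "\<exists>q. \<forall>t. entry (A * gen b i t * B) a c = poly q t" by blast
qed

lemma polylike_const: "polylike (\<lambda>_. z)"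
  unfolding polylike_def by (metis poly_pCons mult_zero_right poly_0 add.right_neutral)

lemma polylike_add: "polylike H \<Longrightarrow> polylike H' \<Longrightarrow> polylike (\<lambda>A. H A + H' A)"
  unfolding polylike_def by (metis poly_add)

lemma polylike_mult: "polylike H \<Longrightarrow> polylike H' \<Longrightarrow> polylike (\<lambda>A. H A * H' A)"
  unfolding polylike_def by (metis poly_mult)

lemma polylike_diff: "polylike H \<Longrightarrow> polylike H' \<Longrightarrow> polylike (\<lambda>A. H A - H' A)"
  unfolding polylike_def by (metis poly_diff)

lemma polylike_translate: "polylike H \<Longrightarrow> polylike (\<lambda>A. H (L * A * R))"
  unfolding polylike_def
proof (intro allI ballI)
  fix A B b i
  assume "\<forall>A B b. \<forall>i\<in>I. \<exists>q. \<forall>t. H (A * gen b i t * B) = poly q t" "i \<in> I"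
  then obtain q where "\<forall>t. H ((L * A) * gen b i t * (B * R)) = poly q t" by blast
  then show "\<exists>q. \<forall>t. H (L * (A * gen b i t * B) * R) = poly q t"
    by (intro exI[of _ q]) (simp add: mult.assoc[symmetric])
qed

lemma polylike_polynomial_map: "polynomial_map q \<Longrightarrow> polylike (\<lambda>A. q (mat_of A))"
  by (induction rule: polynomial_map.induct)
    (use polylike_entry in \<open>simp_all add: polylike_const polylike_add polylike_mult entry_def\<close>)

lemma continuous_polynomial_map: "polynomial_map q \<Longrightarrow> continuous_on UNIV (\<lambda>A. q (mat_of (A :: 'm cm)))"
proof (induction rule: polynomial_map.induct)
  case (entry a b)
  then show ?case
    using bounded_linear.continuous_on[OF bounded_linear_entry continuous_on_id, of UNIV a b]
    by (simp add: entry_def)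
qed (auto intro: continuous_intros)

definition W :: "(bool \<times> nat \<times> complex) list \<Rightarrow> 'm cm" where
  "W ls = prod_list (map (\<lambda>(b, i, t). gen b i t) ls)"

definition indexed :: "(bool \<times> nat \<times> complex) list \<Rightarrow> bool" where
  "indexed ls \<longleftrightarrow> (\<forall>(b, i, t)\<in>set ls. i \<in> I)"

definition pos :: "complex \<Rightarrow> bool" where "pos z \<longleftrightarrow> (\<exists>s>0. z = of_real s)"

definition positive :: "(bool \<times> nat \<times> complex) list \<Rightarrow> bool" where
  "positive ls \<longleftrightarrow> (\<forall>(b, i, t)\<in>set ls. i \<in> I \<and> pos t)"

text \<open>The inverse of a letter is the letter with the negated parameter, so these words are
  closed under inversion as well.\<close>

definition grp :: "'m cm set" where "grp = {W ls | ls. indexed ls}"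

lemma pos_ne_0: "pos z \<Longrightarrow> z \<noteq> 0"
  by (auto simp: pos_def)

lemma pos_mult: "pos z \<Longrightarrow> pos w \<Longrightarrow> pos (z * w)"
  unfolding pos_def by (metis mult_pos_pos of_real_mult)

lemma pos_add: "pos z \<Longrightarrow> pos w \<Longrightarrow> pos (z + w)"
  unfolding pos_def by (metis add_pos_pos of_real_add)

lemma pos_inverse: "pos z \<Longrightarrow> pos (inverse z)"
  unfolding pos_def by (metis inverse_positive_iff_positive of_real_inverse)

lemma pos_divide: "pos z \<Longrightarrow> pos w \<Longrightarrow> pos (z / w)"
  by (simp add: divide_inverse pos_mult pos_inverse)

lemma pos_1 [simp]: "pos 1"
  unfolding pos_def by (intro exI[of _ 1]) simp

lemma pos_powi: "pos z \<Longrightarrow> pos (z powi k)"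
  unfolding pos_def by (metis zero_less_power_int of_real_power_int)

lemma W_simps [simp]: "W [] = 1" "W ((b, i, t) # ls) = gen b i t * W ls" "W (ls @ ms) = W ls * W ms"
  by (simp_all add: W_def)

text \<open>Positivity is dropped one letter at a time: as a function of one parameter,
  \<open>H\<close> is a polynomial with every positive real number as a root.\<close>

lemma density:
  assumes H: "polylike H" and pos: "\<And>ls. positive ls \<Longrightarrow> H (W ls) = 0" and A: "A \<in> grp"
  shows "H A = 0"
proof -
  have "indexed ls \<Longrightarrow> positive ms \<Longrightarrow> H (W ls * W ms) = 0" for ls ms
  proof (induction ls arbitrary: ms rule: rev_induct)
    case Nil
    then show ?case using pos by simp
  next
    case (snoc l ls)
    obtain b i t where l: "l = (b, i, t)" using prod_cases3 by blast
    have i: "i \<in> I" and ls: "indexed ls" using snoc.prems l by (auto simp: indexed_def)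
    obtain q where q: "\<And>t. H (W ls * gen b i t * W ms) = poly q t"
      using H i unfolding polylike_def by blast
    have "poly q (of_real s) = 0" if "s > 0" for s
    proof -
      have "positive ((b, i, of_real s) # ms)"
        using snoc.prems(2) i that by (auto simp: positive_def pos_def)
      from snoc.IH[OF ls this] show ?thesis by (simp add: q[symmetric] mult.assoc)
    qed
    then have "q = 0" by (rule poly_zero_on_positive)
    then show ?case using q[of t] by (simp add: l mult.assoc)
  qed
  from this[of _ "[]"] show ?thesis using A by (auto simp: grp_def positive_def)
qed

lemma density_eq:
  assumes "polylike H" "polylike H'" "\<And>ls. positive ls \<Longrightarrow> H (W ls) = H' (W ls)" "A \<in> grp"
  shows "H A = H' A"
  using density[OF polylike_diff[OF assms(1,2)] _ assms(4)] assms(3) by simp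

lemma grp_1 [simp]: "1 \<in> grp"
  unfolding grp_def by (auto intro!: exI[of _ "[]"] simp: indexed_def)

lemma grp_mult: "A \<in> grp \<Longrightarrow> B \<in> grp \<Longrightarrow> A * B \<in> grp"
proof -
  assume "A \<in> grp" "B \<in> grp"
  then obtain ls ms where "A = W ls" "indexed ls" "B = W ms" "indexed ms" by (auto simp: grp_def)
  then show ?thesis unfolding grp_def
    by (intro CollectI exI[of _ "ls @ ms"]) (auto simp: indexed_def)
qed

lemma grp_x: "i \<in> I \<Longrightarrow> x i t \<in> grp" and grp_y: "i \<in> I \<Longrightarrow> y i t \<in> grp"
proof -
  assume i: "i \<in> I"
  show "x i t \<in> grp" unfolding grp_def
    by (rule CollectI, rule exI[of _ "[(True, i, t)]"]) (use i in \<open>simp add: indexed_def gen_def\<close>)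
  show "y i t \<in> grp" unfolding grp_def
    by (rule CollectI, rule exI[of _ "[(False, i, t)]"]) (use i in \<open>simp add: indexed_def gen_def\<close>)
qed

lemma grp_sb: "i \<in> I \<Longrightarrow> sb i \<in> grp" and grp_sbi: "i \<in> I \<Longrightarrow> sbi i \<in> grp"
  unfolding sb_def sbi_def by (intro grp_mult grp_x grp_y; assumption)+

lemma grp_sw: "set is \<subseteq> I \<Longrightarrow> sw is \<in> grp" and grp_swi: "set is \<subseteq> I \<Longrightarrow> swi is \<in> grp"
  by (induction "is") (auto simp: sw_Cons swi_Cons intro!: grp_mult grp_sb grp_sbi)

lemma grp_co: assumes "i \<in> I" "c \<noteq> 0" shows "co i c \<in> grp"
proof -
  have "co i c = y i (- inverse c) * (y i (inverse c) * co i c)"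
    by (simp add: mult.assoc[symmetric] y_add)
  also have "\<dots> = y i (- inverse c) * (x i c * sb i * x i (inverse c))"
    using y_co[OF assms(1), of "inverse c"] assms(2) by simp
  also have "\<dots> \<in> grp" by (intro grp_mult grp_x grp_y grp_sb assms(1))
  finally show ?thesis .
qed

section \<open>The torus, and positive words in the big cell\<close>

definition Y :: "(nat \<times> complex) list \<Rightarrow> 'm cm" where "Y v = prod_list (map (\<lambda>(i, t). y i t) v)"

lemma Y_Nil [simp]: "Y [] = 1" and Y_Cons: "Y ((i, t) # v) = y i t * Y v"
  by (simp_all add: Y_def)

definition pos_word :: "(nat \<times> complex) list \<Rightarrow> bool" where
  "pos_word v \<longleftrightarrow> (\<forall>(i, t)\<in>set v. i \<in> I \<and> pos t)"

definition rescale :: "(nat \<Rightarrow> complex) \<Rightarrow> (nat \<times> complex) list \<Rightarrow> (nat \<times> complex) list" where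
  "rescale d v = map (\<lambda>(i, t). (i, d i * t)) v"

lemma fst_rescale: "fst ` set (rescale d v) = fst ` set v"
  by (force simp: rescale_def)

definition tor :: "(nat \<Rightarrow> complex) \<Rightarrow> 'm cm" where
  "tor t = prod_list (map (\<lambda>i. co i (t i)) [1..<Suc n])"

text \<open>The simple root with index \<open>j\<close> as a character of the torus.\<close>

definition tor_char :: "(nat \<Rightarrow> complex) \<Rightarrow> nat \<Rightarrow> complex" where
  "tor_char t j = (\<Prod>i\<in>I. t i powi cartan n i j)"

lemma prod_list_I: "prod_list (map h [1..<Suc n]) = (\<Prod>i\<in>I. h i)" for h :: "nat \<Rightarrow> complex"
proof -
  have "prod_list (map h [1..<Suc n]) = prod h (set [1..<Suc n])"
    by (rule prod.distinct_set_conv_list[symmetric]) simp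
  also have "set [1..<Suc n] = I" by auto
  finally show ?thesis .
qed

lemma entry_tor: "entry (tor t) a b = (if a = b then \<Prod>i\<in>I. t i powi wt a i else 0)"
proof -
  have "entry (prod_list (map (\<lambda>i. co i (t i)) is)) a b
      = (if a = b then prod_list (map (\<lambda>i. t i powi wt a i) is) else 0)" for "is"
    by (induction "is") (simp_all add: entry_diag_times[OF entry_co])
  then show ?thesis unfolding tor_def prod_list_I[symmetric] .
qed

lemma tor_mult: "tor t * tor s = tor (\<lambda>i. t i * s i)"
  by (rule cm_eqI) (simp add: entry_diag_times[OF entry_tor] entry_tor power_int_mult_distrib prod.distrib)

lemma tor_1: "tor (\<lambda>_. 1) = 1"
  by (rule cm_eqI) (simp add: entry_tor)

lemma co_tor: "i \<in> I \<Longrightarrow> co i c = tor ((\<lambda>_. 1)(i := c))"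
proof (rule cm_eqI)
  fix a b assume i: "i \<in> I"
  have "(\<Prod>l\<in>I. ((\<lambda>_. 1)(i := c)) l powi wt a l) = (\<Prod>l\<in>I. if l = i then c powi wt a i else 1)"
    by (rule prod.cong) auto
  also have "\<dots> = c powi wt a i" using i by simp
  finally show "entry (co i c) a b = entry (tor ((\<lambda>_. 1)(i := c))) a b"
    by (simp only: entry_co entry_tor)
qed

lemma tor_inv: "(\<And>i. i \<in> I \<Longrightarrow> t i \<noteq> 0) \<Longrightarrow> tor t * tor (\<lambda>i. inverse (t i)) = 1"
  by (rule cm_eqI) (simp add: entry_diag_times[OF entry_tor] entry_tor power_int_inverse
      prod.distrib[symmetric] power_int_not_zero)

lemma tor_x_y:
  assumes j: "j \<in> I" and t: "\<And>i. i \<in> I \<Longrightarrow> t i \<noteq> 0"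
  shows "tor t * x j s = x j (tor_char t j * s) * tor t" "tor t * y j s = y j (inverse (tor_char t j) * s) * tor t"
proof -
  have "set is \<subseteq> I \<Longrightarrow> prod_list (map (\<lambda>i. co i (t i)) is) * x j s
      = x j (prod_list (map (\<lambda>i. t i powi cartan n i j) is) * s) * prod_list (map (\<lambda>i. co i (t i)) is)
    \<and> prod_list (map (\<lambda>i. co i (t i)) is) * y j s
      = y j (inverse (prod_list (map (\<lambda>i. t i powi cartan n i j) is)) * s) * prod_list (map (\<lambda>i. co i (t i)) is)" for "is"
  proof (induction "is")
    case (Cons i "is")
    then have i: "i \<in> I" "t i \<noteq> 0" using t by auto
    show ?case
      using Cons co_x[OF i(1) j i(2)] co_y[OF i(1) j i(2)]
      by (simp add: mult.assoc) (simp add: mult.assoc[symmetric] power_int_minus mult.commute)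
  qed simp
  moreover have "set [1..<Suc n] \<subseteq> I" by auto
  ultimately show "tor t * x j s = x j (tor_char t j * s) * tor t"
    "tor t * y j s = y j (inverse (tor_char t j) * s) * tor t"
    unfolding tor_char_def tor_def prod_list_I[symmetric] by blast+
qed

lemma tor_char_ne_0: "(\<And>i. i \<in> I \<Longrightarrow> t i \<noteq> 0) \<Longrightarrow> tor_char t j \<noteq> 0"
  unfolding tor_char_def by (simp add: prod_zero_iff)

lemma tor_Y:
  assumes t: "\<And>i. i \<in> I \<Longrightarrow> t i \<noteq> 0"
  shows "fst ` set v \<subseteq> I \<Longrightarrow> tor t * Y v = Y (rescale (\<lambda>i. inverse (tor_char t i)) v) * tor t"
proof (induction v)
  case (Cons a v)
  obtain i s where a: "a = (i, s)" by force
  have "tor t * Y (a # v) = (tor t * y i s) * Y v" by (simp only: a Y_Cons mult.assoc)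
  also have "\<dots> = y i (inverse (tor_char t i) * s) * (tor t * Y v)"
    using Cons.prems a tor_x_y[where t = t and j = i and s = s] t by (simp add: mult.assoc[symmetric])
  finally show ?case using Cons by (simp add: a rescale_def Y_Cons mult.assoc)
qed (simp add: rescale_def)

lemma tor_X:
  assumes t: "\<And>i. i \<in> I \<Longrightarrow> t i \<noteq> 0"
  shows "fst ` set v \<subseteq> I \<Longrightarrow> tor t * X v = X (rescale (\<lambda>i. tor_char t i) v) * tor t"
proof (induction v)
  case (Cons a v)
  obtain i s where a: "a = (i, s)" by force
  have "tor t * X (a # v) = (tor t * x i s) * X v" by (simp only: a X_Cons mult.assoc)
  also have "\<dots> = x i (tor_char t i * s) * (tor t * X v)"
    using Cons.prems a tor_x_y[where t = t and j = i and s = s] t by (simp add: mult.assoc[symmetric])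
  finally show ?case using Cons by (simp add: a rescale_def X_Cons mult.assoc)
qed (simp add: rescale_def)

lemma X_tor:
  assumes t: "\<And>i. i \<in> I \<Longrightarrow> t i \<noteq> 0" and v: "fst ` set v \<subseteq> I"
  shows "X v * tor t = tor t * X (rescale (\<lambda>i. inverse (tor_char t i)) v)"
proof -
  have "rescale (\<lambda>i. tor_char t i) (rescale (\<lambda>i. inverse (tor_char t i)) v) = v"
    using tor_char_ne_0[OF t] by (induction v) (auto simp: rescale_def)
  then show ?thesis
    using tor_X[where t = t and v = "rescale (\<lambda>i. inverse (tor_char t i)) v"] t v by (simp add: fst_rescale)
qed

definition pos_torus :: "(nat \<Rightarrow> complex) \<Rightarrow> bool" where "pos_torus t \<longleftrightarrow> (\<forall>i. pos (t i))"

lemma pos_torus_ne_0: "pos_torus t \<Longrightarrow> t i \<noteq> 0"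
  by (simp add: pos_torus_def pos_ne_0)

lemma pos_tor_char: "pos_torus t \<Longrightarrow> pos (tor_char t j)"
proof -
  assume t: "pos_torus t"
  have "finite J \<Longrightarrow> pos (\<Prod>i\<in>J. t i powi cartan n i j)" for J
    by (induction J rule: finite_induct) (use t in \<open>auto simp: pos_torus_def intro!: pos_mult pos_powi\<close>)
  then show ?thesis by (simp add: tor_char_def)
qed

lemma pos_word_fst: "pos_word v \<Longrightarrow> fst ` set v \<subseteq> I"
  by (auto simp: pos_word_def)

lemma pos_word_rescale: "pos_word v \<Longrightarrow> (\<And>i. pos (d i)) \<Longrightarrow> pos_word (rescale d v)"
  by (auto simp: pos_word_def rescale_def intro!: pos_mult)

text \<open>A letter \<open>y\<close> with another index commutes with \<open>x i s\<close>. One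
  with the same index leaves a torus factor \<open>1 + s * r\<close>, which cannot vanish because
  both parameters are positive. Moving that factor past the rest rescales by positive numbers, so
  positivity persists.\<close>

lemma x_Y:
  assumes i: "i \<in> I"
  shows "pos_word u \<Longrightarrow> pos s \<Longrightarrow> \<exists>u' t s'. pos_word u' \<and> pos_torus t \<and> pos s' \<and> x i s * Y u = Y u' * tor t * x i s'"
proof (induction u arbitrary: s)
  case Nil
  then show ?case
    by (intro exI[of _ "[]"] exI[of _ "\<lambda>_. 1"] exI[of _ s]) (simp add: pos_word_def pos_torus_def tor_1)
next
  case (Cons a u)
  obtain j r where a: "a = (j, r)" by force
  have j: "j \<in> I" and r: "pos r" and u: "pos_word u" using Cons.prems a by (auto simp: pos_word_def)
  show ?case
  proof (cases "j = i")
    case False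
    obtain u' t s' where *: "pos_word u'" "pos_torus t" "pos s'" "x i s * Y u = Y u' * tor t * x i s'"
      using Cons.IH[OF u Cons.prems(2)] by blast
    have "x i s * Y (a # u) = y j r * (x i s * Y u)"
      using x_y_commute[OF i j, of s r] False by (simp add: a Y_Cons mult.assoc[symmetric])
    also have "\<dots> = Y ((j, r) # u') * tor t * x i s'" unfolding * by (simp only: Y_Cons mult.assoc)
    finally show ?thesis
      using * j r by (intro exI[of _ "(j, r) # u'"] exI[of _ t] exI[of _ s']) (simp add: pos_word_def)
  next
    case True
    define d where "d = 1 + s * r"
    have d: "pos d" unfolding d_def by (intro pos_add pos_mult pos_1 r Cons.prems)
    obtain u' t s' where *: "pos_word u'" "pos_torus t" "pos s'" "x i (s / d) * Y u = Y u' * tor t * x i s'"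
      using Cons.IH[OF u pos_divide[OF Cons.prems(2) d]] by blast
    define td where "td = (\<lambda>_. 1 :: complex)(i := d)"
    have td: "pos_torus td" using d by (simp add: td_def pos_torus_def)
    have "x i s * Y (a # u) = (x i s * y i r) * Y u" by (simp only: a True Y_Cons mult.assoc)
    also have "\<dots> = y i (r / d) * co i d * (x i (s / d) * Y u)"
    proof -
      have xyd: "x i s * y i r = y i (r / d) * co i d * x i (s / d)"
        using x_y_self[OF i, of s r] pos_ne_0[OF d] by (simp add: d_def)
      show ?thesis unfolding xyd by (simp only: mult.assoc)
    qed
    also have "\<dots> = y i (r / d) * (tor td * Y u') * (tor t * x i s')"
      unfolding * co_tor[OF i] td_def by (simp only: mult.assoc)
    also have "\<dots> = Y ((i, r / d) # rescale (\<lambda>i. inverse (tor_char td i)) u') * (tor td * tor t) * x i s'"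
      by (simp only: tor_Y[OF pos_torus_ne_0[OF td] pos_word_fst[OF *(1)]] Y_Cons mult.assoc)
    also have "tor td * tor t = tor (\<lambda>i. td i * t i)" by (rule tor_mult)
    finally have eq: "x i s * Y (a # u) = Y ((i, r / d) # rescale (\<lambda>i. inverse (tor_char td i)) u') * tor (\<lambda>i. td i * t i) * x i s'" .
    have "pos_word (rescale (\<lambda>i. inverse (tor_char td i)) u')"
      by (intro pos_word_rescale * pos_inverse pos_tor_char td)
    then have "pos_word ((i, r / d) # rescale (\<lambda>i. inverse (tor_char td i)) u')"
      using i pos_divide[OF r d] by (simp add: pos_word_def)
    moreover have "pos_torus (\<lambda>i. td i * t i)" using td *(2) by (simp add: pos_torus_def pos_mult)
    ultimately show ?thesis using eq *(3) by blast
  qed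
qed

text \<open>This joins the two halves of the characterization of the minor: its values are given on
  the big cell, and \<open>density\<close> asks for values at positive words.\<close>

lemma positive_factorization:
  "positive ls \<Longrightarrow> \<exists>u t v. pos_word u \<and> pos_torus t \<and> pos_word v \<and> W ls = Y u * tor t * X v"
proof (induction ls)
  case Nil
  then show ?case
    by (intro exI[of _ "[]"] exI[of _ "\<lambda>_. 1"]) (simp add: pos_word_def pos_torus_def tor_1)
next
  case (Cons l ls)
  obtain b i s where l: "l = (b, i, s)" using prod_cases3 by blast
  have i: "i \<in> I" and s: "pos s" using Cons.prems l by (auto simp: positive_def)
  obtain u t v where *: "pos_word u" "pos_torus t" "pos_word v" "W ls = Y u * tor t * X v"
    using Cons by (auto simp: positive_def)
  show ?case
  proof (cases b)
    case False
    then have "W (l # ls) = Y ((i, s) # u) * tor t * X v"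
      by (simp add: l gen_def *(4) Y_Cons mult.assoc)
    moreover have "pos_word ((i, s) # u)" using * i s by (simp add: pos_word_def)
    ultimately show ?thesis using * by blast
  next
    case True
    obtain u' t' s' where h: "pos_word u'" "pos_torus t'" "pos s'" "x i s * Y u = Y u' * tor t' * x i s'"
      using x_Y[OF i *(1) s] by blast
    have "W (l # ls) = (x i s * Y u) * tor t * X v"
      using True by (simp add: l gen_def *(4) mult.assoc)
    also have "\<dots> = Y u' * tor t' * (X [(i, s')] * tor t) * X v"
      unfolding h by (simp add: X_Cons mult.assoc)
    also have "X [(i, s')] * tor t = tor t * X [(i, inverse (tor_char t i) * s')]"
      using X_tor[where t = t and v = "[(i, s')]"] pos_torus_ne_0[OF *(2)] i by (simp add: rescale_def)
    also have "Y u' * tor t' * (tor t * X [(i, inverse (tor_char t i) * s')]) * X v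
        = Y u' * (tor t' * tor t) * X ((i, inverse (tor_char t i) * s') # v)"
      by (simp add: X_Cons mult.assoc)
    finally have "W (l # ls) = Y u' * tor (\<lambda>i. t' i * t i) * X ((i, inverse (tor_char t i) * s') # v)"
      unfolding tor_mult .
    moreover have "pos_torus (\<lambda>i. t' i * t i)" using h *(2) by (simp add: pos_torus_def pos_mult)
    moreover have "pos_word ((i, inverse (tor_char t i) * s') # v)"
      using *(3) i h(3) pos_inverse[OF pos_tor_char[OF *(2)]] by (simp add: pos_word_def pos_mult)
    ultimately show ?thesis using h(1) by blast
  qed
qed

end

section \<open>Invariance of the minor and its value\<close>

lemma power_int_sum: "finite J \<Longrightarrow> (z::complex) \<noteq> 0 \<Longrightarrow> (\<Prod>l\<in>J. z powi h l) = z powi (\<Sum>l\<in>J. h l)"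
  by (induction J rule: finite_induct) (simp_all add: power_int_add)

context type_D
begin

text \<open>
  The coefficients of \<open>4 \<rho>\<close> in the simple roots; those of \<open>\<rho>\<close> need not be integers.
\<close>

definition rho_coeff :: "nat \<Rightarrow> int" where
  "rho_coeff l = (if l \<le> n - 2 then 2 * int l * (2 * int n - 1 - int l) else int n * (int n - 1))"

lemma sum_rho_coeff_sroot:
  assumes m: "m \<in> I"
  shows "(\<Sum>l\<in>I. rho_coeff l * sroot l m) = 4 * rho m"
proof -
  obtain r where r: "n = r + 2"
  proof -
    have "n = (n - 2) + 2" using n4 by simp
    then show ?thesis using that by blast
  qed
  have r2: "2 \<le> r" using n4 unfolding r by simp
  have sroot: "sroot l m = (if l \<le> r + 1 then (if m = l then 1 else if m = l + 1 then - 1 else 0)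
      else (if m = r + 1 \<or> m = r + 2 then 1 else 0))" for l
    unfolding sroot_def unfolding r by auto
  have rho_coeff: "rho_coeff l = (if l \<le> r then 2 * int l * (2 * int r + 3 - int l) else (int r + 2) * (int r + 1))" for l
    unfolding rho_coeff_def unfolding r by (simp add: algebra_simps)
  have rho: "rho m = int r + 2 - int m"
    using m unfolding rho_def unfolding r by simp
  have I: "I = {1..r + 2}" unfolding r ..
  have "1 \<le> m" "m \<le> r + 2" using m unfolding r by auto
  have red: "(\<Sum>l\<in>I. rho_coeff l * sroot l m) = (\<Sum>l\<in>S. rho_coeff l * sroot l m)"
    if "S \<subseteq> {1..r + 2}" "\<And>l. 1 \<le> l \<Longrightarrow> l \<le> r + 2 \<Longrightarrow> l \<notin> S \<Longrightarrow> sroot l m = 0" for S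
    unfolding I by (rule sum.mono_neutral_right) (use that in auto)
  from \<open>1 \<le> m\<close> \<open>m \<le> r + 2\<close> consider "m = 1" | "1 < m" "m \<le> r" | "m = r + 1" | "m = r + 2" by linarith
  then show ?thesis
  proof cases
    case 1
    have "(\<Sum>l\<in>I. rho_coeff l * sroot l m) = (\<Sum>l\<in>{1}. rho_coeff l * sroot l m)"
      by (rule red, use 1 r2 in simp, unfold sroot, use 1 r2 in auto)
    also have "\<dots> = 4 * rho m" unfolding sroot rho_coeff rho using 1 r2 by simp
    finally show ?thesis .
  next
    case 2
    have "(\<Sum>l\<in>I. rho_coeff l * sroot l m) = (\<Sum>l\<in>{m - 1, m}. rho_coeff l * sroot l m)"
      by (rule red, use 2 r2 in simp, unfold sroot, use 2 r2 in auto)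
    also have "\<dots> = rho_coeff m - rho_coeff (m - 1)"
    proof -
      have "m - 1 \<noteq> m" "sroot m m = 1" "sroot (m - 1) m = - 1" unfolding sroot using 2 by auto
      then show ?thesis by simp
    qed
    also have "\<dots> = 4 * rho m"
    proof -
      have "m - 1 \<le> r" "int (m - 1) = int m - 1" using 2 by auto
      then show ?thesis unfolding rho_coeff rho using 2 by (simp add: algebra_simps)
    qed
    finally show ?thesis .
  next
    case 3
    have "(\<Sum>l\<in>I. rho_coeff l * sroot l m) = (\<Sum>l\<in>{r, r + 1, r + 2}. rho_coeff l * sroot l m)"
      by (rule red, use 3 r2 in simp, unfold sroot, use 3 r2 in auto)
    also have "\<dots> = 4 * rho m" unfolding sroot rho_coeff rho using 3 r2 by (simp add: algebra_simps)
    finally show ?thesis .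
  next
    case 4
    have "(\<Sum>l\<in>I. rho_coeff l * sroot l m) = (\<Sum>l\<in>{r + 1, r + 2}. rho_coeff l * sroot l m)"
      by (rule red, use 4 r2 in simp, unfold sroot, use 4 r2 in auto)
    also have "\<dots> = 4 * rho m" unfolding sroot rho_coeff rho using 4 r2 by (simp add: algebra_simps)
    finally show ?thesis .
  qed
qed

text \<open>In the simply laced case roots and coroots have the same coordinates, so
  \<open>rho_coeff\<close> also describes a cocharacter; it has the same value 4 at every simple
  root.\<close>

lemma sum_rho_coeff_cartan:
  assumes i: "i \<in> I"
  shows "(\<Sum>l\<in>I. rho_coeff l * cartan n l i) = 4"
proof -
  have "(\<Sum>l\<in>I. rho_coeff l * cartan n l i) = (\<Sum>l\<in>I. \<Sum>m\<in>I. rho_coeff l * sroot l m * sroot i m)"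
  proof (rule sum.cong[OF refl])
    fix l assume "l \<in> I"
    from cartan_dot[OF this i] show "rho_coeff l * cartan n l i = (\<Sum>m\<in>I. rho_coeff l * sroot l m * sroot i m)"
      by (simp only: dot_def sum_distrib_left mult.assoc)
  qed
  also have "\<dots> = (\<Sum>m\<in>I. (\<Sum>l\<in>I. rho_coeff l * sroot l m) * sroot i m)"
    by (subst sum.swap) (simp add: sum_distrib_right)
  also have "\<dots> = (\<Sum>m\<in>I. 4 * (rho m * sroot i m))"
  proof (rule sum.cong[OF refl])
    fix m assume "m \<in> I"
    from sum_rho_coeff_sroot[OF this] show "(\<Sum>l\<in>I. rho_coeff l * sroot l m) * sroot i m = 4 * (rho m * sroot i m)" by simp
  qed
  also have "\<dots> = 4 * dot rho (sroot i)" by (simp add: dot_def sum_distrib_left)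
  finally show ?thesis by (simp add: dot_rho_sroot[OF i])
qed

lemma dot_omega_sroot:
  assumes "1 \<le> k" "k \<le> n - 2" "j \<in> I"
  shows "dot (omega k) (sroot j) = (if j = k then 1 else 0)"
  unfolding dot_sroot[OF assms(3)] using assms n4 by (auto simp: omega_def)

end

section \<open>Contracting one-parameter groups\<close>

context D_group
begin

text \<open>Conjugation by \<open>T\<close> scales the simple root subgroups as the value at
  \<open>z\<close> of the cocharacter \<open>a\<close> does. In this form the property passes to
  conjugates by the lifts.\<close>

definition acts :: "'m cm \<Rightarrow> complex \<Rightarrow> (nat \<Rightarrow> int) \<Rightarrow> bool" where
  "acts T z a \<longleftrightarrow> (\<forall>l\<in>I. \<forall>s. T * x l s = x l (z powi dot a (sroot l) * s) * T
      \<and> T * y l s = y l (z powi (- dot a (sroot l)) * s) * T)"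

text \<open>The conjugate of \<open>T\<close> is \<open>co i (inverse d) * T\<close>, and the extra
  coroot factor accounts for the correction term in the reflection of \<open>a\<close>.\<close>

lemma acts_sb:
  assumes T: "acts T z a" and z: "z \<noteq> 0" and i: "i \<in> I"
  shows "acts (sb i * T * sbi i) z (reflect i a)"
proof -
  define d where "d = z powi dot a (sroot i)"
  have d: "d \<noteq> 0" using z by (simp add: d_def)
  have Tx: "T * x i s = x i (d * s) * T" and Ty: "T * y i s = y i (inverse d * s) * T" for s
    using T i by (simp_all add: acts_def d_def power_int_minus)
  have "T * sb i = x i (- d) * y i (inverse d) * x i (- d) * T"
  proof -
    have "T * sb i = (T * x i (- 1)) * y i 1 * x i (- 1)" by (simp only: sb_def mult.assoc)
    also have "\<dots> = x i (- d) * (T * y i 1) * x i (- 1)" unfolding Tx by (simp add: mult.assoc)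
    also have "\<dots> = x i (- d) * y i (inverse d) * (T * x i (- 1))" unfolding Ty by (simp add: mult.assoc)
    also have "\<dots> = x i (- d) * y i (inverse d) * x i (- d) * T" unfolding Tx by (simp add: mult.assoc)
    finally show ?thesis .
  qed
  also have "\<dots> = co i d * sb i * T"
    unfolding sb_rescaled[OF i d] co_sb_self[OF i d] ..
  finally have "co i (inverse d) * (T * sb i) = (co i (inverse d) * co i d) * sb i * T"
    by (simp add: mult.assoc)
  then have h: "sb i * T = co i (inverse d) * (T * sb i)"
    unfolding co_inv(2)[OF d] by simp
  have "sb i * T * sbi i = co i (inverse d) * T * (sb i * sbi i)"
    unfolding h by (simp only: mult.assoc)
  then have eq: "sb i * T * sbi i = co i (inverse d) * T" by (simp add: sb_sbi)
  show ?thesis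
    unfolding acts_def eq
  proof (intro ballI allI conjI)
    fix l s assume l: "l \<in> I"
    have e: "dot (reflect i a) (sroot l) = dot a (sroot l) - dot a (sroot i) * cartan n i l"
      by (simp add: dot_reflect cartan_dot[OF i l])
    have pw: "inverse d powi cartan n i l * z powi dot a (sroot l) = z powi dot (reflect i a) (sroot l)"
    proof -
      have "z powi (dot a (sroot l) - dot a (sroot i) * cartan n i l) = z powi dot a (sroot l) / d powi cartan n i l"
        unfolding d_def power_int_mult[symmetric] by (rule power_int_diff) (use z in simp)
      then show ?thesis unfolding e by (simp add: power_int_inverse divide_inverse)
    qed
    have pw': "inverse d powi (- cartan n i l) * z powi (- dot a (sroot l)) = z powi (- dot (reflect i a) (sroot l))"
      using arg_cong[OF pw, of inverse] by (simp add: power_int_minus)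
    have "co i (inverse d) * T * x l s = co i (inverse d) * x l (z powi dot a (sroot l) * s) * T"
      using T l by (simp add: acts_def mult.assoc)
    also have "\<dots> = x l (inverse d powi cartan n i l * (z powi dot a (sroot l) * s)) * co i (inverse d) * T"
      using co_x[OF i l, of "inverse d"] d by simp
    finally show "co i (inverse d) * T * x l s = x l (z powi dot (reflect i a) (sroot l) * s) * (co i (inverse d) * T)"
      by (simp only: pw[symmetric] mult.assoc)
    have "co i (inverse d) * T * y l s = co i (inverse d) * y l (z powi (- dot a (sroot l)) * s) * T"
      using T l by (simp add: acts_def mult.assoc)
    also have "\<dots> = y l (inverse d powi (- cartan n i l) * (z powi (- dot a (sroot l)) * s)) * co i (inverse d) * T"
      using co_y[OF i l, of "inverse d"] d by simp
    finally show "co i (inverse d) * T * y l s = y l (z powi (- dot (reflect i a) (sroot l)) * s) * (co i (inverse d) * T)"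
      by (simp only: pw'[symmetric] mult.assoc)
  qed
qed

lemma acts_sw:
  assumes "acts T z a" "z \<noteq> 0"
  shows "set is \<subseteq> I \<Longrightarrow> acts (sw is * T * swi is) z (refls is a)"
proof (induction "is")
  case (Cons i "is")
  have "sw (i # is) * T * swi (i # is) = sb i * (sw is * T * swi is) * sbi i"
    by (simp only: sw_Cons swi_Cons mult.assoc)
  then show ?case using Cons acts_sb[OF _ assms(2)] by simp
qed (use assms in simp)

text \<open>\<open>swi is * x j t * sw is\<close> runs through the root subgroup of the root
  obtained from \<open>\<alpha>\<^sub>j\<close> by the inverse of \<open>is\<close>; the exponent is
  the value of \<open>a\<close> at this root.\<close>

lemma acts_conj:
  assumes T: "acts T z a" "z \<noteq> 0" and TT: "T * T' = 1" and s: "set is \<subseteq> I" and j: "j \<in> I"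
  shows "T * (swi is * x j t * sw is) * T' = swi is * x j (z powi dot (refls is a) (sroot j) * t) * sw is"
    and "T * (swi is * y j t * sw is) * T' = swi is * y j (z powi (- dot (refls is a) (sroot j)) * t) * sw is"
proof -
  define S where "S = sw is * T * swi is"
  have S: "acts S z (refls is a)" unfolding S_def by (rule acts_sw[OF T s])
  have gen: "T * (swi is * P * sw is) * T' = swi is * Q * sw is" if "S * P = Q * S" for P Q
  proof -
    have "T * (swi is * P * sw is) * T' = (swi is * sw is) * T * (swi is * P * sw is) * T'"
      by (simp add: swi_sw)
    also have "\<dots> = swi is * (S * P) * sw is * T'" by (simp only: S_def mult.assoc)
    also have "\<dots> = swi is * Q * (sw is * T * (swi is * sw is) * T')"
      unfolding that by (simp only: S_def mult.assoc)
    also have "\<dots> = swi is * Q * (sw is * (T * T'))" by (simp add: swi_sw mult.assoc)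
    finally show ?thesis by (simp add: TT)
  qed
  show "T * (swi is * x j t * sw is) * T' = swi is * x j (z powi dot (refls is a) (sroot j) * t) * sw is"
    by (rule gen) (use S j in \<open>simp add: acts_def\<close>)
  show "T * (swi is * y j t * sw is) * T' = swi is * y j (z powi (- dot (refls is a) (sroot j)) * t) * sw is"
    by (rule gen) (use S j in \<open>simp add: acts_def\<close>)
qed

text \<open>The cocharacter \<open>4 * rho\<close>, which is twice the sum of the positive coroots.
  Every simple root takes the value \<open>z ^ 4\<close> on it.\<close>

definition rho_tor :: "complex \<Rightarrow> 'm cm" where "rho_tor z = tor (\<lambda>l. z powi rho_coeff l)"

lemma rho_tor_inv: "z \<noteq> 0 \<Longrightarrow> rho_tor z * rho_tor (inverse z) = 1" "z \<noteq> 0 \<Longrightarrow> rho_tor (inverse z) * rho_tor z = 1"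
  using tor_inv[of "\<lambda>l. z powi rho_coeff l"] tor_inv[of "\<lambda>l. inverse z powi rho_coeff l"]
  by (simp_all add: rho_tor_def power_int_inverse)

lemma tor_char_rho_tor:
  assumes "z \<noteq> 0" "j \<in> I"
  shows "tor_char (\<lambda>l. z powi rho_coeff l) j = z ^ 4"
proof -
  have "tor_char (\<lambda>l. z powi rho_coeff l) j = z powi (\<Sum>l\<in>I. rho_coeff l * cartan n l j)"
    using assms(1) by (simp add: tor_char_def power_int_mult[symmetric] power_int_sum)
  then show ?thesis unfolding sum_rho_coeff_cartan[OF assms(2)] by simp
qed

lemma acts_rho_tor:
  assumes "z \<noteq> 0"
  shows "acts (rho_tor z) (z ^ 4) rho"
  unfolding acts_def
proof (intro ballI allI)
  fix l s assume l: "l \<in> I"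
  have t: "\<And>i. i \<in> I \<Longrightarrow> z powi rho_coeff i \<noteq> 0" using assms by simp
  show "rho_tor z * x l s = x l ((z ^ 4) powi dot rho (sroot l) * s) * rho_tor z \<and>
      rho_tor z * y l s = y l ((z ^ 4) powi - dot rho (sroot l) * s) * rho_tor z"
    using tor_x_y[where j = l and s = s and t = "\<lambda>l. z powi rho_coeff l"] l t
    unfolding tor_char_rho_tor[OF assms l] dot_rho_sroot[OF l] rho_tor_def by (simp add: power_int_minus)
qed

lemma rescale_cong: "(\<And>i. i \<in> fst ` set v \<Longrightarrow> d i = d' i) \<Longrightarrow> rescale d v = rescale d' v"
  unfolding rescale_def by (rule map_cong) force+

lemma rho_tor_Y:
  assumes "w \<noteq> 0" "fst ` set u \<subseteq> I"
  shows "rho_tor (inverse w) * Y u * rho_tor w = Y (rescale (\<lambda>_. w ^ 4) u)"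
proof -
  have t: "\<And>i. i \<in> I \<Longrightarrow> inverse w powi rho_coeff i \<noteq> 0" using assms by simp
  have "rescale (\<lambda>i. inverse (tor_char (\<lambda>l. inverse w powi rho_coeff l) i)) u = rescale (\<lambda>_. w ^ 4) u"
  proof (rule rescale_cong)
    fix i assume "i \<in> fst ` set u"
    then have "i \<in> I" using assms(2) by blast
    then show "inverse (tor_char (\<lambda>l. inverse w powi rho_coeff l) i) = w ^ 4"
      using assms(1) by (subst tor_char_rho_tor) (auto simp: power_inverse)
  qed
  then have "rho_tor (inverse w) * Y u = Y (rescale (\<lambda>_. w ^ 4) u) * rho_tor (inverse w)"
    unfolding rho_tor_def using tor_Y[where t = "\<lambda>l. inverse w powi rho_coeff l" and v = u] t assms(2) by simp
  then show ?thesis using rho_tor_inv(2)[OF assms(1)] by (simp add: mult.assoc)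
qed

lemma rho_tor_X:
  assumes "w \<noteq> 0" "fst ` set u \<subseteq> I"
  shows "rho_tor w * X u * rho_tor (inverse w) = X (rescale (\<lambda>_. w ^ 4) u)"
proof -
  have t: "\<And>i. i \<in> I \<Longrightarrow> w powi rho_coeff i \<noteq> 0" using assms by simp
  have "rescale (\<lambda>i. tor_char (\<lambda>l. w powi rho_coeff l) i) u = rescale (\<lambda>_. w ^ 4) u"
  proof (rule rescale_cong)
    fix i assume "i \<in> fst ` set u"
    then have "i \<in> I" using assms(2) by blast
    then show "tor_char (\<lambda>l. w powi rho_coeff l) i = w ^ 4"
      using assms(1) by (subst tor_char_rho_tor) auto
  qed
  then have "rho_tor w * X u = X (rescale (\<lambda>_. w ^ 4) u) * rho_tor w"
    unfolding rho_tor_def using tor_X[where t = "\<lambda>l. w powi rho_coeff l" and v = u] t assms(2) by simp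
  then show ?thesis using rho_tor_inv(1)[OF assms(1)] by (simp add: mult.assoc)
qed

lemma isCont_gen:
  assumes "i \<in> I"
  shows "isCont (\<lambda>t. gen b i t) t"
  unfolding isCont_def
proof (rule cm_tendstoI)
  fix a c
  obtain q where q: "\<And>t. entry (1 * gen b i t * 1) a c = poly q t"
    using polylike_entry[of a c] assms unfolding polylike_def by blast
  have "poly q \<midarrow>t\<rightarrow> poly q t" using poly_isCont[of t q] unfolding isCont_def .
  then show "((\<lambda>t. entry (gen b i t) a c) \<longlongrightarrow> entry (gen b i t) a c) (at t)"
    using q by simp
qed

lemma isCont_x: "i \<in> I \<Longrightarrow> isCont (x i) t" and isCont_y: "i \<in> I \<Longrightarrow> isCont (y i) t"
  using isCont_gen[where b = True and i = i and t = t] isCont_gen[where b = False and i = i and t = t] by (simp_all add: gen_def)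

lemma isCont_Y_rescale: "fst ` set u \<subseteq> I \<Longrightarrow> isCont (\<lambda>w. Y (rescale (\<lambda>_. w ^ m) u)) w"
  and isCont_X_rescale: "fst ` set u \<subseteq> I \<Longrightarrow> isCont (\<lambda>w. X (rescale (\<lambda>_. w ^ m) u)) w"
proof -
  have "fst ` set u \<subseteq> I \<Longrightarrow> isCont (\<lambda>w. Y (rescale (\<lambda>_. w ^ m) u)) w \<and> isCont (\<lambda>w. X (rescale (\<lambda>_. w ^ m) u)) w"
  proof (induction u)
    case (Cons a u)
    obtain i s where a: "a = (i, s)" by force
    have i: "i \<in> I" using Cons.prems a by simp
    have "isCont (\<lambda>w. w ^ m * s) w" by (intro continuous_intros)
    then have "isCont (\<lambda>w. y i (w ^ m * s)) w" "isCont (\<lambda>w. x i (w ^ m * s)) w"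
      using isCont_o2[where g = "y i"] isCont_o2[where g = "x i"] isCont_y[OF i] isCont_x[OF i] by blast+
    then show ?case using Cons by (simp add: a rescale_def Y_Cons X_Cons)
  qed (simp add: rescale_def)
  then show "fst ` set u \<subseteq> I \<Longrightarrow> isCont (\<lambda>w. Y (rescale (\<lambda>_. w ^ m) u)) w"
    "fst ` set u \<subseteq> I \<Longrightarrow> isCont (\<lambda>w. X (rescale (\<lambda>_. w ^ m) u)) w" by blast+
qed

lemma rescale_0: "Y (rescale (\<lambda>_. 0) u) = 1" "X (rescale (\<lambda>_. 0) u) = 1"
  by (induction u) (auto simp: rescale_def Y_Cons X_Cons)

text \<open>A word for the unipotent factor to the left of the lift. The letter \<open>x i\<close>
  that \<open>trans\<close> leaves to the right of \<open>sb i\<close> is omitted;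
  \<open>p_Theta\<close> shows that the minor does not see it.\<close>

fun left_word :: "(nat \<times> complex) list \<Rightarrow> (nat \<times> complex) list" where
  "left_word [] = []"
| "left_word ((i, c) # L) = (i, inverse c) # trans i c (left_word L)"

definition Theta :: "(nat \<times> complex) list \<Rightarrow> 'm cm" where
  "Theta L = prod_list (map (\<lambda>(i, c). y i c * co i (inverse c)) L)"

lemma fst_trans: "i \<in> I \<Longrightarrow> fst ` set v \<subseteq> I \<Longrightarrow> fst ` set (trans i a v) \<subseteq> I"
  by (induction i a v rule: trans.induct) auto

lemma fst_left_word: "fst ` set L \<subseteq> I \<Longrightarrow> fst ` set (left_word L) \<subseteq> I"
proof (induction L rule: left_word.induct)
  case (2 i c L)
  then show ?case using fst_trans[of i "left_word L" c] by simp
qed simp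

lemma grp_X: "fst ` set v \<subseteq> I \<Longrightarrow> X v \<in> grp"
  by (induction v) (auto simp: X_Cons intro!: grp_mult grp_x)

lemma grp_Y: "fst ` set v \<subseteq> I \<Longrightarrow> Y v \<in> grp"
  by (induction v) (auto simp: Y_Cons intro!: grp_mult grp_y)

lemma grp_tor:
  assumes "\<And>i. i \<in> I \<Longrightarrow> s i \<noteq> 0"
  shows "tor s \<in> grp"
proof -
  have "set is \<subseteq> I \<Longrightarrow> prod_list (map (\<lambda>i. co i (s i)) is) \<in> grp" for "is"
    by (induction "is") (use assms in \<open>auto intro!: grp_mult grp_co\<close>)
  moreover have "set [1..<Suc n] \<subseteq> I" by auto
  ultimately show ?thesis unfolding tor_def by blast
qed

end

text \<open>Here \<open>p\<close> is polynomial on all matrices, hence continuous, and its values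
  are prescribed on the big cell.\<close>

locale minor_D = D_group n e f wt for n e f and wt :: "'m::finite \<Rightarrow> nat \<Rightarrow> int" +
  fixes p :: "'m cm \<Rightarrow> complex" and k :: nat
  assumes k: "1 \<le> k" "k \<le> n - 2"
    and p_poly: "\<exists>q. polynomial_map q \<and> (\<forall>A. p A = q (mat_of A))"
    and p_val: "fst ` set u \<subseteq> {1..n} \<Longrightarrow> fst ` set v \<subseteq> {1..n} \<Longrightarrow> (\<And>i. i \<in> {1..n} \<Longrightarrow> t i \<noteq> 0) \<Longrightarrow>
      p (Y u * tor t * X v) = t k"
begin

lemma kI: "k \<in> I" using k by auto

lemma polylike_p: "polylike p"
  using p_poly polylike_polynomial_map by (metis (no_types, lifting) ext)

lemma isCont_p: "isCont p A"
proof -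
  obtain q where "polynomial_map q" "p = (\<lambda>A. q (mat_of A))" using p_poly by auto
  then show ?thesis
    using continuous_polynomial_map[of q] by (simp add: continuous_on_eq_continuous_at)
qed

lemma polylike_p_translate: "polylike (\<lambda>A. p (L * A * R))"
  by (rule polylike_translate[OF polylike_p])

lemma p_1: "p 1 = 1"
  using p_val[of "[]" "[]" "\<lambda>_. 1"] by (simp add: tor_1)

text \<open>Rules for \<open>p\<close> may be checked on the big cell: positive words lie there, and
  they are dense for polynomials. The factor \<open>r\<close> serves the torus characters.\<close>

lemma p_eqI:
  assumes "polylike H" "A \<in> grp"
    and H: "\<And>u t v. fst ` set u \<subseteq> I \<Longrightarrow> fst ` set v \<subseteq> I \<Longrightarrow> (\<And>i. i \<in> I \<Longrightarrow> t i \<noteq> 0) \<Longrightarrow>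
      H (Y u * tor t * X v) = r * t k"
  shows "H A = r * p A"
proof (rule density_eq[OF assms(1) polylike_mult[OF polylike_const polylike_p] _ assms(2)])
  fix ls assume "positive ls"
  then obtain u t v where *: "pos_word u" "pos_torus t" "pos_word v" "W ls = Y u * tor t * X v"
    using positive_factorization by blast
  show "H (W ls) = r * p (W ls)"
    unfolding *(4) using H[of u v t] p_val[of u v t] pos_word_fst pos_torus_ne_0 * by metis
qed

lemma p_x:
  assumes A: "A \<in> grp" and j: "j \<in> I"
  shows "p (A * x j s) = p A"
proof -
  have "p (1 * A * x j s) = 1 * p A"
  proof (rule p_eqI[OF polylike_p_translate A])
    fix u v :: "(nat \<times> complex) list" and t :: "nat \<Rightarrow> complex"
    assume *: "fst ` set u \<subseteq> I" "fst ` set v \<subseteq> I" "\<And>i. i \<in> I \<Longrightarrow> t i \<noteq> 0"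
    have "1 * (Y u * tor t * X v) * x j s = Y u * tor t * X (v @ [(j, s)])"
      by (simp add: X_def mult.assoc)
    then show "p (1 * (Y u * tor t * X v) * x j s) = 1 * t k"
      using p_val[of u "v @ [(j, s)]" t] * j by simp
  qed
  then show ?thesis by simp
qed

lemma p_y:
  assumes A: "A \<in> grp" and j: "j \<in> I"
  shows "p (y j s * A) = p A"
proof -
  have "p (y j s * A * 1) = 1 * p A"
  proof (rule p_eqI[OF polylike_p_translate A])
    fix u v :: "(nat \<times> complex) list" and t :: "nat \<Rightarrow> complex"
    assume *: "fst ` set u \<subseteq> I" "fst ` set v \<subseteq> I" "\<And>i. i \<in> I \<Longrightarrow> t i \<noteq> 0"
    have "y j s * (Y u * tor t * X v) * 1 = Y ((j, s) # u) * tor t * X v"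
      by (simp add: Y_Cons mult.assoc)
    then show "p (y j s * (Y u * tor t * X v) * 1) = 1 * t k"
      using p_val[of "(j, s) # u" v t] * j by simp
  qed
  then show ?thesis by simp
qed

lemma p_tor:
  assumes A: "A \<in> grp" and s: "\<And>i. i \<in> I \<Longrightarrow> s i \<noteq> 0"
  shows "p (tor s * A) = s k * p A" "p (A * tor s) = s k * p A"
proof -
  have "p (tor s * A * 1) = s k * p A"
  proof (rule p_eqI[OF polylike_p_translate A])
    fix u v :: "(nat \<times> complex) list" and t :: "nat \<Rightarrow> complex"
    assume *: "fst ` set u \<subseteq> I" "fst ` set v \<subseteq> I" "\<And>i. i \<in> I \<Longrightarrow> t i \<noteq> 0"
    have "tor s * (Y u * tor t * X v) * 1 = (tor s * Y u) * tor t * X v" by (simp add: mult.assoc)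
    also have "\<dots> = Y (rescale (\<lambda>i. inverse (tor_char s i)) u) * (tor s * tor t) * X v"
      using tor_Y[where t = s and v = u] s *(1) by (simp add: mult.assoc)
    finally show "p (tor s * (Y u * tor t * X v) * 1) = s k * t k"
      unfolding tor_mult by (simp only:) (rule p_val, use * s in \<open>auto simp: fst_rescale\<close>)
  qed
  then show "p (tor s * A) = s k * p A" by simp
  have "p (1 * A * tor s) = s k * p A"
  proof (rule p_eqI[OF polylike_p_translate A])
    fix u v :: "(nat \<times> complex) list" and t :: "nat \<Rightarrow> complex"
    assume *: "fst ` set u \<subseteq> I" "fst ` set v \<subseteq> I" "\<And>i. i \<in> I \<Longrightarrow> t i \<noteq> 0"
    have "1 * (Y u * tor t * X v) * tor s = Y u * tor t * (X v * tor s)" by (simp add: mult.assoc)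
    also have "\<dots> = Y u * (tor t * tor s) * X (rescale (\<lambda>i. inverse (tor_char s i)) v)"
      using X_tor[where t = s and v = v] s *(2) by (simp add: mult.assoc)
    finally have "p (1 * (Y u * tor t * X v) * tor s) = t k * s k"
      unfolding tor_mult by (simp only:) (rule p_val, use * s in \<open>auto simp: fst_rescale\<close>)
    then show "p (1 * (Y u * tor t * X v) * tor s) = s k * t k" by simp
  qed
  then show "p (A * tor s) = s k * p A" by simp
qed

lemma p_X: "A \<in> grp \<Longrightarrow> fst ` set v \<subseteq> I \<Longrightarrow> p (A * X v) = p A"
proof (induction v arbitrary: A)
  case (Cons a v)
  obtain i s where a: "a = (i, s)" by force
  have i: "i \<in> I" using Cons.prems a by simp
  have "p (A * X (a # v)) = p ((A * x i s) * X v)" by (simp add: a X_Cons mult.assoc)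
  also have "\<dots> = p (A * x i s)" by (rule Cons.IH) (use Cons.prems i in \<open>auto intro!: grp_mult grp_x\<close>)
  finally show ?case using p_x[OF Cons.prems(1) i] by simp
qed simp

lemma p_Y: "A \<in> grp \<Longrightarrow> fst ` set u \<subseteq> I \<Longrightarrow> p (Y u * A) = p A"
proof (induction u)
  case (Cons a u)
  obtain i s where a: "a = (i, s)" by force
  have i: "i \<in> I" using Cons.prems a by simp
  have "p (Y (a # u) * A) = p (y i s * (Y u * A))" by (simp add: a Y_Cons mult.assoc)
  also have "\<dots> = p (Y u * A)" by (rule p_y) (use Cons.prems i in \<open>auto intro!: grp_mult grp_Y\<close>)
  finally show ?case using Cons by simp
qed simp

lemma p_rho_tor_conj:
  assumes "A \<in> grp" "z \<noteq> 0" 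
  shows "p (rho_tor z * A * rho_tor (inverse z)) = p A"
proof -
  have 1: "\<And>i. i \<in> I \<Longrightarrow> z powi rho_coeff i \<noteq> 0" "\<And>i. i \<in> I \<Longrightarrow> inverse z powi rho_coeff i \<noteq> 0" using assms by auto
  have "rho_tor z \<in> grp"
    unfolding rho_tor_def by (rule grp_tor) (rule 1)
  then have "p ((rho_tor z * A) * rho_tor (inverse z)) = inverse z powi rho_coeff k * p (rho_tor z * A)"
    unfolding rho_tor_def[of "inverse z"] using 1 assms by (intro p_tor(2)) (auto intro: grp_mult)
  also have "p (rho_tor z * A) = z powi rho_coeff k * p A"
    unfolding rho_tor_def using 1 assms by (intro p_tor(1)) auto
  finally show ?thesis using assms(2) by (simp add: power_int_inverse)
qed

text \<open>Conjugation by \<open>rho_tor (inverse w)\<close> does not change \<open>p\<close>, and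
  as \<open>w\<close> tends to 0 it contracts both \<open>Z t\<close> and the lower unipotent
  \<open>Y u\<close> to 1. So \<open>p (Z t * Y u)\<close> is \<open>p 1\<close>. On the big cell
  the factors \<open>tor s\<close> and \<open>X v\<close> are then split off on the right, and
  \<open>p_eqI\<close> reaches the whole group.\<close>

lemma limit_left:
  assumes cont: "\<And>t. isCont Z t" and Z0: "Z 0 = 1" and ZG: "\<And>t. Z t \<in> grp" and M: "M > 0"
    and conj: "\<And>w t. w \<noteq> 0 \<Longrightarrow> rho_tor (inverse w) * Z t * rho_tor w = Z (w ^ M * t)"
    and A: "A \<in> grp"
  shows "p (Z t * A) = p A"
proof -
  have one: "p (Z t * Y u) = 1" if u: "fst ` set u \<subseteq> I" for u
  proof -
    define q where "q w = p (Z (w ^ M * t) * Y (rescale (\<lambda>_. w ^ 4) u))" for w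
    have "q w = p (Z t * Y u)" if w: "w \<noteq> 0" for w
    proof -
      have "rho_tor (inverse w) * (Z t * Y u) * rho_tor w
          = rho_tor (inverse w) * Z t * (rho_tor w * rho_tor (inverse w)) * Y u * rho_tor w"
        by (simp add: rho_tor_inv(1)[OF w] mult.assoc)
      also have "\<dots> = (rho_tor (inverse w) * Z t * rho_tor w) * (rho_tor (inverse w) * Y u * rho_tor w)"
        by (simp only: mult.assoc)
      also have "\<dots> = Z (w ^ M * t) * Y (rescale (\<lambda>_. w ^ 4) u)"
        by (simp only: conj[OF w] rho_tor_Y[OF w u])
      finally show ?thesis
        using p_rho_tor_conj[of "Z t * Y u" "inverse w"] w ZG grp_Y[OF u] by (simp add: q_def grp_mult)
    qed
    moreover have "isCont q 0"
    proof -
      have "isCont (\<lambda>w. w ^ M * t) 0" by (intro continuous_intros)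
      then have "isCont (\<lambda>w. Z (w ^ M * t)) 0"
        using isCont_o2[where g = Z] cont by blast
      then have "isCont (\<lambda>w. Z (w ^ M * t) * Y (rescale (\<lambda>_. w ^ 4) u)) 0"
        using isCont_Y_rescale[OF u] by (intro isCont_mult)
      from isCont_o2[OF this isCont_p] show ?thesis by (simp add: q_def[abs_def])
    qed
    ultimately have "q 0 = p (Z t * Y u)" by (rule tendsto_const_at_0[rotated])
    then show ?thesis using M by (simp add: q_def Z0 rescale_0 p_1 power_0_left)
  qed
  have "p (Z t * A * 1) = 1 * p A"
  proof (rule p_eqI[OF polylike_p_translate A])
    fix u v :: "(nat \<times> complex) list" and s :: "nat \<Rightarrow> complex"
    assume *: "fst ` set u \<subseteq> I" "fst ` set v \<subseteq> I" "\<And>i. i \<in> I \<Longrightarrow> s i \<noteq> 0"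
    have ZY: "Z t * Y u \<in> grp" by (intro grp_mult ZG grp_Y *)
    have "p (Z t * (Y u * tor s * X v) * 1) = p ((Z t * Y u * tor s) * X v)" by (simp add: mult.assoc)
    also have "\<dots> = p (Z t * Y u * tor s)" by (intro p_X grp_mult ZG grp_Y grp_tor *)
    also have "\<dots> = s k" using p_tor(2)[OF ZY, of s] *(3) one[OF *(1)] by simp
    finally show "p (Z t * (Y u * tor s * X v) * 1) = 1 * s k" by simp
  qed
  then show ?thesis by simp
qed

lemma limit_right:
  assumes cont: "\<And>t. isCont Z t" and Z0: "Z 0 = 1" and ZG: "\<And>t. Z t \<in> grp" and M: "M > 0"
    and conj: "\<And>w t. w \<noteq> 0 \<Longrightarrow> rho_tor w * Z t * rho_tor (inverse w) = Z (w ^ M * t)"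
    and A: "A \<in> grp"
  shows "p (A * Z t) = p A"
proof -
  have one: "p (X u * Z t) = 1" if u: "fst ` set u \<subseteq> I" for u
  proof -
    define q where "q w = p (X (rescale (\<lambda>_. w ^ 4) u) * Z (w ^ M * t))" for w
    have "q w = p (X u * Z t)" if w: "w \<noteq> 0" for w
    proof -
      have "rho_tor w * (X u * Z t) * rho_tor (inverse w)
          = rho_tor w * X u * (rho_tor (inverse w) * rho_tor w) * Z t * rho_tor (inverse w)"
        by (simp add: rho_tor_inv(2)[OF w] mult.assoc)
      also have "\<dots> = (rho_tor w * X u * rho_tor (inverse w)) * (rho_tor w * Z t * rho_tor (inverse w))"
        by (simp only: mult.assoc)
      also have "\<dots> = X (rescale (\<lambda>_. w ^ 4) u) * Z (w ^ M * t)"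
        by (simp only: conj[OF w] rho_tor_X[OF w u])
      finally show ?thesis
        using p_rho_tor_conj[of "X u * Z t" w] w ZG grp_X[OF u] by (simp add: q_def grp_mult)
    qed
    moreover have "isCont q 0"
    proof -
      have "isCont (\<lambda>w. w ^ M * t) 0" by (intro continuous_intros)
      then have "isCont (\<lambda>w. Z (w ^ M * t)) 0"
        using isCont_o2[where g = Z] cont by blast
      then have "isCont (\<lambda>w. X (rescale (\<lambda>_. w ^ 4) u) * Z (w ^ M * t)) 0"
        using isCont_X_rescale[OF u] by (intro isCont_mult)
      from isCont_o2[OF this isCont_p] show ?thesis by (simp add: q_def[abs_def])
    qed
    ultimately have "q 0 = p (X u * Z t)" by (rule tendsto_const_at_0[rotated])
    then show ?thesis using M by (simp add: q_def Z0 rescale_0 p_1 power_0_left)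
  qed
  have "p (1 * A * Z t) = 1 * p A"
  proof (rule p_eqI[OF polylike_p_translate A])
    fix u v :: "(nat \<times> complex) list" and s :: "nat \<Rightarrow> complex"
    assume *: "fst ` set u \<subseteq> I" "fst ` set v \<subseteq> I" "\<And>i. i \<in> I \<Longrightarrow> s i \<noteq> 0"
    have XZ: "X v * Z t \<in> grp" by (intro grp_mult ZG grp_X *)
    have "p (1 * (Y u * tor s * X v) * Z t) = p (Y u * (tor s * (X v * Z t)))" by (simp add: mult.assoc)
    also have "\<dots> = p (tor s * (X v * Z t))" by (intro p_Y grp_mult ZG grp_X grp_tor *)
    also have "\<dots> = s k" using p_tor(1)[OF XZ, of s] *(3) one[OF *(2)] by simp
    finally show "p (1 * (Y u * tor s * X v) * Z t) = 1 * s k" by simp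
  qed
  then show ?thesis by simp
qed

lemma powi_nat: "m > 0 \<Longrightarrow> (z ^ 4) powi m = z ^ (4 * nat m)" for z :: complex
  by (simp add: power_int_def power_mult)

text \<open>\<open>dot (refls is rho) (sroot j)\<close> is the height of the root obtained from
  \<open>\<alpha>\<^sub>j\<close> by the inverse of \<open>is\<close>. If it is positive, the
  conjugate of \<open>y j\<close> is a lower root subgroup, which is contracted as
  \<open>limit_left\<close> requires. In \<open>p_left_x\<close> and \<open>p_right_x\<close> the
  sign decides in the same way.\<close>

lemma p_left_y:
  assumes s: "set is \<subseteq> I" and j: "j \<in> I" and d: "0 < dot (refls is rho) (sroot j)" and A: "A \<in> grp"
  shows "p (swi is * y j t * A) = p (swi is * A)"
proof -
  define Z where "Z t = swi is * y j t * sw is" for t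
  define M where "M = 4 * nat (dot (refls is rho) (sroot j))"
  have "p (Z t * (swi is * A)) = p (swi is * A)"
  proof (rule limit_left[where M = M])
    show "isCont Z t" for t
      unfolding Z_def[abs_def] using isCont_y[OF j, of t] by (intro isCont_mult) auto
    show "Z 0 = 1" by (simp add: Z_def swi_sw)
    show "Z t \<in> grp" for t unfolding Z_def by (intro grp_mult grp_swi grp_sw grp_y s j)
    show "M > 0" using d by (simp add: M_def)
    show "rho_tor (inverse w) * Z t * rho_tor w = Z (w ^ M * t)" if w: "w \<noteq> 0" for w t
    proof -
      have w': "inverse w \<noteq> 0" "inverse w ^ 4 \<noteq> 0" using w by auto
      have "(inverse w ^ 4) powi (- dot (refls is rho) (sroot j)) = w ^ M"
        using powi_nat[OF d, of w] by (simp add: M_def power_int_minus power_int_inverse power_inverse)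
      then show ?thesis
        using acts_conj(2)[OF acts_rho_tor[OF w'(1)] w'(2) rho_tor_inv(2)[OF w] s j, of t] by (simp add: Z_def)
    qed
    show "swi is * A \<in> grp" by (intro grp_mult grp_swi s A)
  qed
  moreover have "Z t * (swi is * A) = swi is * y j t * (sw is * swi is) * A"
    by (simp only: Z_def mult.assoc)
  ultimately show ?thesis by (simp add: sw_swi)
qed

lemma p_left_x:
  assumes s: "set is \<subseteq> I" and j: "j \<in> I" and d: "dot (refls is rho) (sroot j) < 0" and A: "A \<in> grp"
  shows "p (swi is * x j t * A) = p (swi is * A)"
proof -
  define Z where "Z t = swi is * x j t * sw is" for t
  define M where "M = 4 * nat (- dot (refls is rho) (sroot j))"
  have "p (Z t * (swi is * A)) = p (swi is * A)"
  proof (rule limit_left[where M = M])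
    show "isCont Z t" for t
      unfolding Z_def[abs_def] using isCont_x[OF j, of t] by (intro isCont_mult) auto
    show "Z 0 = 1" by (simp add: Z_def swi_sw)
    show "Z t \<in> grp" for t unfolding Z_def by (intro grp_mult grp_swi grp_sw grp_x s j)
    show "M > 0" using d by (simp add: M_def)
    show "rho_tor (inverse w) * Z t * rho_tor w = Z (w ^ M * t)" if w: "w \<noteq> 0" for w t
    proof -
      have w': "inverse w \<noteq> 0" "inverse w ^ 4 \<noteq> 0" using w by auto
      have "(inverse w ^ 4) powi dot (refls is rho) (sroot j) = (w ^ 4) powi (- dot (refls is rho) (sroot j))"
        by (simp add: power_int_minus power_int_inverse power_inverse)
      also have "\<dots> = w ^ M" unfolding M_def by (rule powi_nat) (use d in simp)
      finally show ?thesis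
        using acts_conj(1)[OF acts_rho_tor[OF w'(1)] w'(2) rho_tor_inv(2)[OF w] s j, of t] by (simp add: Z_def)
    qed
    show "swi is * A \<in> grp" by (intro grp_mult grp_swi s A)
  qed
  moreover have "Z t * (swi is * A) = swi is * x j t * (sw is * swi is) * A"
    by (simp only: Z_def mult.assoc)
  ultimately show ?thesis by (simp add: sw_swi)
qed

lemma p_right_x:
  assumes s: "set is \<subseteq> I" and j: "j \<in> I" and d: "0 < dot (refls is rho) (sroot j)" and A: "A \<in> grp"
  shows "p (A * x j t * sw is) = p (A * sw is)"
proof -
  define Z where "Z t = swi is * x j t * sw is" for t
  define M where "M = 4 * nat (dot (refls is rho) (sroot j))"
  have "p ((A * sw is) * Z t) = p (A * sw is)"
  proof (rule limit_right[where M = M])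
    show "isCont Z t" for t
      unfolding Z_def[abs_def] using isCont_x[OF j, of t] by (intro isCont_mult) auto
    show "Z 0 = 1" by (simp add: Z_def swi_sw)
    show "Z t \<in> grp" for t unfolding Z_def by (intro grp_mult grp_swi grp_sw grp_x s j)
    show "M > 0" using d by (simp add: M_def)
    show "rho_tor w * Z t * rho_tor (inverse w) = Z (w ^ M * t)" if w: "w \<noteq> 0" for w t
    proof -
      have w': "w ^ 4 \<noteq> 0" using w by auto
      have "(w ^ 4) powi dot (refls is rho) (sroot j) = w ^ M"
        unfolding M_def by (rule powi_nat[OF d])
      then show ?thesis
        using acts_conj(1)[OF acts_rho_tor[OF w] w' rho_tor_inv(1)[OF w] s j, of t] by (simp add: Z_def)
    qed
    show "A * sw is \<in> grp" by (intro grp_mult grp_sw s A)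
  qed
  moreover have "(A * sw is) * Z t = A * (sw is * swi is) * x j t * sw is"
    by (simp only: Z_def mult.assoc)
  ultimately show ?thesis by (simp add: sw_swi)
qed

text \<open>Moved to the left of \<open>swi is\<close>, the coroot element becomes that of the
  coroot transformed by the inverse of \<open>is\<close>. There \<open>p\<close> transforms by the
  weight \<open>omega k\<close>.\<close>

lemma p_left_co:
  assumes j: "j \<in> I" and c: "c \<noteq> 0"
  shows "set is \<subseteq> I \<Longrightarrow> A \<in> grp \<Longrightarrow>
    p (swi is * co j c * A) = c powi dot (refls is (omega k)) (sroot j) * p (swi is * A)"
  using j c
proof (induction "is" arbitrary: A j c)
  case Nil
  have "p (tor ((\<lambda>_. 1)(j := c)) * A) = ((\<lambda>_. 1)(j := c)) k * p A"
    by (rule p_tor(1)) (use Nil in auto)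
  then show ?case
    using Nil dot_omega_sroot[OF k, of j] by (simp add: co_tor[symmetric])
next
  case (Cons i "is")
  have i: "i \<in> I" "set is \<subseteq> I" using Cons.prems by auto
  let ?d = "c powi (- cartan n j i)"
  have d: "?d \<noteq> 0" using Cons.prems by simp
  have "sbi i * (co j c * sb i) * sbi i = (sbi i * sb i) * co i ?d * co j c * sbi i"
    unfolding co_sb[OF i(1) Cons.prems(3,4)] by (simp only: mult.assoc)
  then have "sbi i * co j c * (sb i * sbi i) = co i ?d * co j c * sbi i"
    by (simp add: sbi_sb mult.assoc)
  then have "sbi i * co j c = co i ?d * co j c * sbi i" by (simp add: sb_sbi)
  then have "p (swi (i # is) * co j c * A) = p (swi is * co i ?d * (co j c * (sbi i * A)))"
    by (simp add: swi_Cons mult.assoc)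
  also have "\<dots> = ?d powi dot (refls is (omega k)) (sroot i) * p (swi is * co j c * (sbi i * A))"
    using Cons.IH[of "co j c * (sbi i * A)" i ?d] i d Cons.prems
    by (simp add: grp_mult grp_co grp_sbi mult.assoc)
  also have "p (swi is * co j c * (sbi i * A)) = c powi dot (refls is (omega k)) (sroot j) * p (swi (i # is) * A)"
    using Cons.IH[of "sbi i * A" j c] i Cons.prems
    by (simp add: grp_mult grp_sbi mult.assoc swi_Cons)
  also have "?d powi dot (refls is (omega k)) (sroot i) * (c powi dot (refls is (omega k)) (sroot j) * p (swi (i # is) * A))
      = c powi dot (refls (i # is) (omega k)) (sroot j) * p (swi (i # is) * A)"
  proof -
    have "dot (refls (i # is) (omega k)) (sroot j)
        = - cartan n j i * dot (refls is (omega k)) (sroot i) + dot (refls is (omega k)) (sroot j)"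
      using cartan_dot[OF Cons.prems(3) i(1)] by (simp add: dot_reflect dot_commute[of "sroot i" "sroot j"])
    then show ?thesis
      using Cons.prems(4) by (simp only: power_int_add power_int_mult simp_thms mult.assoc)
  qed
  finally show ?case .
qed

lemma p_left_X:
  assumes s: "set is \<subseteq> I" and neg: "\<And>j. j \<in> I \<Longrightarrow> dot (refls is rho) (sroot j) < 0"
  shows "fst ` set v \<subseteq> I \<Longrightarrow> A \<in> grp \<Longrightarrow> p (swi is * X v * A) = p (swi is * A)"
proof (induction v)
  case (Cons a v)
  obtain i t where a: "a = (i, t)" by force
  have i: "i \<in> I" using Cons.prems a by simp
  have "p (swi is * X (a # v) * A) = p (swi is * x i t * (X v * A))"
    by (simp only: a X_Cons mult.assoc)
  also have "\<dots> = p (swi is * (X v * A))"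
    by (rule p_left_x[OF s i neg[OF i]]) (use Cons.prems in \<open>auto intro!: grp_mult grp_X\<close>)
  finally show ?case using Cons by (simp add: mult.assoc)
qed simp

text \<open>The letter \<open>x i\<close> that arrives to the right of \<open>sb i\<close> stands
  before the lift of the remaining letters. As the word is ascending, moving it past that lift turns
  it into an upper root subgroup, under which \<open>p\<close> is invariant on the right.\<close>

lemma p_Theta:
  "ascending (map fst L) \<Longrightarrow> (\<And>i c. (i, c) \<in> set L \<Longrightarrow> c \<noteq> 0) \<Longrightarrow> A \<in> grp \<Longrightarrow>
    p (A * Theta L) = p (A * X (left_word L) * sw (map fst L))"
proof (induction L arbitrary: A)
  case Nil
  then show ?case by (simp add: Theta_def)
next
  case (Cons a L)
  obtain i c where a: "a = (i, c)" by force
  have c: "c \<noteq> 0" using Cons.prems(2)[of i c] a by simp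
  have i: "i \<in> I" and pp: "ascending (map fst L)" and d: "0 < dot (refls (map fst L) rho) (sroot i)"
    using Cons.prems(1) a by auto
  have sL: "set (map fst L) \<subseteq> I" using ascending_set[OF pp] .
  have u: "fst ` set (left_word L) \<subseteq> I" by (rule fst_left_word) (use sL in auto)
  define B where "B = A * X (left_word (a # L)) * sb i"
  have B: "B \<in> grp"
    unfolding B_def by (intro grp_mult Cons.prems grp_X grp_sb i fst_left_word) (use i sL a in auto)
  have "p (A * Theta (a # L)) = p ((A * (y i c * co i (inverse c))) * Theta L)"
    by (simp add: a Theta_def mult.assoc)
  also have "\<dots> = p (A * (y i c * co i (inverse c)) * X (left_word L) * sw (map fst L))"
    by (rule Cons.IH[OF pp]) (use Cons.prems i c in \<open>auto intro!: grp_mult grp_y grp_co\<close>)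
  also have "A * (y i c * co i (inverse c)) * X (left_word L) * sw (map fst L)
      = A * x i (inverse c) * (sb i * x i c * X (left_word L)) * sw (map fst L)"
    unfolding y_co[OF i c] by (simp only: mult.assoc)
  also have "\<dots> = B * x i (c + chi i (left_word L)) * sw (map fst L)"
    unfolding trans[OF i u] B_def by (simp only: a left_word.simps X_Cons mult.assoc)
  also have "p \<dots> = p (B * sw (map fst L))"
    by (rule p_right_x[OF sL i d B])
  finally show ?case by (simp add: B_def a sw_Cons mult.assoc)
qed

lemma p_minor:
  assumes w0: "longest_element n w0" and ws: "reduced_word n ws (w0 \<circ> simple_refl n k)"
    and L: "map fst L = i0 (n - 1)" "\<And>i c. (i, c) \<in> set L \<Longrightarrow> c \<noteq> 0"
  shows "p (swi ws * Theta L) = chi k (left_word L)"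
proof -
  note F = longest_word_facts[OF w0 k ws]
  have sk: "set (k # ws) \<subseteq> I" and sws: "set ws \<subseteq> I" using ascending_set[OF F(1)] by auto
  have p0: "ascending (i0 (n - 1))" using n4 by (intro ascending_i0) simp
  define u where "u = left_word L"
  have "fst ` set L \<subseteq> I" using set_i0[of "n - 1"] L(1) by (metis set_map)
  then have u: "fst ` set u \<subseteq> I" unfolding u_def by (rule fst_left_word)
  define t where "t = chi k u"
  \<comment> \<open>With \<open>a = 0\<close>, \<open>trans\<close> splits \<open>X u\<close> into
    the conjugate of \<open>X v\<close> by the inverse of \<open>sb k\<close>, followed by
    \<open>x k t\<close>. The first factor disappears because \<open>k # ws\<close> is a word of
    w_0, which makes every simple root negative.\<close>
  define v where "v = trans k 0 u"
  have v: "fst ` set v \<subseteq> I" unfolding v_def by (rule fst_trans[OF kI u])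
  \<comment> \<open>Here Matsumoto's theorem enters: both words are ascending and represent
    w_0.\<close>
  have sw0: "sw (i0 (n - 1)) = sb k * sw ws"
    using matsumoto[OF p0 F(1) F(2)[symmetric]] by (simp add: sw_Cons)
  have "sbi k * (sb k * x k 0 * X u) = sbi k * (X v * sb k * x k t)"
    unfolding trans[OF kI u] by (simp add: v_def t_def)
  then have Xu: "X u = sbi k * (X v * sb k * x k t)"
    by (simp add: mult.assoc[symmetric] sbi_sb)
  have "p (swi ws * Theta L) = p (swi ws * X u * sw (i0 (n - 1)))"
    using p_Theta[of L "swi ws"] p0 L grp_swi[OF sws] by (simp add: u_def)
  also have "\<dots> = p (swi (k # ws) * X v * (sb k * x k t * sw (i0 (n - 1))))"
    unfolding Xu by (simp only: swi_Cons mult.assoc)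
  also have "\<dots> = p (swi (k # ws) * (sb k * x k t * sw (i0 (n - 1))))"
    by (rule p_left_X[OF sk F(4) v]) (use kI in \<open>auto intro!: grp_mult grp_sb grp_x grp_sw set_i0\<close>)
  also have "\<dots> = p (swi ws * (sbi k * sb k) * x k t * sb k * sw ws)"
    unfolding sw0 swi_Cons by (simp only: mult.assoc)
  also have "\<dots> = p (swi ws * x k t * (sb k * sw ws))"
    by (simp add: sbi_sb mult.assoc)
  also have "\<dots> = t"
  proof -
    have kpos: "0 < dot (refls ws rho) (sroot k)" using F(1) by simp
    have nz: "p (swi ws * x k t * (sb k * sw ws)) = t" if t: "t \<noteq> 0" for t
    proof -
      have "swi ws * x k t * (sb k * sw ws) = swi ws * (x k t * sb k) * sw ws"
        by (simp only: mult.assoc)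
      also have "\<dots> = swi ws * y k (inverse t) * (co k t * (x k (- inverse t) * sw ws))"
        unfolding x_sb[OF kI t] by (simp only: mult.assoc)
      also have "p \<dots> = p (swi ws * (co k t * (x k (- inverse t) * sw ws)))"
        by (rule p_left_y[OF sws kI kpos]) (use kI t sws in \<open>auto intro!: grp_mult grp_co grp_x grp_sw\<close>)
      also have "\<dots> = p (swi ws * co k t * (x k (- inverse t) * sw ws))"
        by (simp only: mult.assoc)
      \<comment> \<open>The exponent of \<open>t\<close> is the pairing of
        \<open>refls ws (omega k)\<close> with \<open>\<alpha>\<^sub>k\<close>, which is 1.\<close>
      also have "\<dots> = t * p (swi ws * (x k (- inverse t) * sw ws))"
        using p_left_co[OF kI t sws, of "x k (- inverse t) * sw ws"] F(3) grp_mult[OF grp_x[OF kI] grp_sw[OF sws]]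
        by simp
      also have "p (swi ws * (x k (- inverse t) * sw ws)) = p (swi ws * sw ws)"
        using p_right_x[OF sws kI kpos grp_swi[OF sws], of "- inverse t"] by (simp add: mult.assoc)
      finally show ?thesis by (simp add: swi_sw p_1)
    qed
    \<comment> \<open>\<open>x_sb\<close> requires a nonzero parameter. The value at 0 follows
      because the left side is a polynomial in \<open>t\<close>.\<close>
    obtain q where q: "\<And>t. p (swi ws * gen True k t * (sb k * sw ws)) = poly q t"
      using polylike_p kI unfolding polylike_def by blast
    have "poly q 0 - 0 = 0"
    proof (rule tendsto_const_at_0[of "\<lambda>w. poly q w - w"])
      show "isCont (\<lambda>w. poly q w - w) 0" by (intro continuous_intros poly_isCont)
      show "poly q w - w = 0" if "w \<noteq> 0" for w
        using nz[OF that] q[of w] by (simp add: gen_def)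
    qed
    then show ?thesis using nz q[of t] by (cases "t = 0") (auto simp: gen_def)
  qed
  finally show ?thesis by (simp add: t_def u_def)
qed

end

context D_group
begin

section \<open>The coefficients of the unipotent factor\<close>

text \<open>
  \<open>chi k\<close> and \<open>pair_sum k\<close> are the entries at \<open>(k, k + 1)\<close> and \<open>(k - 1, k + 1)\<close> of the product of the
  letters, taken as elementary unipotent matrices of type A.
\<close>

fun pair_sum :: "nat \<Rightarrow> (nat \<times> complex) list \<Rightarrow> complex" where
  "pair_sum k [] = 0"
| "pair_sum k ((j, t) # v) = (if j = k - 1 then t * chi k v else 0) + pair_sum k v"

lemma chi_trans_far: "i \<noteq> k \<Longrightarrow> cartan n i k = 0 \<Longrightarrow> chi k (trans i a v) = chi k v"
  by (induction i a v rule: trans.induct) auto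

lemma chi_trans_self: "chi i (trans i a v) = 0"
  by (induction i a v rule: trans.induct) auto

text \<open>\<open>chi k\<close> of the transformed rest is 0, so in the five letters made from
  \<open>(k - 1, t)\<close> the only contribution is that of \<open>(k - 1, t)\<close> before
  \<open>(k, 1)\<close>, namely \<open>t\<close>.\<close>

lemma pair_sum_trans: "2 \<le> k \<Longrightarrow> cartan n k (k - 1) \<noteq> 0 \<Longrightarrow> pair_sum k (trans k a v) = chi (k - 1) v"
  by (induction k a v rule: trans.induct) (auto simp: chi_trans_self)

text \<open>A letter \<open>(k, t)\<close> is left with \<open>t\<close> times the parameter
  collected so far, which is \<open>a\<close> plus the parameters of the letters
  \<open>k - 1\<close> before it.\<close>

lemma chi_trans_near:
  assumes "2 \<le> k" "cartan n (k - 1) k \<noteq> 0"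
  shows "chi k (trans (k - 1) a v) = a * chi k v + pair_sum k v"
proof (induction v arbitrary: a)
  case (Cons jt v)
  then show ?case using assms by (cases jt) (auto simp: algebra_simps)
qed simp

definition block :: "(nat \<Rightarrow> complex) \<Rightarrow> nat \<Rightarrow> (nat \<times> complex) list \<Rightarrow> (nat \<times> complex) list" where
  "block d j u = foldr (\<lambda>i v. (i, inverse (d i)) # trans i (d i) v) [j..<Suc n] u"

lemma block_step: "j \<le> n \<Longrightarrow> block d j u = (j, inverse (d j)) # trans j (d j) (block d (Suc j) u)"
proof -
  assume "j \<le> n"
  then have "[j..<Suc n] = j # [Suc j..<Suc n]" by (simp add: upt_conv_Cons del: upt_Suc)
  then show ?thesis unfolding block_def by (simp del: upt_Suc)
qed

text \<open>The bound \<open>i + 3 \<le> n\<close> keeps out \<open>i = n - 2\<close>, which the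
  fork of the diagram joins to \<open>n\<close>.\<close>

lemma cartan_far: "i \<in> I \<Longrightarrow> j \<in> I \<Longrightarrow> i + 2 \<le> j \<Longrightarrow> i + 3 \<le> n \<Longrightarrow> cartan n i j = 0 \<and> cartan n j i = 0"
  unfolding cartan_def doubleton_eq_iff by (simp only: if_True simp_thms) (auto split: if_split)

lemma cartan_near: "2 \<le> k \<Longrightarrow> k \<le> n - 2 \<Longrightarrow> cartan n k (k - 1) \<noteq> 0 \<and> cartan n (k - 1) k \<noteq> 0"
  unfolding cartan_def doubleton_eq_iff by auto

lemma chi_block_above:
  assumes "1 \<le> q" "q + 3 \<le> n" "q + 2 \<le> j" "j \<le> Suc n"
  shows "chi q (block d j u) = chi q u"
  using assms(4,3)
proof (induction j rule: inc_induct)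
  case base
  then show ?case by (simp add: block_def)
next
  case (step j)
  then have "cartan n j q = 0" using cartan_far[of q j] assms by auto
  then show ?case
    using step block_step[of j d u] chi_trans_far[of j q] by simp
qed

lemma chi_block_below:
  assumes "k \<le> n - 2" "1 \<le> j" "Suc j \<le> k"
  shows "chi k (block d j u) = chi k (block d (k - 1) u)"
proof -
  have "j \<le> k - 1" using assms by simp
  then show ?thesis using assms(2)
  proof (induction j rule: inc_induct)
    case (step j)
    then have "cartan n j k = 0" using cartan_far[of j k] assms by auto
    then show ?case
      using step assms block_step[of j d u] chi_trans_far[of j k] by simp
  qed simp
qed

lemma chi_block_1: "chi 1 (block d 1 u) = inverse (d 1)"
  using n4 block_step[of 1 d u] by (simp add: chi_trans_self)

text \<open>The letters above \<open>k\<close> leave \<open>chi (k - 1)\<close> unchanged. The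
  letter \<open>k\<close> sets \<open>chi k\<close> to \<open>inverse (d k)\<close> and stores the
  old \<open>chi (k - 1)\<close> in \<open>pair_sum k\<close>; the letter \<open>k - 1\<close> adds
  this to \<open>d (k - 1)\<close> times the new \<open>chi k\<close>. The letters below
  \<open>k - 1\<close> leave \<open>chi k\<close> unchanged.\<close>

lemma chi_block:
  assumes "2 \<le> k" "k \<le> n - 2"
  shows "chi k (block d 1 u) = chi (k - 1) u + d (k - 1) / d k"
proof -
  have above: "chi (k - 1) (block d (Suc k) u) = chi (k - 1) u"
    using chi_block_above[of "k - 1" "Suc k" d u] assms by simp
  have bk: "block d k u = (k, inverse (d k)) # trans k (d k) (block d (Suc k) u)"
    using block_step[of k d u] assms by simp
  have chik: "chi k (block d k u) = inverse (d k)"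
    unfolding bk by (simp add: chi_trans_self)
  have rck: "pair_sum k (block d k u) = chi (k - 1) u"
    unfolding bk using pair_sum_trans[of k] cartan_near[OF assms] above assms by simp
  have bk1: "block d (k - 1) u = (k - 1, inverse (d (k - 1))) # trans (k - 1) (d (k - 1)) (block d k u)"
    using block_step[of "k - 1" d u] assms by simp
  have "chi k (block d 1 u) = chi k (block d (k - 1) u)"
    using chi_block_below[of k 1 d u] assms by simp
  also have "\<dots> = d (k - 1) * inverse (d k) + chi (k - 1) u"
    unfolding bk1 using chi_trans_near[of k] cartan_near[OF assms] assms by (simp add: chik rck)
  finally show ?thesis by (simp add: divide_inverse)
qed

lemma left_word_foldr: "left_word L = foldr (\<lambda>(i, c) v. (i, inverse c) # trans i c v) L []"
  by (induction L rule: left_word.induct) auto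

definition blocks :: "(nat \<Rightarrow> nat \<Rightarrow> complex) \<Rightarrow> nat \<Rightarrow> (nat \<times> complex) list" where
  "blocks c m = concat (map (\<lambda>m. map (\<lambda>i. (i, c m i)) [1..<Suc n]) [m..<n])"

lemma left_word_blocks: "m < n \<Longrightarrow> left_word (blocks c m) = block (c m) 1 (left_word (blocks c (Suc m)))"
proof -
  assume "m < n"
  then have "blocks c m = map (\<lambda>i. (i, c m i)) [1..<Suc n] @ blocks c (Suc m)"
    by (simp add: blocks_def upt_conv_Cons del: upt_Suc)
  then show ?thesis by (simp add: left_word_foldr block_def foldr_map o_def del: upt_Suc)
qed

text \<open>Each step goes to the next block and to an index smaller by one, and collects one
  quotient. Index 1 is reached in block \<open>m + k\<close>, where \<open>chi_block_1\<close> ends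
  the recursion.\<close>

lemma chi_blocks:
  "1 \<le> m \<Longrightarrow> m + k < n \<Longrightarrow> Suc k \<le> n - 2 \<Longrightarrow> chi (Suc k) (left_word (blocks c m))
    = 1 / c (m + k) 1 + (\<Sum>j<k. c (m + j) (k - j) / c (m + j) (Suc k - j))"
proof (induction k arbitrary: m)
  case 0
  then show ?case using left_word_blocks[of m c] chi_block_1[of "c m"] by (simp add: divide_inverse)
next
  case (Suc k)
  have "chi (Suc (Suc k)) (left_word (blocks c m))
      = chi (Suc k) (left_word (blocks c (Suc m))) + c m (Suc k) / c m (Suc (Suc k))"
    using left_word_blocks[of m c] chi_block[of "Suc (Suc k)" "c m" "left_word (blocks c (Suc m))"] Suc.prems by simp
  also have "chi (Suc k) (left_word (blocks c (Suc m)))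
      = 1 / c (m + Suc k) 1 + (\<Sum>j<k. c (m + Suc j) (Suc k - Suc j) / c (m + Suc j) (Suc (Suc k) - Suc j))"
    using Suc.IH[of "Suc m"] Suc.prems by simp
  also have "\<dots> + c m (Suc k) / c m (Suc (Suc k))
      = 1 / c (m + Suc k) 1 + (\<Sum>j<Suc k. c (m + j) (Suc k - j) / c (m + j) (Suc (Suc k) - j))"
    unfolding sum.lessThan_Suc_shift by simp
  finally show ?case .
qed

end

section \<open>Return to matrices and conclusion\<close>

lemma cm_of_simps:
  "cm_of (A ** B) = cm_of A * cm_of B" "cm_of (A - B) = cm_of A - cm_of B"
  "cm_of (cscale z A) = scal z * cm_of A" "cm_of 0 = 0" "cm_of (mat 1) = 1"
proof -
  show "cm_of (A ** B) = cm_of A * cm_of B"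
    by (simp add: times_cm_def cm_of_inverse)
  show "cm_of (A - B) = cm_of A - cm_of B"
    by (simp add: minus_cm_def cm_of_inverse)
  show "cm_of (cscale z A) = scal z * cm_of A"
    by (rule cm_eqI) (simp, simp add: entry_def cm_of_inverse cscale_def)
qed (simp_all add: zero_cm_def one_cm_def)

lemma mat_of_exp: "mat_of (exp A) = mexp (mat_of A)"
proof -
  have pow: "mpower (mat_of A) k = mat_of (A ^ k)" for k
    by (induction k) (simp_all add: mpower_def one_cm.rep_eq times_cm.rep_eq)
  have "(\<lambda>n. entry (\<Sum>k<n. A ^ k /\<^sub>R fact k) a b) \<longlonglongrightarrow> entry (exp A) a b" for a b
    using bounded_linear.tendsto[OF bounded_linear_entry summable_LIMSEQ[OF summable_exp_generic[of A]]]
    by (simp add: exp_def)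
  moreover have "entry (\<Sum>k<n. A ^ k /\<^sub>R fact k) a b = (\<Sum>k<n. (1 / fact k) *\<^sub>R mpower (mat_of A) k) $ a $ b" for n a b
    by (induction n) (simp_all add: pow entry_def plus_cm.rep_eq scaleR_cm.rep_eq zero_cm.rep_eq divide_inverse)
  ultimately have "(\<lambda>n. \<Sum>k<n. (1 / fact k) *\<^sub>R mpower (mat_of A) k) \<longlonglongrightarrow> mat_of (exp A)"
    by (intro vec_tendstoI) (simp add: entry_def)
  then have "(\<lambda>k. (1 / fact k) *\<^sub>R mpower (mat_of A) k) sums mat_of (exp A)"
    by (simp add: sums_def)
  then show ?thesis unfolding mexp_def by (simp add: sums_iff)
qed

lemma mat_of_prod_list: "mat_of (prod_list As) = mprod (map mat_of As)"
  by (induction As) (simp_all add: mprod_def one_cm.rep_eq times_cm.rep_eq)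

lemma matrix_inv_unique:
  fixes A B :: "complex^'m^'m"
  assumes "A ** B = mat 1" "B ** A = mat 1"
  shows "matrix_inv A = B"
proof -
  have "A ** matrix_inv A = mat 1"
    unfolding matrix_inv_def by (rule someI2[of _ B]) (use assms in auto)
  then have "B ** (A ** matrix_inv A) = B" by simp
  then show ?thesis unfolding matrix_mul_assoc assms(2) by simp
qed

lemma cm_of_commutator: "cm_of (commutator A B) = cm_of A * cm_of B - cm_of B * cm_of A"
  by (simp add: commutator_def cm_of_simps)

lemma D_groupI:
  assumes "4 \<le> n" "simply_connected_D n e f wt"
  shows "D_group n (\<lambda>i. cm_of (e i)) (\<lambda>i. cm_of (f i)) wt"
proof -
  have *: "commutator (hmat wt i) (e j) = cscale (of_int (cartan n i j)) (e j)"
      "commutator (hmat wt i) (f j) = cscale (- of_int (cartan n i j)) (f j)"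
      "commutator (e i) (f j) = (if i = j then hmat wt i else 0)"
      "i \<noteq> j \<Longrightarrow> (commutator (e i) ^^ nat (1 - cartan n i j)) (e j) = 0"
      "i \<noteq> j \<Longrightarrow> (commutator (f i) ^^ nat (1 - cartan n i j)) (f j) = 0"
    if "i \<in> {1..n}" "j \<in> {1..n}" for i j
    using assms(2) that unfolding simply_connected_D_def by blast+
  have "cartan n i i \<noteq> - 1" for i by (simp add: cartan_def)
  then have d: "i \<noteq> j" if "cartan n i j = - 1" for i j using that by blast
  show ?thesis
  proof (unfold_locales)
    fix i j assume ij: "i \<in> {1..n}" "j \<in> {1..n}"
    show "cm_of (hmat wt i) * cm_of (e j) - cm_of (e j) * cm_of (hmat wt i) = scal (of_int (cartan n i j)) * cm_of (e j)"
      using *(1)[OF ij, THEN arg_cong[of _ _ cm_of]] by (simp add: cm_of_commutator cm_of_simps)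
    show "cm_of (hmat wt i) * cm_of (f j) - cm_of (f j) * cm_of (hmat wt i) = scal (- of_int (cartan n i j)) * cm_of (f j)"
      using *(2)[OF ij, THEN arg_cong[of _ _ cm_of]] by (simp add: cm_of_commutator cm_of_simps)
    show "cm_of (e i) * cm_of (f j) - cm_of (f j) * cm_of (e i) = (if i = j then cm_of (hmat wt i) else 0)"
      using *(3)[OF ij, THEN arg_cong[of _ _ cm_of]] by (simp add: cm_of_commutator cm_of_simps split: if_splits)
    show "cm_of (e i) * cm_of (e j) = cm_of (e j) * cm_of (e i)" if "i \<noteq> j" "cartan n i j = 0"
      using *(4)[OF ij that(1), THEN arg_cong[of _ _ cm_of]] that by (simp add: cm_of_commutator cm_of_simps)
    show "cm_of (f i) * cm_of (f j) = cm_of (f j) * cm_of (f i)" if "i \<noteq> j" "cartan n i j = 0"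
      using *(5)[OF ij that(1), THEN arg_cong[of _ _ cm_of]] that by (simp add: cm_of_commutator cm_of_simps)
    show "cm_of (e i) * (cm_of (e i) * cm_of (e j) - cm_of (e j) * cm_of (e i)) =
        (cm_of (e i) * cm_of (e j) - cm_of (e j) * cm_of (e i)) * cm_of (e i)" if "cartan n i j = - 1"
      using *(4)[OF ij d[OF that], THEN arg_cong[of _ _ cm_of]] that
      by (simp add: numeral_2_eq_2 cm_of_commutator cm_of_simps)
    show "cm_of (f i) * (cm_of (f i) * cm_of (f j) - cm_of (f j) * cm_of (f i)) =
        (cm_of (f i) * cm_of (f j) - cm_of (f j) * cm_of (f i)) * cm_of (f i)" if "cartan n i j = - 1"
      using *(5)[OF ij d[OF that], THEN arg_cong[of _ _ cm_of]] that
      by (simp add: numeral_2_eq_2 cm_of_commutator cm_of_simps)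
  qed (rule assms(1))
qed

theorem theorem9p2:
  fixes n k :: nat
    and e f :: "nat \<Rightarrow> complex^'m^'m"
    and wt :: "'m::finite \<Rightarrow> nat \<Rightarrow> int"
    and w0 :: "(nat \<Rightarrow> int) \<Rightarrow> (nat \<Rightarrow> int)"
    and \<Delta> :: "complex^'m^'m \<Rightarrow> complex"
    and c :: "nat \<Rightarrow> nat \<Rightarrow> complex"
  assumes "n \<ge> 4"
    and "simply_connected_D n e f wt"
    and "longest_element n w0"
    and "k \<in> {1..n - 2}"
    and "principal_minor n e f wt k \<Delta>"
    and "\<And>m i. m \<in> {1..n - 1} \<Longrightarrow> i \<in> {1..n} \<Longrightarrow> c m i \<noteq> 0"
  shows "gen_minor n e f \<Delta> (w0 \<circ> simple_refl n k) id (Theta_minus n f wt c)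
    = 1 / c k 1 + (\<Sum>j = 1..k - 1. c j (k - j) / c j (k - j + 1))"
proof -
  interpret D: D_group n "\<lambda>i. cm_of (e i)" "\<lambda>i. cm_of (f i)" wt
    by (rule D_groupI[OF assms(1,2)])
  have xop: "mat_of (D.x i t) = one_param e i t" and yop: "mat_of (D.y i t) = one_param f i t" for i t
    by (simp_all add: D.x_def D.y_def mat_of_exp one_param_def cm_of_simps(3)[symmetric] cm_of_inverse)
  have coop: "mat_of (D.co i t) = coroot wt i t" for i t
    by (simp add: D.co_def cm_of_inverse)
  have torop: "mat_of (D.tor t) = torus_element n wt t" for t
    by (simp add: D.tor_def torus_element_def mat_of_prod_list o_def coop del: upt_Suc)
  have sbop: "mat_of (D.sb i) = sbar e f i" for i
    by (simp add: D.sb_def sbar_def times_cm.rep_eq xop yop)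
  have grp: "mat_of A \<in> group_G n e f" if "A \<in> D.grp" for A
  proof -
    have "D.indexed ls \<Longrightarrow> mat_of (D.W ls) \<in> group_G n e f" for ls
    proof (induction ls)
      case Nil
      then show ?case by (simp add: one_cm.rep_eq group_G_def generated_group.one)
    next
      case (Cons l ls)
      obtain b i t where l: "l = (b, i, t)" using prod_cases3 by blast
      have "mat_of (D.gen b i t) \<in> group_G n e f"
        using Cons.prems unfolding group_G_def D.gen_def l
        by (intro generated_group.gen) (auto simp: D.indexed_def xop yop)
      then show ?case
        using Cons unfolding group_G_def by (simp add: l times_cm.rep_eq generated_group.mult D.indexed_def)
    qed
    then show ?thesis using that by (auto simp: D.grp_def)
  qed
  have YU: "mat_of (D.Y u) \<in> unipotent n f" if "fst ` set u \<subseteq> {1..n}" for u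
    using that
  proof (induction u)
    case Nil
    then show ?case by (simp add: one_cm.rep_eq unipotent_def generated_group.one)
  next
    case (Cons a u)
    obtain i t where a: "a = (i, t)" by force
    have "mat_of (D.y i t) \<in> unipotent n f"
      using Cons.prems unfolding unipotent_def yop a by (intro generated_group.gen) auto
    then show ?case
      using Cons unfolding unipotent_def by (simp add: a D.Y_Cons times_cm.rep_eq generated_group.mult)
  qed
  have XU: "mat_of (D.X u) \<in> unipotent n e" if "fst ` set u \<subseteq> {1..n}" for u
    using that
  proof (induction u)
    case Nil
    then show ?case by (simp add: one_cm.rep_eq unipotent_def generated_group.one)
  next
    case (Cons a u)
    obtain i t where a: "a = (i, t)" by force
    have "mat_of (D.x i t) \<in> unipotent n e"
      using Cons.prems unfolding unipotent_def xop a by (intro generated_group.gen) auto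
    then show ?case
      using Cons unfolding unipotent_def by (simp add: a D.X_Cons times_cm.rep_eq generated_group.mult)
  qed
  obtain q where q: "polynomial_map q" "\<And>A. A \<in> group_G n e f \<Longrightarrow> \<Delta> A = q A"
    and val: "\<And>u v t. u \<in> unipotent n f \<Longrightarrow> v \<in> unipotent n e \<Longrightarrow> (\<forall>j\<in>{1..n}. t j \<noteq> 0) \<Longrightarrow>
        \<Delta> (u ** torus_element n wt t ** v) = t k"
    using assms(5) unfolding principal_minor_def by blast
  \<comment> \<open>The function \<Delta> is tied to a polynomial on the group only;
    \<open>p\<close> is that polynomial, so it satisfies the locale assumption on all
    matrices.\<close>
  define p where "p A = q (mat_of A)" for A :: "'m cm"
  have pD: "p A = \<Delta> (mat_of A)" if "A \<in> D.grp" for A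
    using q(2)[OF grp[OF that]] by (simp add: p_def)
  interpret M: minor_D n "\<lambda>i. cm_of (e i)" "\<lambda>i. cm_of (f i)" wt p k
  proof unfold_locales
    show "1 \<le> k" "k \<le> n - 2" using assms(4) by auto
    show "\<exists>q. polynomial_map q \<and> (\<forall>A. p A = q (mat_of A))" using q(1) by (auto simp: p_def)
    fix u v :: "(nat \<times> complex) list" and t :: "nat \<Rightarrow> complex"
    assume u: "fst ` set u \<subseteq> {1..n}" and v: "fst ` set v \<subseteq> {1..n}" and t: "\<And>i. i \<in> {1..n} \<Longrightarrow> t i \<noteq> 0"
    have "D.Y u * D.tor t * D.X v \<in> D.grp"
      by (intro D.grp_mult D.grp_Y D.grp_X D.grp_tor u v t)
    from pD[OF this] show "p (D.Y u * D.tor t * D.X v) = t k"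
      using val[OF YU[OF u] XU[OF v], of t] t by (simp add: times_cm.rep_eq torop)
  qed
  define L where "L = D.blocks c 1"
  have L1: "map fst L = D.i0 (n - 1)"
    by (simp add: L_def D.blocks_def D.i0_def map_concat o_def map_replicate_const del: upt_Suc)
  have L2: "d \<noteq> 0" if "(i, d) \<in> set L" for i d
    using that assms(6) by (auto simp: L_def D.blocks_def simp del: upt_Suc)
  have Theta: "Theta_minus n f wt c = mat_of (D.Theta L)"
  proof -
    have conc: "prod_list (concat Ls) = prod_list (map prod_list Ls)" for Ls :: "'m cm list list"
      by (induction Ls) simp_all
    have "D.Theta L = prod_list (map (\<lambda>m. prod_list (map (\<lambda>i. D.y i (c m i) * D.co i (inverse (c m i))) [1..<Suc n])) [1..<n])"
      by (simp add: D.Theta_def L_def D.blocks_def map_concat conc o_def del: upt_Suc)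
    then show ?thesis
      by (simp add: Theta_minus_def mat_of_prod_list o_def ybold_def times_cm.rep_eq yop coop del: upt_Suc)
  qed
  define w where "w = w0 \<circ> simple_refl n k"
  obtain is0 where is0: "set is0 \<subseteq> {1..n}" "word_refl n is0 = w0"
    using assms(3) unfolding longest_element_def weyl_group_def by auto
  have "w = word_refl n (is0 @ [k])"
    by (simp add: w_def D.word_refl_append D.word_refl_Cons D.word_refl_Nil is0)
  then have "w \<in> weyl_group n"
    using is0(1) M.kI by (auto simp: weyl_group_def intro!: exI[of _ "is0 @ [k]"])
  then obtain ws' where "reduced_word n ws' w" using D.ex_reduced by blast
  \<comment> \<open>The word chosen in \<open>wbar\<close>.\<close>
  define ws where "ws = (SOME is. reduced_word n is w)"
  have ws: "reduced_word n ws w"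
    unfolding ws_def by (rule someI) fact
  have sws: "set ws \<subseteq> {1..n}" using ws by (simp add: reduced_word_def)
  have wbar: "wbar n e f w = mat_of (D.sw ws)"
    by (simp add: wbar_def ws_def[symmetric] D.sw_def mat_of_prod_list o_def sbop)
  have inv: "matrix_inv (wbar n e f w) = mat_of (D.swi ws)"
  proof (rule matrix_inv_unique)
    show "wbar n e f w ** mat_of (D.swi ws) = mat 1"
      using arg_cong[OF D.sw_swi[of ws], of mat_of] by (simp add: wbar times_cm.rep_eq one_cm.rep_eq)
    show "mat_of (D.swi ws) ** wbar n e f w = mat 1"
      using arg_cong[OF D.swi_sw[of ws], of mat_of] by (simp add: wbar times_cm.rep_eq one_cm.rep_eq)
  qed
  have wid: "wbar n e f id = mat 1"
  proof -
    have l0: "weyl_length n id = 0"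
      unfolding weyl_length_def by (rule Least_eq_0) (auto simp: word_refl_def)
    have "reduced_word n [] id" by (simp add: reduced_word_def l0 word_refl_def)
    then have "reduced_word n (SOME is. reduced_word n is id) id" by (rule someI)
    then have "(SOME is. reduced_word n is id) = []" by (simp add: reduced_word_def l0)
    then show ?thesis by (simp add: wbar_def mprod_def)
  qed
  have ThG: "D.Theta L \<in> D.grp"
  proof -
    have "(\<And>i d. (i, d) \<in> set L' \<Longrightarrow> i \<in> {1..n} \<and> d \<noteq> 0) \<Longrightarrow> D.Theta L' \<in> D.grp" for L'
    proof (induction L')
      case (Cons a L')
      obtain i d where a: "a = (i, d)" by force
      then have i: "i \<in> {1..n}" and d: "inverse d \<noteq> 0" using Cons.prems[of i d] by auto
      have eq: "D.Theta (a # L') = D.y i d * D.co i (inverse d) * D.Theta L'" by (simp add: D.Theta_def a)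
      have "D.Theta L' \<in> D.grp" by (rule Cons.IH) (use Cons.prems in auto)
      then show ?case unfolding eq by (intro D.grp_mult D.grp_y D.grp_co i d)
    qed (simp add: D.Theta_def)
    moreover have "i \<in> {1..n}" if "(i, d) \<in> set L" for i d
      using that by (auto simp: L_def D.blocks_def simp del: upt_Suc)
    ultimately show ?thesis using L2 by blast
  qed
  have "gen_minor n e f \<Delta> w id (Theta_minus n f wt c) = \<Delta> (mat_of (D.swi ws * D.Theta L))"
    by (simp add: gen_minor_def inv wid Theta times_cm.rep_eq)
  also have "\<dots> = p (D.swi ws * D.Theta L)"
    by (rule pD[symmetric]) (intro D.grp_mult D.grp_swi ThG sws)
  also have "\<dots> = D.chi k (D.left_word L)"
    by (rule M.p_minor[OF assms(3) ws[unfolded w_def] L1 L2])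
  also have "\<dots> = 1 / c k 1 + (\<Sum>j = 1..k - 1. c j (k - j) / c j (k - j + 1))"
  proof -
    obtain k' where k': "k = Suc k'" using assms(4) by (cases k) auto
    have "D.chi k (D.left_word L) = 1 / c k 1 + (\<Sum>j<k'. c (1 + j) (k' - j) / c (1 + j) (Suc k' - j))"
      using D.chi_blocks[of 1 k' c] assms(1,4) by (simp add: L_def k')
    also have "(\<Sum>j<k'. c (1 + j) (k' - j) / c (1 + j) (Suc k' - j))
        = (\<Sum>j = 1..k - 1. c j (k - j) / c j (k - j + 1))"
      by (rule sum.reindex_bij_witness[of _ "\<lambda>j. j - 1" "\<lambda>j. j + 1"]) (auto simp: k' Suc_diff_le)
    finally show ?thesis .
  qed
  finally show ?thesis by (simp add: w_def)
qed

end
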